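(* Let $\Gamma\subset\mathfrak{B}_d^0$ be a (finite) convex point configuration and let $\mathrm{LG}(1,\Gamma)$ be the associated prelinked Grassmannian over $\mathrm{Spec}(R)$. Then the locus of simple points of $\mathrm{LG}(1,\Gamma)$ is dense in every fiber of $\mathrm{LG}(1,\Gamma)\to\mathrm{Spec}(R)$.
   Context: Setting: $R$ is a discrete valuation ring with uniformiser $\pi$, quotient field $K$, valuation $\mathrm{val}$, and residue field $k$, which is assumed algebraically closed. $V$ is a $K$-vector space of dimension $d$. A lattice is a free $R$-submodule of $V$ of rank $d$; $\mathfrak{B}_d^0$ is the set of homothety classes $[L]$ of lattices ($L\sim cL$, $c\in K^\times$). A point configuration is a finite subset of $\mathfrak{B}_d^0$; it is convex if for all $[L],[L']\in\Gamma$ every class $[\pi^aL\cap\pi^bL']$ ($a,b\in\mathbb{Z}$) is in $\Gamma$. Two distinct classes are adjacent if they have representatives $L',M'$ with $\pi M'\subset L'\subset M'$. The scheme $\mathrm{LG}(r,\Gamma)$: fix a basis $e_1,\dots,e_d$ of $V$ and the reference lattice $L=Re_1+\dots+Re_d$. Let $G$ be the directed graph whose vertices $v$ are the classes $[L_v]\in\Gamma$, with an edge from $v$ to $w$ (and one from $w$ to $v$) whenever $[L_v],[L_w]$ are adjacent. For each $v$ choose $g_v\in\mathrm{GL}(V)$ with $[g_vL]=[L_v]$. For adjacent $v,w$ let $f_{v,w}$ be the scalar multiple of $g_w^{-1}g_v$ (unique up to a unit of $R$) whose matrix with respect to $e_1,\dots,e_d$ has all entries of valuation $\ge0$ and at least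 one entry of valuation $0$; thus $f_{v,w}:L\to L$. $\mathrm{LG}(r,\Gamma)$ is the projective $R$-scheme representing the functor that associates to an $R$-scheme $T$ the set of families $(\mathcal{F}_v)_{v\in\Gamma}$ of rank-$r$ subbundles $\mathcal{F}_v\subset L\otimes_R\mathcal{O}_T$ with $f_{v,w}(\mathcal{F}_v)\subset\mathcal{F}_w$ for every edge $v\to w$. For a directed path $P$ in $G$, $f_P$ denotes the composition of the edge maps along $P$ (the identity if $P$ is a single vertex). Simple points ($r=1$): for a field $k'$ over $R$, a $k'$-valued point $(F_v)_v$ of $\mathrm{LG}(1,\Gamma)$ is simple if there are a vertex $v'$ and $s\in F_{v'}$ such that for every vertex $v$ there is a path $P$ from $v'$ to $v$ with $f_P(s)$ a basis of the line $F_v$. *)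

theory Defs
  imports
    "HOL-Algebra.Algebraic_Closure_Type"
    "HOL-Library.Poly_Mapping"
    "HOL-Analysis.Abstract_Topology"
begin

section \<open>Discrete valuation rings\<close>

abbreviation ring_of :: "'r::comm_ring_1 itself \<Rightarrow> 'r ring" where
  "ring_of _ \<equiv> ring_of_type_algebra"

definition discrete_valuation_ring :: "('a, 'm) ring_scheme \<Rightarrow> bool" where
  "discrete_valuation_ring R \<longleftrightarrow>
     principal_domain R \<and> \<not> field R \<and> (\<exists>!m. maximalideal m R)"

definition uniformiser :: "('a, 'm) ring_scheme \<Rightarrow> 'a \<Rightarrow> bool" where
  "uniformiser R \<pi> \<longleftrightarrow> \<pi> \<in> carrier R \<and> maximalideal (PIdl\<^bsub>R\<^esub> \<pi>) R"

text \<open>The valuation on the quotient field \<^typ>\<open>'r fract\<close> of a discrete valuation ring with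
  uniformiser \<open>\<pi>\<close>.  It is meaningful only for nonzero arguments; \<open>val 0 = \<infinity>\<close> is treated separately
  wherever the valuation is used.\<close>
definition val :: "'r::idom \<Rightarrow> 'r fract \<Rightarrow> int" where
  "val \<pi> x = (THE n. \<exists>u. u dvd 1 \<and> x = to_fract u * to_fract \<pi> powi n)"


section \<open>Lattices and point configurations\<close>

definition R_scale :: "('r::idom fract \<Rightarrow> 'v::ab_group_add \<Rightarrow> 'v) \<Rightarrow> 'r \<Rightarrow> 'v \<Rightarrow> 'v" where
  "R_scale scale a = scale (to_fract a)"

definition lattice :: "('r::idom fract \<Rightarrow> 'v::ab_group_add \<Rightarrow> 'v) \<Rightarrow> 'v set \<Rightarrow> bool" where
  "lattice scale L \<longleftrightarrow>
     (\<exists>C. finite C \<and> card C = vector_space.dim scale UNIV \<and>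
          \<not> Modules.module.dependent (R_scale scale) C \<and>
          L = Modules.module.span (R_scale scale) C)"

definition lattice_class :: "('r::idom fract \<Rightarrow> 'v::ab_group_add \<Rightarrow> 'v) \<Rightarrow> 'v set \<Rightarrow> 'v set set" where
  "lattice_class scale L = {scale c ` L | c. c \<noteq> 0}"

definition building :: "('r::idom fract \<Rightarrow> 'v::ab_group_add \<Rightarrow> 'v) \<Rightarrow> 'v set set set" where
  "building scale = {lattice_class scale L | L. lattice scale L}"

definition point_configuration ::
  "('r::idom fract \<Rightarrow> 'v::ab_group_add \<Rightarrow> 'v) \<Rightarrow> 'v set set set \<Rightarrow> bool" where
  "point_configuration scale \<Gamma> \<longleftrightarrow> finite \<Gamma> \<and> \<Gamma> \<subseteq> building scale"

definition convex_configuration ::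
  "('r::idom fract \<Rightarrow> 'v::ab_group_add \<Rightarrow> 'v) \<Rightarrow> 'r \<Rightarrow> 'v set set set \<Rightarrow> bool" where
  "convex_configuration scale \<pi> \<Gamma> \<longleftrightarrow>
     (\<forall>v\<in>\<Gamma>. \<forall>w\<in>\<Gamma>. \<forall>L\<in>v. \<forall>L'\<in>w. \<forall>a b :: int.
        lattice_class scale (scale (to_fract \<pi> powi a) ` L \<inter> scale (to_fract \<pi> powi b) ` L') \<in> \<Gamma>)"

definition adjacent ::
  "('r::idom fract \<Rightarrow> 'v::ab_group_add \<Rightarrow> 'v) \<Rightarrow> 'r \<Rightarrow> 'v set set \<Rightarrow> 'v set set \<Rightarrow> bool" where
  "adjacent scale \<pi> v w \<longleftrightarrow>
     v \<noteq> w \<and> (\<exists>L'\<in>v. \<exists>M'\<in>w. scale (to_fract \<pi>) ` M' \<subseteq> L' \<and> L' \<subseteq> M')"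


section \<open>The edge maps\<close>

definition GL :: "('K::field \<Rightarrow> 'v::ab_group_add \<Rightarrow> 'v) \<Rightarrow> ('v \<Rightarrow> 'v) set" where
  "GL scale = {g. Vector_Spaces.linear scale scale g \<and> bij g}"

text \<open>Matrix entries with respect to the basis \<open>B\<close>, rows and columns being indexed by the
  elements of \<open>B\<close>.\<close>
definition entry ::
  "('r::idom fract \<Rightarrow> 'v::ab_group_add \<Rightarrow> 'v) \<Rightarrow> 'v set \<Rightarrow> ('v \<Rightarrow> 'v) \<Rightarrow> 'v \<Rightarrow> 'v \<Rightarrow> 'r fract" where
  "entry scale B h a b = Modules.module.representation scale B (h b) a"

definition normalised ::
  "('r::idom fract \<Rightarrow> 'v::ab_group_add \<Rightarrow> 'v) \<Rightarrow> 'r \<Rightarrow> 'v set \<Rightarrow> ('v \<Rightarrow> 'v) \<Rightarrow> bool" where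
  "normalised scale \<pi> B h \<longleftrightarrow>
     (\<forall>a\<in>B. \<forall>b\<in>B. entry scale B h a b \<noteq> 0 \<longrightarrow> val \<pi> (entry scale B h a b) \<ge> 0) \<and>
     (\<exists>a\<in>B. \<exists>b\<in>B. entry scale B h a b \<noteq> 0 \<and> val \<pi> (entry scale B h a b) = 0)"

text \<open>\<open>g\<close> is a choice of the \<open>g\<^sub>v\<close> and \<open>f\<close> a choice of the \<open>f\<^sub>v\<^sub>,\<^sub>w\<close>; the reference lattice is
  the \<open>R\<close>-span of \<open>B\<close>.\<close>
definition prelinked_chain ::
  "('r::idom fract \<Rightarrow> 'v::ab_group_add \<Rightarrow> 'v) \<Rightarrow> 'r \<Rightarrow> 'v set \<Rightarrow> 'v set set set \<Rightarrow>
   ('v set set \<Rightarrow> 'v \<Rightarrow> 'v) \<Rightarrow> ('v set set \<Rightarrow> 'v set set \<Rightarrow> 'v \<Rightarrow> 'v) \<Rightarrow> bool" where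
  "prelinked_chain scale \<pi> B \<Gamma> g f \<longleftrightarrow>
     (\<forall>v\<in>\<Gamma>. g v \<in> GL scale \<and>
        lattice_class scale (g v ` Modules.module.span (R_scale scale) B) = v) \<and>
     (\<forall>v\<in>\<Gamma>. \<forall>w\<in>\<Gamma>. adjacent scale \<pi> v w \<longrightarrow>
        (\<exists>c. c \<noteq> 0 \<and> f v w = (\<lambda>x. scale c (inv_into UNIV (g w) (g v x)))) \<and>
        normalised scale \<pi> B (f v w))"


section \<open>Field-valued points\<close>

text \<open>For a field \<open>k\<close> over \<open>R\<close>, with structure map \<open>\<phi>\<close>, the space \<open>L \<otimes> k\<close> is the space \<open>k\<^sup>B\<close> of
  extensional functions on the basis \<open>B\<close>.\<close>

definition field_over :: "'r::comm_ring_1 itself \<Rightarrow> 'e ring \<Rightarrow> ('r \<Rightarrow> 'e) \<Rightarrow> bool" where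
  "field_over R k \<phi> \<longleftrightarrow> field k \<and> \<phi> \<in> ring_hom (ring_of R) k"

definition span1 :: "'v set \<Rightarrow> 'e ring \<Rightarrow> ('v \<Rightarrow> 'e) \<Rightarrow> ('v \<Rightarrow> 'e) set" where
  "span1 B k s = {\<lambda>b\<in>B. c \<otimes>\<^bsub>k\<^esub> s b | c. c \<in> carrier k}"

definition basis_of_line :: "'v set \<Rightarrow> 'e ring \<Rightarrow> ('v \<Rightarrow> 'e) \<Rightarrow> ('v \<Rightarrow> 'e) set \<Rightarrow> bool" where
  "basis_of_line B k s F \<longleftrightarrow>
     s \<in> B \<rightarrow>\<^sub>E carrier k \<and> s \<noteq> (\<lambda>b\<in>B. \<zero>\<^bsub>k\<^esub>) \<and> F = span1 B k s"

definition line :: "'v set \<Rightarrow> 'e ring \<Rightarrow> ('v \<Rightarrow> 'e) set \<Rightarrow> bool" where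
  "line B k F \<longleftrightarrow> (\<exists>s. basis_of_line B k s F)"

text \<open>The base change \<open>L \<otimes> k \<rightarrow> L \<otimes> k\<close> of a map \<open>h : L \<rightarrow> L\<close>; here \<open>h\<close> is given as an
  endomorphism of \<open>V\<close> whose matrix has entries in \<open>R\<close>.\<close>
definition base_change ::
  "('r::idom fract \<Rightarrow> 'v::ab_group_add \<Rightarrow> 'v) \<Rightarrow> 'v set \<Rightarrow> 'e ring \<Rightarrow> ('r \<Rightarrow> 'e) \<Rightarrow>
   ('v \<Rightarrow> 'v) \<Rightarrow> ('v \<Rightarrow> 'e) \<Rightarrow> ('v \<Rightarrow> 'e)" where
  "base_change scale B k \<phi> h s =
     (\<lambda>a\<in>B. \<Oplus>\<^bsub>k\<^esub>b\<in>B. \<phi> (the_inv to_fract (entry scale B h a b)) \<otimes>\<^bsub>k\<^esub> s b)"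

definition LG_field_point ::
  "('r::idom fract \<Rightarrow> 'v::ab_group_add \<Rightarrow> 'v) \<Rightarrow> 'r \<Rightarrow> 'v set \<Rightarrow> 'v set set set \<Rightarrow>
   ('v set set \<Rightarrow> 'v set set \<Rightarrow> 'v \<Rightarrow> 'v) \<Rightarrow>
   'e ring \<Rightarrow> ('r \<Rightarrow> 'e) \<Rightarrow> ('v set set \<Rightarrow> ('v \<Rightarrow> 'e) set) \<Rightarrow> bool" where
  "LG_field_point scale \<pi> B \<Gamma> f k \<phi> F \<longleftrightarrow>
     field_over TYPE('r) k \<phi> \<and>
     (\<forall>v\<in>\<Gamma>. line B k (F v)) \<and>
     (\<forall>v\<in>\<Gamma>. \<forall>w\<in>\<Gamma>. adjacent scale \<pi> v w \<longrightarrow>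
        base_change scale B k \<phi> (f v w) ` F v \<subseteq> F w)"

text \<open>A directed path is the nonempty list of its vertices.\<close>
definition path_from_to ::
  "('r::idom fract \<Rightarrow> 'v::ab_group_add \<Rightarrow> 'v) \<Rightarrow> 'r \<Rightarrow> 'v set set set \<Rightarrow>
   'v set set \<Rightarrow> 'v set set \<Rightarrow> 'v set set list \<Rightarrow> bool" where
  "path_from_to scale \<pi> \<Gamma> v w P \<longleftrightarrow>
     P \<noteq> [] \<and> hd P = v \<and> last P = w \<and> set P \<subseteq> \<Gamma> \<and> successively (adjacent scale \<pi>) P"

fun path_map :: "('p \<Rightarrow> 'p \<Rightarrow> 'a \<Rightarrow> 'a) \<Rightarrow> 'p list \<Rightarrow> 'a \<Rightarrow> 'a" where
  "path_map h (v # w # P) s = path_map h (w # P) (h v w s)"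
| "path_map h _ s = s"

definition simple_field_point ::
  "('r::idom fract \<Rightarrow> 'v::ab_group_add \<Rightarrow> 'v) \<Rightarrow> 'r \<Rightarrow> 'v set \<Rightarrow> 'v set set set \<Rightarrow>
   ('v set set \<Rightarrow> 'v set set \<Rightarrow> 'v \<Rightarrow> 'v) \<Rightarrow>
   'e ring \<Rightarrow> ('r \<Rightarrow> 'e) \<Rightarrow> ('v set set \<Rightarrow> ('v \<Rightarrow> 'e) set) \<Rightarrow> bool" where
  "simple_field_point scale \<pi> B \<Gamma> f k \<phi> F \<longleftrightarrow>
     LG_field_point scale \<pi> B \<Gamma> f k \<phi> F \<and>
     (\<exists>v'\<in>\<Gamma>. \<exists>s\<in>F v'. \<forall>v\<in>\<Gamma>. \<exists>P. path_from_to scale \<pi> \<Gamma> v' v P \<and>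
        basis_of_line B k (path_map (\<lambda>u w. base_change scale B k \<phi> (f u w)) P s) (F v))"


section \<open>The underlying topological space of the scheme\<close>

text \<open>\<open>LG(1,\<Gamma>)\<close> is a closed subscheme of the product over \<open>v \<in> \<Gamma>\<close> of the projective spaces of
  lines in \<open>L\<close>, that is, of the multiprojective \<open>Proj\<close> of the polynomial ring
  \<open>S = R[x\<^sub>v\<^sub>,\<^sub>b | v \<in> \<Gamma>, b \<in> B]\<close>.\<close>

type_synonym ('p, 'b, 'r) mpoly = "(('p \<times> 'b) \<Rightarrow>\<^sub>0 nat) \<Rightarrow>\<^sub>0 'r"

definition multihomogeneous :: "'b set \<Rightarrow> 'p set \<Rightarrow> ('p, 'b, 'r::zero) mpoly \<Rightarrow> bool" where
  "multihomogeneous B \<Gamma> q \<longleftrightarrow>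
     (\<exists>deg. \<forall>m\<in>Poly_Mapping.keys q. Poly_Mapping.keys m \<subseteq> \<Gamma> \<times> B \<and>
        (\<forall>v\<in>\<Gamma>. (\<Sum>b\<in>B. Poly_Mapping.lookup m (v, b)) = deg v))"

definition eval_mpoly ::
  "'e ring \<Rightarrow> ('r::zero \<Rightarrow> 'e) \<Rightarrow> ('p \<times> 'b \<Rightarrow> 'e) \<Rightarrow> ('p, 'b, 'r) mpoly \<Rightarrow> 'e" where
  "eval_mpoly k \<phi> x q =
     (\<Oplus>\<^bsub>k\<^esub>m\<in>Poly_Mapping.keys q. \<phi> (Poly_Mapping.lookup q m) \<otimes>\<^bsub>k\<^esub>
        (\<Otimes>\<^bsub>k\<^esub>i\<in>Poly_Mapping.keys m. x i [^]\<^bsub>k\<^esub> Poly_Mapping.lookup m i))"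

text \<open>The point of the scheme underlying a field-valued point.  A point of the multiprojective
  \<open>Proj\<close> is a multihomogeneous prime ideal of \<open>S\<close>, and is encoded here by the set of
  multihomogeneous elements of that ideal, which determines it.  For the image of
  \<open>Spec k\<close> these are the multihomogeneous polynomials vanishing on the lines \<open>F v\<close>.\<close>
definition point_of ::
  "'v set \<Rightarrow> 'p set \<Rightarrow> 'e ring \<Rightarrow> ('r::zero \<Rightarrow> 'e) \<Rightarrow> ('p \<Rightarrow> ('v \<Rightarrow> 'e) set) \<Rightarrow> ('p, 'v, 'r) mpoly set" where
  "point_of B \<Gamma> k \<phi> F =
     {q. multihomogeneous B \<Gamma> q \<and>
         (\<forall>s. (\<forall>v\<in>\<Gamma>. s v \<in> F v) \<longrightarrow> eval_mpoly k \<phi> (\<lambda>(v, b). s v b) q = \<zero>\<^bsub>k\<^esub>)}"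

text \<open>A type large enough to carry, for every prime ideal \<open>P\<close> of \<open>S\<close>, the fraction field of
  \<open>S / P\<close>, whose elements are equivalence classes of pairs of polynomials.  Every point of the scheme
  underlies a field-valued point over such a field, so letting \<open>k\<close> range over the fields
  carried by this type yields all points.\<close>
type_synonym ('p, 'b, 'r) universe = "(('p, 'b, 'r) mpoly \<times> ('p, 'b, 'r) mpoly) set"

definition LG_points ::
  "('r::idom fract \<Rightarrow> 'v::ab_group_add \<Rightarrow> 'v) \<Rightarrow> 'r \<Rightarrow> 'v set \<Rightarrow> 'v set set set \<Rightarrow>
   ('v set set \<Rightarrow> 'v set set \<Rightarrow> 'v \<Rightarrow> 'v) \<Rightarrow> ('v set set, 'v, 'r) mpoly set set" where
  "LG_points scale \<pi> B \<Gamma> f =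
     {point_of B \<Gamma> k \<phi> F | (k :: ('v set set, 'v, 'r) universe ring) \<phi> F.
        LG_field_point scale \<pi> B \<Gamma> f k \<phi> F}"

definition simple_locus ::
  "('r::idom fract \<Rightarrow> 'v::ab_group_add \<Rightarrow> 'v) \<Rightarrow> 'r \<Rightarrow> 'v set \<Rightarrow> 'v set set set \<Rightarrow>
   ('v set set \<Rightarrow> 'v set set \<Rightarrow> 'v \<Rightarrow> 'v) \<Rightarrow> ('v set set, 'v, 'r) mpoly set set" where
  "simple_locus scale \<pi> B \<Gamma> f =
     {point_of B \<Gamma> k \<phi> F | (k :: ('v set set, 'v, 'r) universe ring) \<phi> F.
        simple_field_point scale \<pi> B \<Gamma> f k \<phi> F}"

text \<open>The Zariski topology, with basis the sets \<open>D(q)\<close> for \<open>q\<close> multihomogeneous; \<open>D(1)\<close> is the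
  whole space.\<close>
definition LG_space ::
  "('r::idom fract \<Rightarrow> 'v::ab_group_add \<Rightarrow> 'v) \<Rightarrow> 'r \<Rightarrow> 'v set \<Rightarrow> 'v set set set \<Rightarrow>
   ('v set set \<Rightarrow> 'v set set \<Rightarrow> 'v \<Rightarrow> 'v) \<Rightarrow> ('v set set, 'v, 'r) mpoly set topology" where
  "LG_space scale \<pi> B \<Gamma> f =
     topology_generated_by
       {{p \<in> LG_points scale \<pi> B \<Gamma> f. q \<notin> p} | q. multihomogeneous B \<Gamma> q}"

lemma one_notin_LG_point:
  fixes \<pi> :: "'r::idom" and scale :: "'r fract \<Rightarrow> 'v::ab_group_add \<Rightarrow> 'v"
  assumes "p \<in> LG_points scale \<pi> B \<Gamma> f"
  shows "1 \<notin> p"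
proof -
  obtain k :: "('v set set, 'v, 'r) universe ring" and \<phi> F where
    p: "p = point_of B \<Gamma> k \<phi> F" and F: "LG_field_point scale \<pi> B \<Gamma> f k \<phi> F"
    using assms unfolding LG_points_def by blast
  interpret k: field k
    using F unfolding LG_field_point_def field_over_def by blast
  have \<phi>1: "\<phi> 1 = \<one>\<^bsub>k\<^esub>"
    using F ring_hom_one[of \<phi> "ring_of TYPE('r)" k]
    unfolding LG_field_point_def field_over_def ring_of_type_algebra_def by simp
  have "\<forall>v\<in>\<Gamma>. \<exists>s. s \<in> F v"
    using F unfolding LG_field_point_def line_def basis_of_line_def span1_def by blast
  then obtain s where s: "\<forall>v\<in>\<Gamma>. s v \<in> F v"
    unfolding bchoice_iff by blast
  have eval: "eval_mpoly k \<phi> x 1 = \<one>\<^bsub>k\<^esub>" for x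
    unfolding eval_mpoly_def by (simp add: \<phi>1)
  show ?thesis
  proof
    assume "1 \<in> p"
    then have "eval_mpoly k \<phi> (\<lambda>(v, b). s v b) 1 = \<zero>\<^bsub>k\<^esub>"
      unfolding p point_of_def using s by blast
    then show False
      unfolding eval by simp
  qed
qed

lemma topspace_LG_space: "topspace (LG_space scale \<pi> B \<Gamma> f) = LG_points scale \<pi> B \<Gamma> f"
proof -
  have "multihomogeneous B \<Gamma> 1"
    unfolding multihomogeneous_def by (intro exI[of _ "\<lambda>_. 0"]) simp
  then show ?thesis
    unfolding LG_space_def topology_generated_by_topspace
    using one_notin_LG_point[of _ scale \<pi> B \<Gamma> f] by blast
qed

text \<open>The structure map to \<open>Spec R\<close> contracts a prime ideal of \<open>S\<close> to the constants.  The fiber over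
  a prime \<open>\<pp>\<close> of \<open>R\<close>, as a topological space, is the preimage of \<open>\<pp>\<close> with the subspace topology.\<close>
definition structure_map :: "('p, 'b, 'r::zero) mpoly set \<Rightarrow> 'r set" where
  "structure_map p = {a. Poly_Mapping.single 0 a \<in> p}"

definition LG_fiber ::
  "('r::idom fract \<Rightarrow> 'v::ab_group_add \<Rightarrow> 'v) \<Rightarrow> 'r \<Rightarrow> 'v set \<Rightarrow> 'v set set set \<Rightarrow>
   ('v set set \<Rightarrow> 'v set set \<Rightarrow> 'v \<Rightarrow> 'v) \<Rightarrow> 'r set \<Rightarrow> ('v set set, 'v, 'r) mpoly set topology" where
  "LG_fiber scale \<pi> B \<Gamma> f \<pp> =
     subtopology (LG_space scale \<pi> B \<Gamma> f) {p. structure_map p = \<pp>}"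

end

theory Submission
  imports Defs
begin

text \<open>
  Write \<open>L\<^sub>v\<close> for the lattice \<open>g v\<close> applied to the reference lattice.  For vertices \<open>v\<close> and \<open>w\<close> let
  the distance from \<open>v\<close> to \<open>w\<close> be the least \<open>j\<close> with \<open>\<pi>\<^sup>j L\<^sub>v \<subseteq> L\<^sub>w\<close>, and let \<open>H v w\<close> be the base
  change to a field \<open>k\<close> of this inclusion.  If the distances from \<open>u\<close> to \<open>v\<close> and from \<open>v\<close> to \<open>w\<close> add
  up to the distance from \<open>u\<close> to \<open>w\<close>, then \<open>H v w \<circ> H u v = H u w\<close>; otherwise the composition
  is \<open>H u w\<close> multiplied by a positive power of \<open>\<pi>\<close>.  By convexity any two vertices are joined by a
  path along which distances add up, so \<open>H v w\<close> is a nonzero multiple of the map of that path.  Hence a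
  \<open>k\<close>-valued point is a family of lines spanned by vectors \<open>s v \<noteq> 0\<close> such that \<open>H v w (s v)\<close> is a
  multiple of \<open>s w\<close> for all \<open>v\<close> and \<open>w\<close>, and it is simple as soon as some \<open>v\<close> generates every \<open>w\<close>,
  meaning \<open>H v w (s v) \<noteq> 0\<close>.

  If \<open>\<pi>\<close> is invertible in \<open>k\<close>, every \<open>H v w\<close> is injective and every point is simple.  Let \<open>\<pi>\<close> be zero
  in \<open>k\<close>.  Now compositions along detours vanish, so generation is a partial order on the vertices, and
  simplicity means that it has a least element.  Convexity enters through exactness (\<open>exactness\<close>): a
  vector at \<open>v\<close> that is killed by all \<open>H v w\<close> with \<open>w\<close> in a set \<open>S\<close> comes from the lattice of those
  elements of \<open>L\<^sub>v\<close> whose images in all these \<open>L\<^sub>w\<close> are divisible by \<open>\<pi>\<close>.  This lattice is an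
  intersection of lattices of the configuration, hence belongs to it.

  Exactness has two consequences.  First, below every vertex there is only one minimal vertex
  (\<open>minimal_unique\<close>).  Secondly, a point that is not simple deforms (\<open>deformation\<close>): if \<open>v\<close> is minimal
  but not least, apply exactness to \<open>s v\<close> and the set \<open>S\<close> of vertices that \<open>v\<close> does not generate.  The
  resulting vertex \<open>u\<close> is adjacent to \<open>v\<close>, and \<open>s v\<close> comes from \<open>u\<close>.  As \<open>v\<close> is minimal, \<open>s u\<close> dies
  at \<open>v\<close> and therefore comes from some \<open>z\<close> at \<open>v\<close>.  Replace \<open>s v\<close> by \<open>s v + t z\<close>, push this vector
  forward to the vertices generated by \<open>v\<close>, and keep the lines at the vertices of \<open>S\<close>.  For almost all
  \<open>t\<close> this is a point with the same relations as before, and now \<open>v\<close> also generates \<open>u\<close>, because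
  \<open>H v u (s v + t z) = t s u\<close>.

  Finally, a neighbourhood of a point contains the locus where finitely many polynomials do not vanish.
  Along the deformation they become polynomials in \<open>t\<close> that are not identically zero.  Since \<open>k\<close> contains
  the algebraically closed residue field, it is infinite, so the deformation can stay inside the
  neighbourhood without changing \<open>k\<close>.  A point of the neighbourhood with the largest number of relations
  is therefore simple (\<open>special_simple_point_nearby\<close>).
\<close>

section \<open>Lines in a vector space\<close>

context module
begin

definition line_through :: "'c \<Rightarrow> 'c set" where
  "line_through x = {c \<odot>\<^bsub>M\<^esub> x | c. c \<in> carrier R}"

lemma line_through_self: "x \<in> carrier M \<Longrightarrow> x \<in> line_through x"
  unfolding line_through_def by (intro CollectI exI[of _ "\<one>"]) simp

lemma line_through_zero: "x \<in> carrier M \<Longrightarrow> \<zero>\<^bsub>M\<^esub> \<in> line_through x"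
  unfolding line_through_def by (intro CollectI exI[of _ "\<zero>"]) simp

lemma line_through_closed: "x \<in> carrier M \<Longrightarrow> y \<in> line_through x \<Longrightarrow> y \<in> carrier M"
  unfolding line_through_def by auto

lemma line_through_smult:
  "x \<in> carrier M \<Longrightarrow> y \<in> line_through x \<Longrightarrow> c \<in> carrier R \<Longrightarrow> c \<odot>\<^bsub>M\<^esub> y \<in> line_through x"
  unfolding line_through_def by (auto simp: smult_assoc1[symmetric])

lemma line_through_trans:
  "x \<in> carrier M \<Longrightarrow> y \<in> line_through x \<Longrightarrow> z \<in> line_through y \<Longrightarrow> z \<in> line_through x"
  using line_through_smult unfolding line_through_def[of y] by blast

end

locale vector_space_over = V?: module k E + F?: field k
  for k :: "('e, 'm) ring_scheme" (structure) and E :: "('e, 'x, 'n) module_scheme" (structure)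
begin

lemma smult_inverse:
  assumes "c \<in> carrier k" "c \<noteq> \<zero>\<^bsub>k\<^esub>" "x \<in> carrier E"
  shows "inv\<^bsub>k\<^esub> c \<odot>\<^bsub>E\<^esub> (c \<odot>\<^bsub>E\<^esub> x) = x"
  using assms field_Units smult_assoc1[of "inv\<^bsub>k\<^esub> c" c x] by (simp add: Units_l_inv)

lemma inverse_closed: "c \<in> carrier k \<Longrightarrow> c \<noteq> \<zero>\<^bsub>k\<^esub> \<Longrightarrow> inv\<^bsub>k\<^esub> c \<in> carrier k - {\<zero>\<^bsub>k\<^esub>}"
  using field_Units Units_inv_Units[of c] by auto

lemma smult_eq_zero:
  assumes "c \<in> carrier k" "x \<in> carrier E" "c \<odot>\<^bsub>E\<^esub> x = \<zero>\<^bsub>E\<^esub>"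
  shows "c = \<zero>\<^bsub>k\<^esub> \<or> x = \<zero>\<^bsub>E\<^esub>"
  using assms smult_inverse inverse_closed smult_r_null by (metis DiffD1)

lemma line_through_sym:
  assumes "x \<in> carrier E" "y \<in> line_through x" "y \<noteq> \<zero>\<^bsub>E\<^esub>"
  shows "x \<in> line_through y"
proof -
  obtain c where c: "c \<in> carrier k" "y = c \<odot>\<^bsub>E\<^esub> x"
    using assms unfolding line_through_def by auto
  with assms have "c \<noteq> \<zero>\<^bsub>k\<^esub>" by auto
  then have "x = inv\<^bsub>k\<^esub> c \<odot>\<^bsub>E\<^esub> y" "inv\<^bsub>k\<^esub> c \<in> carrier k"
    using c assms smult_inverse inverse_closed by auto
  then show ?thesis
    unfolding line_through_def by auto
qed

end

section \<open>Deforming families of lines over a metric configuration\<close>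

text \<open>The linear algebra of the special fiber in isolation: \<open>D\<close> is an asymmetric integral distance on the
  vertices, and \<open>H v w\<close> is the reduction of the inclusion of the largest multiple of \<open>L\<^sub>v\<close> that
  is contained in \<open>L\<^sub>w\<close>.  In the last axiom \<open>u\<close> stands for the intersection of \<open>L\<^sub>v\<close> with the lattices
  \<open>\<pi>\<^bsup>1 - D v w\<^esup> L\<^sub>w\<close> for \<open>w \<in> S\<close>: the strict inequalities say that this lattice is contained in each of
  them, and the final clause says that it contains every multiple \<open>\<pi>\<^sup>j L\<^sub>z\<close> that they all contain.\<close>
locale geodesic_representation = vector_space_over k E
  for k :: "('e, 'm) ring_scheme" (structure) and E :: "('e, 'x, 'n) module_scheme" (structure) +
  fixes \<Gamma> :: "'p set"
    and D :: "'p \<Rightarrow> 'p \<Rightarrow> int"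
    and H :: "'p \<Rightarrow> 'p \<Rightarrow> 'x \<Rightarrow> 'x"
  assumes finite_vertices: "finite \<Gamma>"
    and D_self: "v \<in> \<Gamma> \<Longrightarrow> D v v = 0"
    and D_triangle: "u \<in> \<Gamma> \<Longrightarrow> v \<in> \<Gamma> \<Longrightarrow> w \<in> \<Gamma> \<Longrightarrow> D u w \<le> D u v + D v w"
    and D_separates: "v \<in> \<Gamma> \<Longrightarrow> w \<in> \<Gamma> \<Longrightarrow> v \<noteq> w \<Longrightarrow> 1 \<le> D v w + D w v"
    and H_closed: "v \<in> \<Gamma> \<Longrightarrow> w \<in> \<Gamma> \<Longrightarrow> x \<in> carrier E \<Longrightarrow> H v w x \<in> carrier E"
    and H_add: "v \<in> \<Gamma> \<Longrightarrow> w \<in> \<Gamma> \<Longrightarrow> x \<in> carrier E \<Longrightarrow> y \<in> carrier E \<Longrightarrow>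
        H v w (x \<oplus>\<^bsub>E\<^esub> y) = H v w x \<oplus>\<^bsub>E\<^esub> H v w y"
    and H_smult: "v \<in> \<Gamma> \<Longrightarrow> w \<in> \<Gamma> \<Longrightarrow> c \<in> carrier k \<Longrightarrow> x \<in> carrier E \<Longrightarrow>
        H v w (c \<odot>\<^bsub>E\<^esub> x) = c \<odot>\<^bsub>E\<^esub> H v w x"
    and H_self: "v \<in> \<Gamma> \<Longrightarrow> x \<in> carrier E \<Longrightarrow> H v v x = x"
    and H_geodesic: "u \<in> \<Gamma> \<Longrightarrow> v \<in> \<Gamma> \<Longrightarrow> w \<in> \<Gamma> \<Longrightarrow> x \<in> carrier E \<Longrightarrow>
        D u w = D u v + D v w \<Longrightarrow> H v w (H u v x) = H u w x"
    and H_detour: "u \<in> \<Gamma> \<Longrightarrow> v \<in> \<Gamma> \<Longrightarrow> w \<in> \<Gamma> \<Longrightarrow> x \<in> carrier E \<Longrightarrow>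
        D u w \<noteq> D u v + D v w \<Longrightarrow> H v w (H u v x) = \<zero>\<^bsub>E\<^esub>"
    and H_exact: "v \<in> \<Gamma> \<Longrightarrow> S \<subseteq> \<Gamma> \<Longrightarrow> x \<in> carrier E \<Longrightarrow> x \<noteq> \<zero>\<^bsub>E\<^esub> \<Longrightarrow>
        (\<And>w. w \<in> S \<Longrightarrow> H v w x = \<zero>\<^bsub>E\<^esub>) \<Longrightarrow>
        \<exists>u\<in>\<Gamma>. \<exists>y\<in>carrier E. x = H u v y \<and> (\<forall>w\<in>S. D u w < D u v + D v w) \<and>
          (\<forall>z\<in>\<Gamma>. \<forall>j. D z v \<le> j \<longrightarrow> (\<forall>w\<in>S. D z w < j + D v w) \<longrightarrow> D z u + D u v \<le> j)"
begin

lemma H_zero: "v \<in> \<Gamma> \<Longrightarrow> w \<in> \<Gamma> \<Longrightarrow> H v w \<zero>\<^bsub>E\<^esub> = \<zero>\<^bsub>E\<^esub>"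
  using H_smult[of v w "\<zero>\<^bsub>k\<^esub>" "\<zero>\<^bsub>E\<^esub>"] H_closed[of v w "\<zero>\<^bsub>E\<^esub>"] by simp

lemma H_there_and_back:
  assumes "v \<in> \<Gamma>" "w \<in> \<Gamma>" "v \<noteq> w" "x \<in> carrier E"
  shows "H w v (H v w x) = \<zero>\<^bsub>E\<^esub>"
  using assms D_separates[of v w] D_self[of v] by (intro H_detour) auto

text \<open>If \<open>S\<close> is nonempty, the intersection lattice is properly contained in \<open>L\<^sub>v\<close>, but it contains
  \<open>\<pi> L\<^sub>v\<close>; so \<open>u\<close> is a neighbour of \<open>v\<close>.\<close>
lemma H_exact_nonempty:
  assumes "v \<in> \<Gamma>" "S \<subseteq> \<Gamma>" "S \<noteq> {}" "x \<in> carrier E" "x \<noteq> \<zero>\<^bsub>E\<^esub>"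
    and "\<And>w. w \<in> S \<Longrightarrow> H v w x = \<zero>\<^bsub>E\<^esub>"
  obtains u y where "u \<in> \<Gamma>" "y \<in> carrier E" "x = H u v y" "u \<noteq> v" "D u v + D v u = 1"
    "\<forall>w\<in>S. D u w < D u v + D v w"
    "\<forall>z\<in>\<Gamma>. \<forall>j. D z v \<le> j \<longrightarrow> (\<forall>w\<in>S. D z w < j + D v w) \<longrightarrow> D z u + D u v \<le> j"
proof -
  obtain u y where u: "u \<in> \<Gamma>" "y \<in> carrier E" "x = H u v y"
    "\<forall>w\<in>S. D u w < D u v + D v w"
    "\<forall>z\<in>\<Gamma>. \<forall>j. D z v \<le> j \<longrightarrow> (\<forall>w\<in>S. D z w < j + D v w) \<longrightarrow> D z u + D u v \<le> j"
    using H_exact[of v S x] assms by auto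
  have "u \<noteq> v"
    using u(4) assms(1,3) D_self[of v] by force
  moreover have "D v u + D u v \<le> 1"
    using u(5)[rule_format, of v 1] assms(1) D_self[of v] by auto
  ultimately show thesis
    using D_separates[of u v] assms(1) u by (intro that[of u y]) auto
qed

text \<open>Since \<open>H v u\<close> kills \<open>x\<close>, exactness provides a preimage at some \<open>u'\<close> whose lattice lies in that of
  \<open>u\<close>; then \<open>u\<close> is on a geodesic from \<open>u'\<close> to \<open>v\<close>, and the preimage can be pushed to \<open>u\<close>.\<close>
lemma kernel_of_adjacent:
  assumes "v \<in> \<Gamma>" "u \<in> \<Gamma>" "D u v + D v u = 1" "x \<in> carrier E" "H v u x = \<zero>\<^bsub>E\<^esub>"
  obtains y where "y \<in> carrier E" "x = H u v y"
proof (cases "x = \<zero>\<^bsub>E\<^esub>")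
  case True
  then show ?thesis
    using H_zero[of u v] assms that[of "\<zero>\<^bsub>E\<^esub>"] by auto
next
  case False
  have "\<exists>u'\<in>\<Gamma>. \<exists>y\<in>carrier E. x = H u' v y \<and> (\<forall>w\<in>{u}. D u' w < D u' v + D v w)"
    using H_exact[of v "{u}" x] assms False by blast
  then obtain u' y where u': "u' \<in> \<Gamma>" "y \<in> carrier E" "x = H u' v y" "D u' u < D u' v + D v u"
    by auto
  have "D u' v = D u' u + D u v"
    using u'(4) assms D_triangle[OF u'(1) assms(2,1)] by linarith
  then have "x = H u v (H u' u y)"
    using H_geodesic[of u' u v y] u' assms by simp
  then show ?thesis
    using that H_closed u' assms by blast
qed

definition compatible :: "('p \<Rightarrow> 'x) \<Rightarrow> bool" where
  "compatible s \<longleftrightarrow> (\<forall>v\<in>\<Gamma>. s v \<in> carrier E - {\<zero>\<^bsub>E\<^esub>}) \<and>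
     (\<forall>v\<in>\<Gamma>. \<forall>w\<in>\<Gamma>. H v w (s v) \<in> line_through (s w))"

text \<open>For compatible \<open>s\<close> this says that the line at \<open>v\<close> maps onto the line at \<open>w\<close>.\<close>
definition generates :: "('p \<Rightarrow> 'x) \<Rightarrow> 'p \<Rightarrow> 'p \<Rightarrow> bool" where
  "generates s v w \<longleftrightarrow> H v w (s v) \<noteq> \<zero>\<^bsub>E\<^esub>"

context
  fixes s assumes comp: "compatible s"
begin

lemma section_closed: "v \<in> \<Gamma> \<Longrightarrow> s v \<in> carrier E"
  and section_nonzero: "v \<in> \<Gamma> \<Longrightarrow> s v \<noteq> \<zero>\<^bsub>E\<^esub>"
  and section_image: "v \<in> \<Gamma> \<Longrightarrow> w \<in> \<Gamma> \<Longrightarrow> H v w (s v) \<in> line_through (s w)"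
  using comp unfolding compatible_def by auto

lemma generates_obtains_scalar:
  assumes "v \<in> \<Gamma>" "w \<in> \<Gamma>" "generates s v w"
  obtains c where "c \<in> carrier k" "c \<noteq> \<zero>\<^bsub>k\<^esub>" "H v w (s v) = c \<odot>\<^bsub>E\<^esub> s w"
proof -
  obtain c where c: "c \<in> carrier k" "H v w (s v) = c \<odot>\<^bsub>E\<^esub> s w"
    using section_image[OF assms(1,2)] unfolding line_through_def by auto
  moreover have "c \<noteq> \<zero>\<^bsub>k\<^esub>"
    using c assms section_closed unfolding generates_def by auto
  ultimately show thesis using that by blast
qed

lemma H_after_generates:
  assumes "u \<in> \<Gamma>" "v \<in> \<Gamma>" "w \<in> \<Gamma>" "generates s u v"
  shows "H v w (H u v (s u)) = \<zero>\<^bsub>E\<^esub> \<longleftrightarrow> \<not> generates s v w"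
proof -
  obtain c where c: "c \<in> carrier k" "c \<noteq> \<zero>\<^bsub>k\<^esub>" "H u v (s u) = c \<odot>\<^bsub>E\<^esub> s v"
    using generates_obtains_scalar assms by blast
  then have "H v w (H u v (s u)) = c \<odot>\<^bsub>E\<^esub> H v w (s v)"
    using assms H_smult section_closed by simp
  then show ?thesis
    unfolding generates_def using smult_eq_zero c assms H_closed section_closed smult_r_null by metis
qed

lemma generates_self: "v \<in> \<Gamma> \<Longrightarrow> generates s v v"
  unfolding generates_def using H_self section_closed section_nonzero by simp

text \<open>The composite of two maps between the lines is nonzero, so the two legs cannot form a detour.\<close>
lemma generates_chain:
  assumes "u \<in> \<Gamma>" "v \<in> \<Gamma>" "w \<in> \<Gamma>" "generates s u v" "generates s v w"
  shows "generates s u w" and "D u w = D u v + D v w"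
proof -
  have "H v w (H u v (s u)) \<noteq> \<zero>\<^bsub>E\<^esub>"
    using H_after_generates assms by blast
  then show "D u w = D u v + D v w"
    using H_detour assms section_closed by blast
  then show "generates s u w"
    using H_geodesic assms section_closed \<open>H v w (H u v (s u)) \<noteq> \<zero>\<^bsub>E\<^esub>\<close>
    unfolding generates_def by metis
qed

lemma generates_antisym:
  assumes "v \<in> \<Gamma>" "w \<in> \<Gamma>" "generates s v w" "generates s w v"
  shows "v = w"
proof (rule ccontr)
  assume "v \<noteq> w"
  then show False
    using H_there_and_back[of v w "s v"] H_after_generates[of v w v] assms section_closed by blast
qed

lemma generates_factor:
  assumes "u \<in> \<Gamma>" "v \<in> \<Gamma>" "w \<in> \<Gamma>" "D u w = D u v + D v w" "generates s u w"
  shows "generates s u v" and "generates s v w"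
proof -
  have eq: "H v w (H u v (s u)) \<noteq> \<zero>\<^bsub>E\<^esub>"
    using H_geodesic[of u v w "s u"] assms section_closed unfolding generates_def by simp
  then show 1: "generates s u v"
    using H_zero assms unfolding generates_def by auto
  show "generates s v w"
    using eq H_after_generates 1 assms by blast
qed

text \<open>The vertex \<open>u\<close> is the last one before \<open>x\<close> on a geodesic from \<open>p\<close> to \<open>x\<close>.  It is found by applying
  exactness to \<open>s x\<close>, which dies at \<open>p\<close> because \<open>p\<close> already generates \<open>x\<close>.\<close>
lemma adjacent_predecessor:
  assumes "p \<in> \<Gamma>" "x \<in> \<Gamma>" "generates s p x" "p \<noteq> x"
  obtains u where "u \<in> \<Gamma>" "u \<noteq> x" "D u x + D x u = 1" "generates s p u" "generates s u x"
proof -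
  have zero: "H x w (s x) = \<zero>\<^bsub>E\<^esub>" if "w \<in> {p}" for w
    using generates_antisym assms that unfolding generates_def by blast
  have sub: "{p} \<subseteq> \<Gamma>" "{p} \<noteq> {}" using assms by auto
  obtain u y where u: "u \<in> \<Gamma>" "y \<in> carrier E" "s x = H u x y" "u \<noteq> x" "D u x + D x u = 1"
    and less: "\<forall>w\<in>{p}. D u w < D u x + D x w"
    and glb: "\<forall>z\<in>\<Gamma>. \<forall>j. D z x \<le> j \<longrightarrow> (\<forall>w\<in>{p}. D z w < j + D x w) \<longrightarrow> D z u + D u x \<le> j"
    by (rule H_exact_nonempty[OF assms(2) sub section_closed[OF assms(2)]
      section_nonzero[OF assms(2)] zero])
  have "D p u + D u x \<le> D p x"
    using glb[rule_format, of p "D p x"] assms D_separates[of p x] D_self[of p] by auto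
  then have "D p x = D p u + D u x"
    using D_triangle[of p u x] assms u by auto
  then show thesis
    using generates_factor[of p u x] assms u that by blast
qed

text \<open>The vertex \<open>u\<close> is the intersection of the lattices of \<open>p\<close> and \<open>q\<close> inside that of \<open>x\<close>; as \<open>p\<close> and \<open>q\<close>
  are adjacent to \<open>x\<close>, they lie on geodesics between \<open>u\<close> and \<open>x\<close>.  Suppose \<open>u\<close> did not generate \<open>x\<close>.  Then
  \<open>s u\<close> comes from some \<open>r\<close> at \<open>x\<close>, and \<open>u\<close> generates neither \<open>p\<close> nor \<open>q\<close>, so \<open>r\<close> dies at both.
  By exactness \<open>r\<close> comes from a lattice contained in that of \<open>u\<close>; passing from there to \<open>x\<close> and then to
  \<open>u\<close> is a detour, so \<open>s u = 0\<close>.\<close>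
lemma adjacent_predecessors_meet:
  assumes "p \<in> \<Gamma>" "q \<in> \<Gamma>" "x \<in> \<Gamma>" "generates s p x" "generates s q x" "p \<noteq> x" "q \<noteq> x"
    and adj: "D p x + D x p = 1" "D q x + D x q = 1"
  obtains u where "u \<in> \<Gamma>" "u \<noteq> x" "generates s u p" "generates s u q"
proof -
  let ?S = "{p, q}"
  have gen: "w \<in> \<Gamma>" "generates s w x" "w \<noteq> x" "D w x + D x w = 1" if "w \<in> ?S" for w
    using that assms by auto
  have zero: "H x w (s x) = \<zero>\<^bsub>E\<^esub>" if "w \<in> ?S" for w
    using generates_antisym gen[OF that] assms unfolding generates_def by blast
  have sub: "?S \<subseteq> \<Gamma>" "?S \<noteq> {}" using assms by auto
  obtain u y where u: "u \<in> \<Gamma>" "y \<in> carrier E" "s x = H u x y" "u \<noteq> x" "D u x + D x u = 1"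
    and less: "\<forall>w\<in>?S. D u w < D u x + D x w"
    and glb: "\<forall>z\<in>\<Gamma>. \<forall>j. D z x \<le> j \<longrightarrow> (\<forall>w\<in>?S. D z w < j + D x w) \<longrightarrow> D z u + D u x \<le> j"
    by (rule H_exact_nonempty[OF assms(3) sub section_closed[OF assms(3)]
      section_nonzero[OF assms(3)] zero])
  have geo: "D u x = D u w + D w x" "D x w = D x u + D u w" if "w \<in> ?S" for w
    using less[rule_format, OF that] gen[OF that] u D_triangle[of u w x] D_triangle[of x u w] assms(3) by auto
  have "generates s u x"
  proof (rule ccontr)
    assume "\<not> generates s u x"
    then have ux: "H u x (s u) = \<zero>\<^bsub>E\<^esub>"
      unfolding generates_def by simp
    then obtain r where r: "r \<in> carrier E" "s u = H x u r"
      using kernel_of_adjacent[of u x "s u"] u assms(3) section_closed by (metis add.commute)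
    have Hr: "H x w r = \<zero>\<^bsub>E\<^esub>" if w: "w \<in> ?S" for w
    proof (rule ccontr)
      assume "H x w r \<noteq> \<zero>\<^bsub>E\<^esub>"
      then have "H u w (s u) \<noteq> \<zero>\<^bsub>E\<^esub>"
        using H_geodesic[of x u w r] r u gen[OF w] assms(3) geo[OF w] by simp
      then have "generates s u w"
        unfolding generates_def by simp
      then show False
        using generates_chain(1)[of u w x] u gen[OF w] assms(3) \<open>\<not> generates s u x\<close> by blast
    qed
    have "r \<noteq> \<zero>\<^bsub>E\<^esub>"
      using r H_zero[of x u] u assms(3) section_nonzero[of u] by auto
    then have "\<exists>u'\<in>\<Gamma>. \<exists>y'\<in>carrier E. r = H u' x y' \<and> (\<forall>w\<in>?S. D u' w < D u' x + D x w)"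
      using H_exact[OF assms(3) sub(1) r(1) _ Hr] by blast
    then obtain u' y' where u': "u' \<in> \<Gamma>" "y' \<in> carrier E" "r = H u' x y'"
      and less': "\<And>w. w \<in> ?S \<Longrightarrow> D u' w < D u' x + D x w"
      by blast
    \<comment> \<open>The lattice that \<open>r\<close> comes from is contained in the greatest lower bound \<open>u\<close>.\<close>
    have "D u' u + D u x \<le> D u' x"
      using glb[rule_format, of u' "D u' x"] less' u' by auto
    then have "H x u r = \<zero>\<^bsub>E\<^esub>"
      using H_detour[of u' x u y'] u u' assms(3) by simp
    then show False
      using r section_nonzero u by simp
  qed
  then have "generates s u w" if "w \<in> ?S" for w
    using generates_factor(1)[of u w x] u gen[OF that] geo[OF that] assms(3) by blast
  then show thesis
    using that u by blast
qed

definition minimal :: "'p \<Rightarrow> bool" where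
  "minimal v \<longleftrightarrow> v \<in> \<Gamma> \<and> (\<forall>u\<in>\<Gamma>. generates s u v \<longrightarrow> u = v)"

lemma generated_induct [consumes 1]:
  assumes "x \<in> \<Gamma>"
    and "\<And>x. x \<in> \<Gamma> \<Longrightarrow> (\<And>u. u \<in> \<Gamma> \<Longrightarrow> u \<noteq> x \<Longrightarrow> generates s u x \<Longrightarrow> P u) \<Longrightarrow> P x"
  shows "P x"
  using assms(1)
proof (induction "card {u \<in> \<Gamma>. generates s u x}" arbitrary: x rule: less_induct)
  case less
  show ?case
  proof (rule assms(2)[OF less.prems])
    fix u assume u: "u \<in> \<Gamma>" "u \<noteq> x" "generates s u x"
    have "{w \<in> \<Gamma>. generates s w u} \<subset> {w \<in> \<Gamma>. generates s w x}"
      using generates_chain(1) generates_antisym generates_self u less.prems by blast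
    then show "P u"
      using less u finite_vertices by (simp add: psubset_card_mono)
  qed
qed

lemma exists_minimal:
  assumes "x \<in> \<Gamma>"
  shows "\<exists>v. minimal v \<and> generates s v x"
  using assms
proof (induction rule: generated_induct)
  case (1 x)
  then show ?case
    using generates_self generates_chain(1) unfolding minimal_def by (metis (full_types))
qed

text \<open>Confluence: descending from \<open>x\<close> towards \<open>v\<close> and towards \<open>w\<close> passes through neighbours \<open>p\<close> and \<open>q\<close> of
  \<open>x\<close>, which are generated by a common vertex, hence by a common minimal one.  By induction that vertex
  is the only minimal one below \<open>p\<close> and below \<open>q\<close>.\<close>
lemma minimal_unique:
  assumes "x \<in> \<Gamma>" "minimal v" "minimal w" "generates s v x" "generates s w x"
  shows "v = w"
  using assms
proof (induction arbitrary: v w rule: generated_induct)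
  case (1 x)
  show ?case
  proof (cases "v = x \<or> w = x")
    case True
    then show ?thesis
      using 1 unfolding minimal_def by auto
  next
    case False
    have vw: "v \<in> \<Gamma>" "w \<in> \<Gamma>" using 1 unfolding minimal_def by auto
    obtain p where p: "p \<in> \<Gamma>" "p \<noteq> x" "D p x + D x p = 1" "generates s v p" "generates s p x"
      using adjacent_predecessor[of v x] 1 vw False by blast
    obtain q where q: "q \<in> \<Gamma>" "q \<noteq> x" "D q x + D x q = 1" "generates s w q" "generates s q x"
      using adjacent_predecessor[of w x] 1 vw False by blast
    obtain u where u: "u \<in> \<Gamma>" "u \<noteq> x" "generates s u p" "generates s u q"
      using adjacent_predecessors_meet[of p q x] p q 1(1) by blast
    obtain m where m: "minimal m" "generates s m u"
      using exists_minimal u by blast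
    then have "generates s m p" "generates s m q"
      using generates_chain(1)[of m u] u p q unfolding minimal_def by auto
    then have "v = m" "w = m"
      using 1(2)[OF p(1,2,5) 1(3) m(1) p(4)] 1(2)[OF q(1,2,5) 1(4) m(1) q(4)] by auto
    then show ?thesis by simp
  qed
qed

text \<open>The deformation adds \<open>t z\<close> to \<open>s v\<close> for a minimal vertex \<open>v\<close> and pushes the result forward to the
  vertices that \<open>v\<close> generates; \<open>S\<close> consists of the others.  Compatibility from \<open>S\<close> to its complement
  holds because such a map kills the line: a vertex of \<open>S\<close> that generated something generated by \<open>v\<close>
  would have \<open>v\<close> as its minimal vertex.  Compatibility into \<open>S\<close> holds because the geodesics from \<open>v\<close> to
  \<open>S\<close> pass through \<open>u\<close>, where \<open>s v\<close> vanishes and \<open>z\<close> becomes \<open>s u\<close>.\<close>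
lemma deformation:
  assumes "\<Gamma> \<noteq> {}" and not_simple: "\<not> (\<exists>v\<in>\<Gamma>. \<forall>w\<in>\<Gamma>. generates s v w)"
  obtains x where "\<forall>w\<in>\<Gamma>. x w \<in> carrier E"
    "\<forall>t\<in>carrier k - {\<zero>\<^bsub>k\<^esub>}.
      (\<forall>w\<in>\<Gamma>. s w \<oplus>\<^bsub>E\<^esub> t \<odot>\<^bsub>E\<^esub> x w \<noteq> \<zero>\<^bsub>E\<^esub>) \<longrightarrow>
      compatible (\<lambda>w. s w \<oplus>\<^bsub>E\<^esub> t \<odot>\<^bsub>E\<^esub> x w) \<and>
      {(v, w) \<in> \<Gamma> \<times> \<Gamma>. generates s v w}
        \<subset> {(v, w) \<in> \<Gamma> \<times> \<Gamma>. generates (\<lambda>w. s w \<oplus>\<^bsub>E\<^esub> t \<odot>\<^bsub>E\<^esub> x w) v w}"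
proof -
  obtain v where v: "v \<in> \<Gamma>" "minimal v"
    using assms(1) exists_minimal minimal_def by blast
  define S where "S = {w \<in> \<Gamma>. \<not> generates s v w}"
  have S: "S \<subseteq> \<Gamma>" "S \<noteq> {}" "\<And>w. w \<in> S \<Longrightarrow> H v w (s v) = \<zero>\<^bsub>E\<^esub>"
    using not_simple v unfolding S_def generates_def by auto
  obtain u y where u: "u \<in> \<Gamma>" "y \<in> carrier E" "s v = H u v y" "u \<noteq> v" "D u v + D v u = 1"
    and less: "\<forall>w\<in>S. D u w < D u v + D v w"
    by (rule H_exact_nonempty[OF v(1) S(1,2) section_closed[OF v(1)] section_nonzero[OF v(1)] S(3)])
  have geo: "D v w = D v u + D u w" if "w \<in> S" for w
    using less[rule_format, OF that] u D_triangle[of v u w] v S(1) that by fastforce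
  have uv: "u \<in> S"
    using H_there_and_back[of u v y] u v unfolding S_def generates_def by simp
  have "\<not> generates s u v"
    using v u unfolding minimal_def by blast
  then obtain z where z: "z \<in> carrier E" "s u = H v u z"
    using kernel_of_adjacent[of u v "s u"] u v section_closed unfolding generates_def
    by (metis add.commute)
  \<comment> \<open>The spanning vectors outside \<open>S\<close> are rescaled images of \<open>s v\<close>; \<open>c w\<close> is the factor at \<open>w\<close>.\<close>
  define good where "good w c \<longleftrightarrow> c \<in> carrier k \<and> c \<noteq> \<zero>\<^bsub>k\<^esub> \<and> s w = c \<odot>\<^bsub>E\<^esub> H v w (s v)" for w c
  have "\<exists>c. good w c" if w: "w \<in> \<Gamma> - S" for w
  proof -
    have "generates s v w"
      using w unfolding S_def by simp
    then obtain d where d: "d \<in> carrier k" "d \<noteq> \<zero>\<^bsub>k\<^esub>" "H v w (s v) = d \<odot>\<^bsub>E\<^esub> s w"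
      using generates_obtains_scalar v w by blast
    then have "s w = inv\<^bsub>k\<^esub> d \<odot>\<^bsub>E\<^esub> H v w (s v)"
      using smult_inverse section_closed w by simp
    then show ?thesis
      unfolding good_def using inverse_closed d by blast
  qed
  then obtain c where c: "\<And>w. w \<in> \<Gamma> - S \<Longrightarrow> good w (c w)"
    by metis
  have c': "c w \<in> carrier k" "c w \<noteq> \<zero>\<^bsub>k\<^esub>" "s w = c w \<odot>\<^bsub>E\<^esub> H v w (s v)" if "w \<in> \<Gamma>" "w \<notin> S" for w
    using c that unfolding good_def by auto
  define x where "x w = (if w \<in> S then \<zero>\<^bsub>E\<^esub> else c w \<odot>\<^bsub>E\<^esub> H v w z)" for w
  show thesis
  proof (rule that; intro ballI impI)
    show "x w \<in> carrier E" if "w \<in> \<Gamma>" for w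
      unfolding x_def using that c' v z H_closed by auto
    fix t assume "t \<in> carrier k - {\<zero>\<^bsub>k\<^esub>}"
    then have t: "t \<in> carrier k" "t \<noteq> \<zero>\<^bsub>k\<^esub>"
      by auto
    let ?s = "\<lambda>w. s w \<oplus>\<^bsub>E\<^esub> t \<odot>\<^bsub>E\<^esub> x w"
    let ?e = "s v \<oplus>\<^bsub>E\<^esub> t \<odot>\<^bsub>E\<^esub> z"
    assume "\<forall>w\<in>\<Gamma>. ?s w \<noteq> \<zero>\<^bsub>E\<^esub>"
    then have nz: "?s w \<noteq> \<zero>\<^bsub>E\<^esub>" if "w \<in> \<Gamma>" for w
      using that by blast
    have e: "?e \<in> carrier E"
      using section_closed v z t by simp
    have He: "H v w ?e = H v w (s v) \<oplus>\<^bsub>E\<^esub> t \<odot>\<^bsub>E\<^esub> H v w z" if "w \<in> \<Gamma>" for w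
      using that v z t section_closed H_add H_smult by simp
    have inS: "?s w = s w" if "w \<in> S" for w
      unfolding x_def using that t S(1) section_closed by auto
    have outS: "?s w = c w \<odot>\<^bsub>E\<^esub> H v w ?e" if w: "w \<in> \<Gamma>" "w \<notin> S" for w
    proof -
      have "t \<odot>\<^bsub>E\<^esub> x w = c w \<odot>\<^bsub>E\<^esub> (t \<odot>\<^bsub>E\<^esub> H v w z)"
        using w t v z c' H_closed
        by (simp add: x_def smult_assoc1[symmetric] m_comm)
      then show ?thesis
        using He[of w] c'[OF w] w t v z section_closed H_closed smult_r_distr by auto
    qed
    have s_closed: "?s w \<in> carrier E" if "w \<in> \<Gamma>" for w
      using inS outS c' that S(1) v e H_closed section_closed by (cases "w \<in> S") auto
    \<comment> \<open>On \<open>S\<close> the pushed-forward vector lies on the old line, because it factors through \<open>u\<close>.\<close>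
    have He_S: "H v w ?e = t \<odot>\<^bsub>E\<^esub> H u w (s u)" if "w \<in> S" for w
      using He[of w] S that z H_geodesic[of v u w z] geo[OF that] v u t H_closed section_closed by auto
    have into: "H w w' (?s w) \<in> line_through (?s w')" and keep: "generates s w w' \<Longrightarrow> generates ?s w w'"
      if w: "w \<in> \<Gamma>" "w' \<in> \<Gamma>" for w w'
    proof -
      have "H w w' (?s w) \<in> line_through (?s w') \<and> (generates s w w' \<longrightarrow> generates ?s w w')"
      proof (cases "w \<in> S")
        case True
        show ?thesis
        proof (cases "generates s w w'")
          case gen: True
          have "w' \<in> S"
          proof (rule ccontr)
            assume "w' \<notin> S"
            then have "generates s v w'"
              using w unfolding S_def by simp
            moreover obtain m where m: "minimal m" "generates s m w"
              using exists_minimal w by blast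
            ultimately have "m = v"
              using minimal_unique[of w' m v] generates_chain(1)[of m w w'] v w gen
              unfolding minimal_def by blast
            then show False
              using m \<open>w \<in> S\<close> unfolding S_def by simp
          qed
          then show ?thesis
            using inS True section_image w unfolding generates_def by simp
        next
          case False
          then show ?thesis
            using inS True line_through_zero s_closed w unfolding generates_def by simp
        qed
      next
        case False
        have eq: "H w w' (?s w) = c w \<odot>\<^bsub>E\<^esub> H w w' (H v w ?e)"
          using outS[OF w(1) False] H_smult[OF w] c'[OF w(1) False] e v w H_closed by simp
        have "H v w' ?e \<in> line_through (?s w')"
        proof (cases "w' \<in> S")
          case True
          have "H v w' ?e \<in> line_through (s w')"
            unfolding He_S[OF True]
            using section_image[OF u(1) w(2)] section_closed w t by (intro line_through_smult)
          then show ?thesis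
            unfolding inS[OF True] .
        next
          case False
          have "?s w' \<in> line_through (H v w' ?e)"
            unfolding outS[OF w(2) False] using c'[OF w(2) False] line_through_def by blast
          then show ?thesis
            using line_through_sym nz w v e H_closed by blast
        qed
        then have "H w w' (H v w ?e) \<in> line_through (?s w')"
          using H_geodesic[of v w w' ?e] H_detour[of v w w' ?e] v w e line_through_zero s_closed
          by (cases "D v w' = D v w + D w w'") auto
        then have 1: "H w w' (?s w) \<in> line_through (?s w')"
          unfolding eq using line_through_smult s_closed w c' False by blast
        have "generates ?s w w'" if gen: "generates s w w'"
        proof -
          have vw: "generates s v w"
            using False w unfolding S_def by simp
          have w'S: "w' \<notin> S"
            using generates_chain(1)[OF v(1) w vw gen] w unfolding S_def by simp
          have "H w w' (H v w ?e) = H v w' ?e"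
            using generates_chain(2)[OF v(1) w vw gen] H_geodesic v w e by blast
          moreover have "H v w' ?e \<noteq> \<zero>\<^bsub>E\<^esub>"
            using outS[OF w(2) w'S] nz[OF w(2)] c'[OF w(2) w'S] by auto
          ultimately show ?thesis
            using eq c'[OF w(1) False] smult_eq_zero v w e H_closed unfolding generates_def by metis
        qed
        then show ?thesis using 1 by blast
      qed
      then show "H w w' (?s w) \<in> line_through (?s w')" "generates s w w' \<Longrightarrow> generates ?s w w'"
        by auto
    qed
    have "v \<notin> S"
      using generates_self v unfolding S_def by simp
    then have "H v u (?s v) = c v \<odot>\<^bsub>E\<^esub> (t \<odot>\<^bsub>E\<^esub> s u)"
      using outS[OF v(1)] c'[OF v(1)] e v u H_smult H_self He_S[OF uv] section_closed by simp
    then have "generates ?s v u"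
      unfolding generates_def using c'[OF v(1) \<open>v \<notin> S\<close>] t smult_eq_zero section_closed section_nonzero u
      by (metis smult_closed)
    moreover have "\<not> generates s v u"
      using uv unfolding S_def by simp
    ultimately show "compatible ?s \<and>
      {(v, w) \<in> \<Gamma> \<times> \<Gamma>. generates s v w} \<subset> {(v, w) \<in> \<Gamma> \<times> \<Gamma>. generates ?s v w}"
      unfolding compatible_def using into keep nz s_closed u v by blast
  qed
qed

end

end

section \<open>Polynomial functions on a field\<close>

lemma (in ring) eval_zero_infinite:
  assumes "domain R" "set p \<subseteq> carrier R" "infinite {t \<in> carrier R. eval p t = \<zero>}" "t \<in> carrier R"
  shows "eval p t = \<zero>"
proof -
  interpret domain R by fact
  have p: "normalize p \<in> carrier (poly_ring R)"
    using normalize_gives_polynomial[OF assms(2)] unfolding univ_poly_carrier[symmetric] .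
  have "normalize p = []"
  proof (rule ccontr)
    assume "normalize p \<noteq> []"
    then have "{t \<in> carrier R. eval p t = \<zero>} \<subseteq> {t. is_root (normalize p) t}"
      using eval_normalize assms(2) unfolding is_root_def by auto
    then show False
      using finite_number_of_roots[OF p] assms(3) finite_subset by blast
  qed
  then show ?thesis
    using eval_normalize[OF assms(2,4)] by simp
qed

text \<open>The polynomial is a coefficient list that need not be normalised, so the leading coefficient may vanish
  and closure under sums and products involves no degrees.\<close>
definition (in ring) polynomial_function :: "('a \<Rightarrow> 'a) \<Rightarrow> bool" where
  "polynomial_function h \<longleftrightarrow> (\<exists>p. set p \<subseteq> carrier R \<and> (\<forall>t\<in>carrier R. h t = eval p t))"

context cring
begin

lemma polynomial_function_closed: "polynomial_function h \<Longrightarrow> t \<in> carrier R \<Longrightarrow> h t \<in> carrier R"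
  unfolding polynomial_function_def using eval_in_carrier by auto

lemma polynomial_function_const: "c \<in> carrier R \<Longrightarrow> polynomial_function (\<lambda>_. c)"
  unfolding polynomial_function_def by (intro exI[of _ "[c]"]) auto

lemma polynomial_function_id: "polynomial_function (\<lambda>t. t)"
  unfolding polynomial_function_def by (intro exI[of _ "[\<one>, \<zero>]"]) auto

lemma polynomial_function_add:
  assumes "polynomial_function h" "polynomial_function h'"
  shows "polynomial_function (\<lambda>t. h t \<oplus> h' t)"
  using assms eval_poly_add poly_add_in_carrier unfolding polynomial_function_def by metis

lemma polynomial_function_mult:
  assumes "polynomial_function h" "polynomial_function h'"
  shows "polynomial_function (\<lambda>t. h t \<otimes> h' t)"
  using assms eval_poly_mult poly_mult_in_carrier unfolding polynomial_function_def by metis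

lemma polynomial_function_pow:
  assumes "polynomial_function h"
  shows "polynomial_function (\<lambda>t. h t [^] (n::nat))"
  by (induction n) (auto intro: polynomial_function_mult polynomial_function_const assms)

lemma polynomial_function_finsum:
  assumes "finite A" "\<And>a. a \<in> A \<Longrightarrow> polynomial_function (h a)"
  shows "polynomial_function (\<lambda>t. \<Oplus>a\<in>A. h a t)"
  using assms
proof (induction A)
  case (insert a A)
  have "polynomial_function (\<lambda>t. h a t \<oplus> (\<Oplus>a\<in>A. h a t))"
    using insert by (intro polynomial_function_add) auto
  moreover have "(\<Oplus>a\<in>insert a A. h a t) = h a t \<oplus> (\<Oplus>a\<in>A. h a t)" if "t \<in> carrier R" for t
    using insert that polynomial_function_closed by (intro finsum_insert) (auto simp: Pi_def)
  ultimately show ?case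
    unfolding polynomial_function_def by auto
qed (simp add: polynomial_function_const)

lemma polynomial_function_finprod:
  assumes "finite A" "\<And>a. a \<in> A \<Longrightarrow> polynomial_function (h a)"
  shows "polynomial_function (\<lambda>t. \<Otimes>a\<in>A. h a t)"
  using assms
proof (induction A)
  case (insert a A)
  have "polynomial_function (\<lambda>t. h a t \<otimes> (\<Otimes>a\<in>A. h a t))"
    using insert by (intro polynomial_function_mult) auto
  moreover have "(\<Otimes>a\<in>insert a A. h a t) = h a t \<otimes> (\<Otimes>a\<in>A. h a t)" if "t \<in> carrier R" for t
    using insert that polynomial_function_closed by (intro finprod_insert) (auto simp: Pi_def)
  ultimately show ?case
    unfolding polynomial_function_def by auto
qed (simp add: polynomial_function_const)

end

lemma (in domain) polynomial_function_finite_zeros: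
  assumes "polynomial_function h" "t0 \<in> carrier R" "h t0 \<noteq> \<zero>"
  shows "finite {t \<in> carrier R. h t = \<zero>}"
proof (rule ccontr)
  obtain p where p: "set p \<subseteq> carrier R" "\<forall>t\<in>carrier R. h t = eval p t"
    using assms(1) unfolding polynomial_function_def by blast
  assume "infinite {t \<in> carrier R. h t = \<zero>}"
  moreover have "{t \<in> carrier R. h t = \<zero>} = {t \<in> carrier R. eval p t = \<zero>}"
    using p by auto
  ultimately show False
    using eval_zero_infinite[OF domain_axioms p(1) _ assms(2)] p assms by auto
qed

text \<open>Because \<open>x\<^sup>2 - x - c\<close> has a root for every \<open>c\<close>, the function \<open>x\<^sup>2 - x\<close> is surjective, and it
  takes the value \<open>0\<close> both at \<open>0\<close> and at \<open>1\<close>; a surjection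
  of a finite set onto itself would be injective.\<close>
lemma algebraically_closed_infinite:
  assumes "algebraically_closed F"
  shows "infinite (carrier F)"
proof
  interpret algebraically_closed F by fact
  assume fin: "finite (carrier F)"
  let ?h = "\<lambda>x. x \<otimes>\<^bsub>F\<^esub> x \<ominus>\<^bsub>F\<^esub> x"
  have "carrier F \<subseteq> ?h ` carrier F"
  proof
    fix c assume c: "c \<in> carrier F"
    let ?p = "[\<one>\<^bsub>F\<^esub>, \<ominus>\<^bsub>F\<^esub> \<one>\<^bsub>F\<^esub>, \<ominus>\<^bsub>F\<^esub> c]"
    have p: "?p \<in> carrier (poly_ring F)"
      using c unfolding univ_poly_carrier[symmetric] polynomial_def by simp
    have "size (roots ?p) = 2"
      using roots_over_carrier[OF p] unfolding splitted_def by simp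
    then obtain x where "x \<in># roots ?p"
      by (metis size_empty multiset_nonemptyE zero_neq_numeral)
    then have "is_root ?p x"
      using roots_mem_iff_is_root[OF p] by simp
    then have x: "x \<in> carrier F" "eval ?p x = \<zero>\<^bsub>F\<^esub>"
      unfolding is_root_def by auto
    have "eval ?p x = ?h x \<ominus>\<^bsub>F\<^esub> c"
      using x(1) c by (simp add: numeral_2_eq_2 minus_eq l_minus a_assoc)
    then have "?h x = c"
      using x c by (metis r_right_minus_eq m_closed minus_closed)
    then show "c \<in> ?h ` carrier F"
      using x by auto
  qed
  moreover have "?h ` carrier F \<subseteq> carrier F"
    by auto
  ultimately have "inj_on ?h (carrier F)"
    using fin by (metis (no_types, lifting) equalityI endo_inj_surj finite_surj_inj)
  moreover have "?h \<zero>\<^bsub>F\<^esub> = ?h \<one>\<^bsub>F\<^esub>"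
    by (simp add: minus_eq r_neg)
  ultimately show False
    using inj_onD[of ?h "carrier F" "\<zero>\<^bsub>F\<^esub>" "\<one>\<^bsub>F\<^esub>"] by simp
qed

section \<open>Discrete valuation rings by units and powers of the uniformiser\<close>

locale uniformised =
  fixes \<pi> :: "'r::idom"
  assumes pi_nonzero: "\<pi> \<noteq> 0" and pi_nonunit: "\<not> \<pi> dvd 1"
    and unit_times_power: "a \<noteq> 0 \<Longrightarrow> \<exists>u n. u dvd 1 \<and> a = u * \<pi> ^ n"

lemma ring_of_simps:
  "carrier (ring_of TYPE('r::comm_ring_1)) = UNIV"
  "monoid.mult (ring_of TYPE('r)) = (*)"
  "ring.add (ring_of TYPE('r)) = (+)"
  "monoid.one (ring_of TYPE('r)) = 1"
  "ring.zero (ring_of TYPE('r)) = 0"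
  by (auto simp: ring_of_type_algebra_def)

lemma PIdl_ring_of: "PIdl\<^bsub>ring_of TYPE('r::comm_ring_1)\<^esub> a = {x. a dvd x}"
  unfolding cgenideal_def by (auto simp: ring_of_simps dvd_def mult.commute)

text \<open>Every irreducible element generates the unique maximal ideal and so is associated to the uniformiser;
  now factor an arbitrary element into irreducibles.\<close>
lemma uniformised_of_discrete_valuation_ring:
  fixes \<pi> :: "'r::idom"
  assumes "discrete_valuation_ring (ring_of TYPE('r))" "uniformiser (ring_of TYPE('r)) \<pi>"
  shows "uniformised \<pi>"
proof -
  let ?R = "ring_of TYPE('r)"
  interpret principal_domain ?R
    using assms unfolding discrete_valuation_ring_def by simp
  have max: "maximalideal (PIdl\<^bsub>?R\<^esub> \<pi>) ?R"
    using assms unfolding uniformiser_def by simp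
  have units: "a \<in> Units ?R \<longleftrightarrow> a dvd 1" for a
    unfolding Units_def by (auto simp: ring_of_simps dvd_def mult.commute)
  have "\<not> \<pi> dvd 1"
  proof
    assume "\<pi> dvd 1"
    then have "PIdl\<^bsub>?R\<^esub> \<pi> = carrier ?R"
      unfolding PIdl_ring_of by (auto simp: ring_of_simps intro: dvd_trans)
    then show False
      using maximalideal.I_notcarr[OF max] by simp
  qed
  moreover have "\<pi> \<noteq> 0"
  proof
    assume "\<pi> = 0"
    then have "PIdl\<^bsub>?R\<^esub> \<pi> = {\<zero>\<^bsub>?R\<^esub>}"
      unfolding PIdl_ring_of by (auto simp: ring_of_simps)
    then have "maximalideal {\<zero>\<^bsub>?R\<^esub>} ?R"
      using max by metis
    then show False
      using zeromaximalideal_fieldI assms(1) unfolding discrete_valuation_ring_def by blast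
  qed
  moreover have "\<exists>u n. u dvd 1 \<and> a = u * \<pi> ^ n" if a: "a \<noteq> 0" for a
  proof (cases "a dvd 1")
    case True
    then show ?thesis
      by (intro exI[of _ a] exI[of _ 0]) simp
  next
    case False
    have irred: "\<exists>u. u dvd 1 \<and> b = u * \<pi>" if "Divisibility.irreducible (mult_of ?R) b" "b \<noteq> 0" for b
    proof -
      have b: "ring_irreducible\<^bsub>?R\<^esub> b"
        using irreducible_mult_imp_irreducible[of b] that
        unfolding ring_irreducible_def by (simp add: ring_of_simps)
      have "maximalideal (PIdl\<^bsub>?R\<^esub> b) ?R"
        using irreducible_imp_maximalideal[OF _ b] by (simp add: ring_of_simps)
      moreover have "\<exists>!m. maximalideal m ?R"
        using assms(1) unfolding discrete_valuation_ring_def by simp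
      ultimately have "PIdl\<^bsub>?R\<^esub> b = PIdl\<^bsub>?R\<^esub> \<pi>"
        using max by (metis (no_types))
      then have eq: "{x. b dvd x} = {x. \<pi> dvd x}"
        unfolding PIdl_ring_of .
      have "b \<in> {x. \<pi> dvd x}"
        unfolding eq[symmetric] by simp
      moreover have "\<pi> \<in> {x. b dvd x}"
        unfolding eq by simp
      ultimately have "\<pi> dvd b" "b dvd \<pi>"
        by simp_all
      then obtain u w where uw: "b = \<pi> * u" "\<pi> = b * w"
        unfolding dvd_def by blast
      have "b * 1 = b * w * u"
        unfolding uw(2)[symmetric] using uw(1) by simp
      then have "b * 1 = b * (w * u)"
        by (simp only: mult.assoc)
      then have "w * u = 1"
        using that(2) mult_left_cancel[of b 1 "w * u"] by simp
      then have "u dvd 1"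
        using dvd_triv_right[of u w] by simp
      then show ?thesis
        using uw(1) by (intro exI[of _ u]) (simp add: mult.commute)
    qed
    obtain fs where fs: "set fs \<subseteq> carrier (mult_of ?R)" "wfactors (mult_of ?R) fs a"
      using factorization_property[of a] False a units by (auto simp: ring_of_simps)
    have "\<exists>u n. u dvd 1 \<and> foldr (*) fs 1 = u * \<pi> ^ n"
      if "set fs \<subseteq> carrier (mult_of ?R)" "\<forall>x\<in>set fs. Divisibility.irreducible (mult_of ?R) x" for fs
      using that
    proof (induction fs)
      case Nil
      then show ?case by (intro exI[of _ 1] exI[of _ 0]) simp
    next
      case (Cons b fs)
      obtain u where u: "u dvd 1" "b = u * \<pi>"
        using irred[of b] Cons.prems by (auto simp: ring_of_simps)
      obtain w n where w: "w dvd 1" "foldr (*) fs 1 = w * \<pi> ^ n"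
        using Cons by auto
      have "foldr (*) (b # fs) 1 = (u * w) * \<pi> ^ Suc n"
        by (simp add: u w algebra_simps)
      moreover have "u * w dvd 1"
        using mult_dvd_mono[OF u(1) w(1)] by simp
      ultimately show ?case by blast
    qed
    moreover have "\<forall>x\<in>set fs. Divisibility.irreducible (mult_of ?R) x"
      using fs(2) unfolding wfactors_def by simp
    ultimately have "\<exists>u n. u dvd 1 \<and> foldr (*) fs 1 = u * \<pi> ^ n"
      using fs(1) by simp
    then obtain u n where un: "u dvd 1" "foldr (*) fs 1 = u * \<pi> ^ n"
      by (elim exE conjE)
    have "foldr (*) fs 1 \<sim>\<^bsub>mult_of ?R\<^esub> a"
      using fs(2) unfolding wfactors_def by (simp add: ring_of_simps)
    then obtain c d where c: "a = foldr (*) fs 1 * c" and d: "foldr (*) fs 1 = a * d"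
      unfolding associated_def factor_def mult_mult_of ring_of_simps by blast
    have "a * 1 = a * (d * c)"
      using c unfolding d by (simp only: mult.assoc mult_1_right)
    then have "d * c = 1"
      using a mult_left_cancel[of a 1 "d * c"] by simp
    then have "c dvd 1"
      using dvd_triv_right[of c d] by simp
    then have "u * c dvd 1"
      using mult_dvd_mono[OF un(1) \<open>c dvd 1\<close>] by simp
    moreover have "a = (u * c) * \<pi> ^ n"
      using c un by (simp add: algebra_simps)
    ultimately show ?thesis by blast
  qed
  ultimately show ?thesis
    by unfold_locales auto
qed

context uniformised
begin

lemma unit_iff: "a dvd 1 \<longleftrightarrow> \<not> \<pi> dvd a"
proof
  show "a dvd 1 \<Longrightarrow> \<not> \<pi> dvd a"
    using pi_nonunit dvd_trans by blast
  assume "\<not> \<pi> dvd a"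
  then have "a \<noteq> 0" by auto
  then obtain u n where "u dvd 1" "a = u * \<pi> ^ n"
    using unit_times_power by blast
  then show "a dvd 1"
    using \<open>\<not> \<pi> dvd a\<close> by (cases n) auto
qed

end

section \<open>Coordinates and base change\<close>

text \<open>The vector space \<open>k\<^sup>B\<close> as a module record.  Its vectors are extensional functions, so that
  equality of vectors is equality of functions.\<close>
definition kvec :: "'v set \<Rightarrow> ('e, 'm) ring_scheme \<Rightarrow> ('e, 'v \<Rightarrow> 'e) module" where
  "kvec B k = \<lparr>carrier = B \<rightarrow>\<^sub>E carrier k, monoid.mult = (\<lambda>x y. undefined), one = undefined,
     zero = (\<lambda>b\<in>B. \<zero>\<^bsub>k\<^esub>), add = (\<lambda>x y. \<lambda>b\<in>B. x b \<oplus>\<^bsub>k\<^esub> y b),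
     module.smult = (\<lambda>c x. \<lambda>b\<in>B. c \<otimes>\<^bsub>k\<^esub> x b)\<rparr>"

lemma kvec_simps:
  "carrier (kvec B k) = B \<rightarrow>\<^sub>E carrier k"
  "\<zero>\<^bsub>kvec B k\<^esub> = (\<lambda>b\<in>B. \<zero>\<^bsub>k\<^esub>)"
  "x \<oplus>\<^bsub>kvec B k\<^esub> y = (\<lambda>b\<in>B. x b \<oplus>\<^bsub>k\<^esub> y b)"
  "c \<odot>\<^bsub>kvec B k\<^esub> x = (\<lambda>b\<in>B. c \<otimes>\<^bsub>k\<^esub> x b)"
  by (simp_all add: kvec_def)

lemma kvec_module:
  fixes k :: "('e, 'm) ring_scheme" and B :: "'v set"
  assumes "cring k"
  shows "module k (kvec B k :: ('e, 'v \<Rightarrow> 'e) module)"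
proof -
  interpret cring k by fact
  have mem: "x b \<in> carrier k" if "x \<in> B \<rightarrow>\<^sub>E carrier k" "b \<in> B" for x b
    using that by (rule PiE_mem)
  have canon: "(\<lambda>b\<in>B. x b) = x" if "x \<in> B \<rightarrow>\<^sub>E carrier k" for x :: "'v \<Rightarrow> 'e"
    using that by (rule PiE_restrict)
  have ab: "abelian_group (kvec B k)"
  proof (rule abelian_groupI)
    fix x assume x: "x \<in> carrier (kvec B k)"
    have "(\<lambda>b\<in>B. \<ominus>\<^bsub>k\<^esub> x b) \<oplus>\<^bsub>kvec B k\<^esub> x = \<zero>\<^bsub>kvec B k\<^esub>"
      using x by (auto simp: kvec_simps l_neg mem intro!: restrict_ext)
    moreover have "(\<lambda>b\<in>B. \<ominus>\<^bsub>k\<^esub> x b) \<in> carrier (kvec B k)"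
      using x by (auto simp: kvec_simps mem)
    ultimately show "\<exists>y\<in>carrier (kvec B k). y \<oplus>\<^bsub>kvec B k\<^esub> x = \<zero>\<^bsub>kvec B k\<^esub>"
      by blast
  qed (auto simp: kvec_simps mem a_ac canon intro!: restrict_ext cong: restrict_cong)
  show ?thesis
    by (rule moduleI[OF assms ab])
      (auto simp: kvec_simps mem l_distr r_distr m_assoc canon intro!: restrict_ext cong: restrict_cong)
qed

locale coordinates = B: finite_dimensional_vector_space scale B
  for scale :: "'r::idom fract \<Rightarrow> 'v::ab_group_add \<Rightarrow> 'v" and B
begin

definition coord :: "'v \<Rightarrow> 'v \<Rightarrow> 'r fract" where
  "coord x b = B.representation B x b"

lemma coord_linear:
  "coord (x + y) b = coord x b + coord y b" "coord (scale c x) b = c * coord x b"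
  "coord 0 b = 0"
  unfolding coord_def
  using B.representation_add[OF B.independent_Basis] B.representation_scale[OF B.independent_Basis]
    B.span_Basis B.representation_zero by auto

lemma coord_diff: "coord (x - y) b = coord x b - coord y b"
  unfolding coord_def
  using B.representation_diff[OF B.independent_Basis] B.span_Basis by auto

lemma coord_basis: "c \<in> B \<Longrightarrow> coord c b = (if b = c then 1 else 0)"
  unfolding coord_def using B.representation_basis[OF B.independent_Basis] by auto

lemma coord_expansion: "(\<Sum>b\<in>B. scale (coord x b) b) = x"
  unfolding coord_def
  using B.sum_representation_eq[OF B.independent_Basis _ B.finite_Basis] B.span_Basis by auto

lemma coord_ext: "(\<And>b. b \<in> B \<Longrightarrow> coord x b = coord y b) \<Longrightarrow> x = y"
  using coord_expansion[of x] coord_expansion[of y] by (metis (no_types, lifting) sum.cong)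

lemma coord_sum: "coord (\<Sum>a\<in>A. h a) b = (\<Sum>a\<in>A. coord (h a) b)"
  by (induction A rule: infinite_finite_induct) (simp_all add: coord_linear)

text \<open>The reference lattice, described by coordinates; \<open>L0_eq_span\<close> identifies it with the span of the basis
  over the valuation ring.\<close>
definition L0 :: "'v set" where
  "L0 = {x. \<forall>b\<in>B. coord x b \<in> range to_fract}"

text \<open>The coordinates of a lattice vector as elements of the valuation ring.\<close>
definition rcoord :: "'v \<Rightarrow> 'v \<Rightarrow> 'r" where
  "rcoord x b = the_inv to_fract (coord x b)"

lemma inj_to_fract: "inj (to_fract :: 'r \<Rightarrow> 'r fract)"
  by (auto intro: injI)

lemma to_fract_rcoord: "x \<in> L0 \<Longrightarrow> b \<in> B \<Longrightarrow> to_fract (rcoord x b) = coord x b"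
  unfolding L0_def rcoord_def using f_the_inv_into_f[OF inj_to_fract] by auto

lemma rcoord_eqI: "coord x b = to_fract r \<Longrightarrow> rcoord x b = r"
  unfolding rcoord_def by (simp add: the_inv_f_f[OF inj_to_fract])

lemma L0_add: "x \<in> L0 \<Longrightarrow> y \<in> L0 \<Longrightarrow> x + y \<in> L0"
  unfolding L0_def mem_Collect_eq coord_linear image_iff
  by (metis to_fract_add UNIV_I)

lemma L0_scale: "x \<in> L0 \<Longrightarrow> scale (to_fract r) x \<in> L0"
  unfolding L0_def mem_Collect_eq coord_linear image_iff
  by (metis to_fract_mult UNIV_I)

lemma L0_zero: "0 \<in> L0"
  unfolding L0_def mem_Collect_eq coord_linear image_iff
  by (metis to_fract_0 UNIV_I)

lemma L0_diff: "x \<in> L0 \<Longrightarrow> y \<in> L0 \<Longrightarrow> x - y \<in> L0"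
  unfolding L0_def mem_Collect_eq coord_diff image_iff
  by (metis to_fract_diff UNIV_I)

lemma L0_sum: "(\<And>a. a \<in> A \<Longrightarrow> h a \<in> L0) \<Longrightarrow> (\<Sum>a\<in>A. h a) \<in> L0"
  by (induction A rule: infinite_finite_induct) (simp_all add: L0_zero L0_add)

lemma basis_subset_L0: "B \<subseteq> L0"
  unfolding L0_def by (auto simp: coord_basis) (metis rangeI to_fract_0 to_fract_1)+

lemma L0_eq_span: "L0 = Modules.module.span (R_scale scale) B"
proof -
  interpret R: Modules.module "R_scale scale"
    unfolding R_scale_def
    by unfold_locales (simp_all add: B.scale_right_distrib B.scale_left_distrib)
  show ?thesis
  proof
    show "L0 \<subseteq> R.span B"
    proof
      fix x assume "x \<in> L0"
      then have "x = (\<Sum>b\<in>B. R_scale scale (rcoord x b) b)"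
        using coord_expansion[of x] to_fract_rcoord[of x] by (simp add: R_scale_def)
      also have "\<dots> \<in> R.span B"
        by (intro R.span_sum R.span_scale R.span_base)
      finally show "x \<in> R.span B" .
    qed
    show "R.span B \<subseteq> L0"
      by (rule R.span_minimal[OF basis_subset_L0])
        (auto intro!: R.subspaceI simp: L0_zero L0_add R_scale_def L0_scale)
  qed
qed

lemma rcoord_add: "x \<in> L0 \<Longrightarrow> y \<in> L0 \<Longrightarrow> b \<in> B \<Longrightarrow> rcoord (x + y) b = rcoord x b + rcoord y b"
  by (rule rcoord_eqI) (simp add: coord_linear to_fract_rcoord)

lemma rcoord_scale: "x \<in> L0 \<Longrightarrow> b \<in> B \<Longrightarrow> rcoord (scale (to_fract r) x) b = r * rcoord x b"
  by (rule rcoord_eqI) (simp add: coord_linear to_fract_rcoord)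

definition integral :: "('v \<Rightarrow> 'v) \<Rightarrow> bool" where
  "integral h \<longleftrightarrow> Vector_Spaces.linear scale scale h \<and> h ` L0 \<subseteq> L0"

lemma integral_id: "integral (\<lambda>x. x)"
  unfolding integral_def using B.linear_id by (simp add: id_def)

lemma integral_comp: "integral h \<Longrightarrow> integral h' \<Longrightarrow> integral (\<lambda>x. h (h' x))"
  unfolding integral_def using Vector_Spaces.linear_compose[of scale scale h' scale h]
  by (auto simp: comp_def)

lemma integral_scale: "integral h \<Longrightarrow> integral (\<lambda>x. scale (to_fract r) (h x))"
  unfolding integral_def
  using Vector_Spaces.linear_compose[of scale scale h scale "scale (to_fract r)"]
    B.linear_scale_self[of "to_fract r"] L0_scale by (auto simp: comp_def)

end

locale base_change_setting =
  coordinates scale B + vector_space_over k "kvec B k"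
  for scale :: "'r::idom fract \<Rightarrow> 'v::ab_group_add \<Rightarrow> 'v" and B
    and k :: "'e ring" (structure) +
  fixes \<phi> :: "'r \<Rightarrow> 'e"
  assumes phi_hom: "\<phi> \<in> ring_hom (ring_of TYPE('r)) k"
begin

abbreviation "E \<equiv> kvec B k"

lemma phi_closed: "\<phi> a \<in> carrier k"
  using ring_hom_closed[OF phi_hom, of a] by (simp add: ring_of_simps)

lemma phi_add: "\<phi> (a + b) = \<phi> a \<oplus> \<phi> b"
  using ring_hom_add[OF phi_hom, of a b] by (simp add: ring_of_simps)

lemma phi_mult: "\<phi> (a * b) = \<phi> a \<otimes> \<phi> b"
  using ring_hom_mult[OF phi_hom, of a b] by (simp add: ring_of_simps)

lemma phi_one: "\<phi> 1 = \<one>"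
  using ring_hom_one[OF phi_hom] by (simp add: ring_of_simps)

lemma phi_zero: "\<phi> 0 = \<zero>"
  using phi_add[of 0 0] phi_closed[of 0] R.add.r_cancel_one[of "\<phi> 0" "\<phi> 0"] by simp

lemma phi_uminus: "\<phi> (- a) = \<ominus> \<phi> a"
  using phi_add[of "- a" a] R.minus_equality[of "\<phi> (- a)" "\<phi> a"] phi_closed by (simp add: phi_zero)

lemma phi_sum: "finite A \<Longrightarrow> \<phi> (\<Sum>a\<in>A. h a) = (\<Oplus>a\<in>A. \<phi> (h a))"
  by (induction A rule: finite_induct) (simp_all add: phi_zero phi_add phi_closed)

lemma phi_unit:
  assumes "a dvd 1"
  shows "\<phi> a \<noteq> \<zero>"
proof
  assume "\<phi> a = \<zero>"
  moreover obtain b where "1 = a * b"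
    using assms by (rule dvdE)
  ultimately have "\<phi> 1 = \<zero>"
    using phi_mult[of a b] phi_closed[of b] by simp
  then show False
    using phi_one one_not_zero by simp
qed

definition red :: "'v \<Rightarrow> 'v \<Rightarrow> 'e" where
  "red x = (\<lambda>b\<in>B. \<phi> (rcoord x b))"

lemma red_closed: "red x \<in> carrier E"
  unfolding red_def by (simp add: kvec_simps phi_closed)

lemma red_add: "x \<in> L0 \<Longrightarrow> y \<in> L0 \<Longrightarrow> red (x + y) = red x \<oplus>\<^bsub>E\<^esub> red y"
  unfolding red_def by (auto simp: kvec_simps rcoord_add phi_add intro!: restrict_ext)

lemma red_scale: "x \<in> L0 \<Longrightarrow> red (scale (to_fract r) x) = \<phi> r \<odot>\<^bsub>E\<^esub> red x"
  unfolding red_def by (auto simp: kvec_simps rcoord_scale phi_mult intro!: restrict_ext)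

text \<open>The space \<open>k\<^sup>B\<close> is spanned by reductions of lattice vectors, indeed by those of the basis.  With
  \<open>bc_red\<close> this reduces identities between base changes to identities in the lattice.\<close>
lemma red_induct [consumes 1, case_names zero red]:
  assumes "s \<in> carrier E"
    and "P \<zero>\<^bsub>E\<^esub>"
    and "\<And>x c s. x \<in> L0 \<Longrightarrow> c \<in> carrier k \<Longrightarrow> s \<in> carrier E \<Longrightarrow> P s \<Longrightarrow> P (c \<odot>\<^bsub>E\<^esub> red x \<oplus>\<^bsub>E\<^esub> s)"
  shows "P s"
proof -
  define cut where "cut A = (\<lambda>b\<in>B. if b \<in> A then s b else \<zero>)" for A
  have sb: "b \<in> B \<Longrightarrow> s b \<in> carrier k" for b
    using assms(1) by (auto simp: kvec_simps)
  have "P (cut A)" if "A \<subseteq> B" for A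
    using finite_subset[OF that B.finite_Basis] that
  proof (induction A rule: finite_induct)
    case empty
    have "cut {} = \<zero>\<^bsub>E\<^esub>"
      unfolding cut_def kvec_simps by (intro restrict_ext) simp
    then show ?case
      using assms(2) by simp
  next
    case (insert a A)
    have "cut (insert a A) = s a \<odot>\<^bsub>E\<^esub> red a \<oplus>\<^bsub>E\<^esub> cut A"
    proof -
      have "rcoord a b = (if b = a then 1 else 0)" for b
        using insert.prems by (intro rcoord_eqI) (simp add: coord_basis)
      then show ?thesis
        using insert sb
        by (auto simp: cut_def red_def kvec_simps phi_one phi_zero intro!: restrict_ext)
    qed
    moreover have "cut A \<in> carrier E"
      using sb by (auto simp: cut_def kvec_simps)
    ultimately show ?case
      using assms(3)[of a "s a" "cut A"] insert sb basis_subset_L0 by auto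
  qed
  moreover have "cut B = s"
  proof -
    have "cut B = restrict s B"
      unfolding cut_def by (intro restrict_ext) simp
    then show ?thesis
      using assms(1) by (simp add: kvec_simps PiE_restrict)
  qed
  ultimately show ?thesis
    by (metis order_refl)
qed

lemma E_mem: "s \<in> carrier E \<Longrightarrow> b \<in> B \<Longrightarrow> s b \<in> carrier k"
  unfolding kvec_simps by (rule PiE_mem)

abbreviation bc :: "('v \<Rightarrow> 'v) \<Rightarrow> ('v \<Rightarrow> 'e) \<Rightarrow> 'v \<Rightarrow> 'e" where
  "bc \<equiv> base_change scale B k \<phi>"

lemma bc_eq: "bc h s = (\<lambda>a\<in>B. \<Oplus>b\<in>B. \<phi> (rcoord (h b) a) \<otimes> s b)"
  unfolding base_change_def entry_def rcoord_def coord_def ..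

lemma bc_closed: "s \<in> carrier E \<Longrightarrow> bc h s \<in> carrier E"
  unfolding bc_eq by (auto simp: kvec_simps phi_closed PiE_mem intro!: R.finsum_closed)

lemma bc_add:
  assumes "s \<in> carrier E" "s' \<in> carrier E"
  shows "bc h (s \<oplus>\<^bsub>E\<^esub> s') = bc h s \<oplus>\<^bsub>E\<^esub> bc h s'"
proof -
  have "(\<Oplus>b\<in>B. \<phi> (rcoord (h b) a) \<otimes> (s \<oplus>\<^bsub>E\<^esub> s') b) =
    (\<Oplus>b\<in>B. \<phi> (rcoord (h b) a) \<otimes> s b) \<oplus> (\<Oplus>b\<in>B. \<phi> (rcoord (h b) a) \<otimes> s' b)" for a
  proof -
    have "(\<Oplus>b\<in>B. \<phi> (rcoord (h b) a) \<otimes> (s \<oplus>\<^bsub>E\<^esub> s') b) =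
        (\<Oplus>b\<in>B. \<phi> (rcoord (h b) a) \<otimes> s b \<oplus> \<phi> (rcoord (h b) a) \<otimes> s' b)"
      using assms by (intro R.finsum_cong') (auto simp: phi_closed E_mem R.r_distr kvec_simps(3))
    also have "\<dots> = (\<Oplus>b\<in>B. \<phi> (rcoord (h b) a) \<otimes> s b) \<oplus> (\<Oplus>b\<in>B. \<phi> (rcoord (h b) a) \<otimes> s' b)"
      using assms by (intro R.finsum_addf) (auto simp: phi_closed E_mem)
    finally show ?thesis .
  qed
  then show ?thesis
    unfolding bc_eq by (auto simp: kvec_simps(3,4) intro!: restrict_ext)
qed

lemma bc_smult:
  assumes "s \<in> carrier E" "c \<in> carrier k"
  shows "bc h (c \<odot>\<^bsub>E\<^esub> s) = c \<odot>\<^bsub>E\<^esub> bc h s"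
proof -
  have "(\<Oplus>b\<in>B. \<phi> (rcoord (h b) a) \<otimes> (c \<odot>\<^bsub>E\<^esub> s) b) = c \<otimes> (\<Oplus>b\<in>B. \<phi> (rcoord (h b) a) \<otimes> s b)" for a
  proof -
    have "(\<Oplus>b\<in>B. \<phi> (rcoord (h b) a) \<otimes> (c \<odot>\<^bsub>E\<^esub> s) b) = (\<Oplus>b\<in>B. c \<otimes> (\<phi> (rcoord (h b) a) \<otimes> s b))"
      using assms by (intro R.finsum_cong') (auto simp: phi_closed E_mem m_lcomm kvec_simps(4))
    also have "\<dots> = c \<otimes> (\<Oplus>b\<in>B. \<phi> (rcoord (h b) a) \<otimes> s b)"
      using assms by (intro R.finsum_rdistr[symmetric]) (auto simp: phi_closed E_mem B.finite_Basis)
    finally show ?thesis .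
  qed
  then show ?thesis
    unfolding bc_eq by (auto simp: kvec_simps(3,4) intro!: restrict_ext)
qed

lemma bc_zero: "bc h \<zero>\<^bsub>E\<^esub> = \<zero>\<^bsub>E\<^esub>"
  using bc_smult[of "\<zero>\<^bsub>E\<^esub>" \<zero> h] bc_closed[of "\<zero>\<^bsub>E\<^esub>" h] by simp

lemma bc_red:
  assumes h: "integral h" and x: "x \<in> L0"
  shows "bc h (red x) = red (h x)"
proof -
  interpret h: Vector_Spaces.linear scale scale h
    using h unfolding integral_def by simp
  have hL: "h y \<in> L0" if "y \<in> L0" for y
    using h that unfolding integral_def by auto
  have "rcoord (h x) a = (\<Sum>b\<in>B. rcoord (h b) a * rcoord x b)" if a: "a \<in> B" for a
  proof (rule rcoord_eqI)
    have "h x = (\<Sum>b\<in>B. scale (coord x b) (h b))"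
      using coord_expansion[of x] by (metis (no_types, lifting) h.scale h.sum sum.cong)
    then have "coord (h x) a = (\<Sum>b\<in>B. coord x b * coord (h b) a)"
      by (simp add: coord_sum coord_linear)
    also have "\<dots> = (\<Sum>b\<in>B. to_fract (rcoord (h b) a * rcoord x b))"
      using a x hL basis_subset_L0 by (intro sum.cong) (auto simp: to_fract_rcoord)
    also have "\<dots> = to_fract (\<Sum>b\<in>B. rcoord (h b) a * rcoord x b)"
      by (induction B rule: infinite_finite_induct) auto
    finally show "coord (h x) a = \<dots>" .
  qed
  then have "\<phi> (rcoord (h x) a) = (\<Oplus>b\<in>B. \<phi> (rcoord (h b) a) \<otimes> \<phi> (rcoord x b))" if "a \<in> B" for a
    using that by (simp add: phi_sum B.finite_Basis phi_mult)
  moreover have "(\<Oplus>b\<in>B. \<phi> (rcoord (h b) a) \<otimes> (if b \<in> B then \<phi> (rcoord x b) else undefined))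
    = (\<Oplus>b\<in>B. \<phi> (rcoord (h b) a) \<otimes> \<phi> (rcoord x b))" for a
    by (intro R.finsum_cong') (auto simp: phi_closed)
  ultimately show ?thesis
    unfolding bc_eq red_def restrict_def by (intro ext) auto
qed

text \<open>Both sides are linear in \<open>s\<close>, and on reductions of lattice vectors they agree by \<open>bc_red\<close>.\<close>
lemma bc_comp:
  assumes "integral h" "integral h'" "s \<in> carrier E"
  shows "bc (\<lambda>x. h (h' x)) s = bc h (bc h' s)"
  using assms(3)
proof (induction rule: red_induct)
  case zero
  then show ?case by (simp add: bc_zero)
next
  case (red x c s)
  have "h' x \<in> L0"
    using assms(2) red unfolding integral_def by auto
  then show ?case
    using red assms by (simp add: bc_add bc_smult bc_red integral_comp red_closed bc_closed)
qed

lemma bc_scale: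
  assumes "integral h" "s \<in> carrier E"
  shows "bc (\<lambda>x. scale (to_fract r) (h x)) s = \<phi> r \<odot>\<^bsub>E\<^esub> bc h s"
  using assms(2)
proof (induction rule: red_induct)
  case zero
  then show ?case by (simp add: bc_zero phi_closed)
next
  case (red x c s)
  have "h x \<in> L0"
    using assms(1) red unfolding integral_def by auto
  then show ?case
    using red assms
    by (simp add: bc_add bc_smult bc_red integral_scale red_closed bc_closed red_scale phi_closed
        smult_r_distr smult_assoc1[symmetric] m_comm)
qed

lemma bc_id:
  assumes "s \<in> carrier E"
  shows "bc (\<lambda>x. x) s = s"
  using assms
proof (induction rule: red_induct)
  case (red x c s)
  then show ?case
    by (simp add: bc_add bc_smult bc_red integral_id red_closed bc_closed)
qed (rule bc_zero)

end

section \<open>Fractions over a discrete valuation ring\<close>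

context uniformised
begin

definition power_pi :: "int \<Rightarrow> 'r fract" where
  "power_pi j = to_fract \<pi> powi j"

lemma to_fract_pi_nonzero: "to_fract \<pi> \<noteq> 0"
  using pi_nonzero by simp

lemma power_pi_nonzero: "power_pi j \<noteq> 0"
  unfolding power_pi_def using to_fract_pi_nonzero by simp

lemma power_pi_add: "power_pi (i + j) = power_pi i * power_pi j"
  unfolding power_pi_def using to_fract_pi_nonzero by (simp add: power_int_add)

lemma power_pi_0: "power_pi 0 = 1" and power_pi_1: "power_pi 1 = to_fract \<pi>"
  unfolding power_pi_def by simp_all

lemma power_pi_nat: "power_pi (int n) = to_fract (\<pi> ^ n)"
proof -
  have "to_fract (\<pi> ^ n) = to_fract \<pi> ^ n"
    by (induction n) simp_all
  then show ?thesis
    unfolding power_pi_def by simp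
qed

lemma power_pi_integral: "0 \<le> j \<Longrightarrow> power_pi j \<in> range to_fract"
  using power_pi_nat[of "nat j"] by auto

lemma integral_mult:
  assumes "x \<in> range to_fract" "y \<in> range to_fract"
  shows "x * y \<in> range (to_fract :: 'r \<Rightarrow> 'r fract)"
proof -
  obtain a b where "x = to_fract a" "y = to_fract b"
    using assms by auto
  then have "x * y = to_fract (a * b)"
    by simp
  then show ?thesis by blast
qed

lemma unit_inverse:
  assumes "u dvd 1"
  obtains w where "w dvd 1" "to_fract u * to_fract w = (1 :: 'r fract)"
proof -
  obtain w where w: "1 = u * w"
    using assms by (rule dvdE)
  then have "to_fract u * to_fract w = (1 :: 'r fract)"
    by (metis to_fract_mult to_fract_1)
  moreover have "w dvd 1"
    using w dvd_triv_right[of w u] by simp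
  ultimately show thesis using that by blast
qed

lemma fract_unit_times_power:
  assumes "x \<noteq> (0 :: 'r fract)"
  obtains u n where "u dvd 1" "x = to_fract u * power_pi n"
proof -
  obtain a b where x: "x = Fract a b" "b \<noteq> 0"
    by (cases x) auto
  then have "a \<noteq> 0"
    using assms by (metis Zero_fract_def eq_fract(1) mult_zero_left zero_neq_one)
  then obtain u m where u: "u dvd 1" "a = u * \<pi> ^ m"
    using unit_times_power by blast
  obtain w n where w: "w dvd 1" "b = w * \<pi> ^ n"
    using unit_times_power[OF x(2)] by blast
  obtain w' where w': "w' dvd 1" "to_fract w * to_fract w' = (1 :: 'r fract)"
    using unit_inverse[OF w(1)] by blast
  have a': "to_fract a = to_fract u * power_pi (int m)"
    unfolding u(2) power_pi_nat by simp
  have b': "to_fract b = to_fract w * power_pi (int n)"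
    unfolding w(2) power_pi_nat by simp
  have "to_fract b \<noteq> (0 :: 'r fract)"
    using x(2) by simp
  moreover have "to_fract (u * w') * power_pi (int m - int n) * to_fract b =
      to_fract u * (to_fract w * to_fract w') * (power_pi (int m - int n) * power_pi (int n))"
    unfolding b' by (simp add: algebra_simps)
  then have "to_fract (u * w') * power_pi (int m - int n) * to_fract b = to_fract a"
    unfolding w'(2) a' power_pi_add[symmetric] by simp
  moreover have "x * to_fract b = to_fract a"
    using x by (simp add: to_fract_def eq_fract)
  ultimately have "x = to_fract (u * w') * power_pi (int m - int n)"
    by (metis mult_right_cancel)
  moreover have "u * w' dvd 1"
    using mult_dvd_mono[OF u(1) w'(1)] by simp
  ultimately show thesis using that by blast
qed

lemma unit_times_power_integral_iff:
  assumes "u dvd 1"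
  shows "to_fract u * power_pi n \<in> range to_fract \<longleftrightarrow> 0 \<le> n"
proof
  assume "0 \<le> n"
  then show "to_fract u * power_pi n \<in> range to_fract"
    using power_pi_integral integral_mult by blast
next
  assume "to_fract u * power_pi n \<in> range to_fract"
  then obtain r where r: "to_fract u * power_pi n = to_fract r"
    by blast
  show "0 \<le> n"
  proof (rule ccontr)
    assume "\<not> 0 \<le> n"
    then have "power_pi (int (nat (- n))) * power_pi n = 1"
      by (simp add: power_pi_add[symmetric] power_pi_0)
    then have "to_fract u = to_fract r * power_pi (int (nat (- n)))"
      unfolding r[symmetric] by (simp add: mult.assoc mult.commute mult.left_commute)
    then have "u = r * \<pi> ^ nat (- n)"
      unfolding power_pi_nat by (metis to_fract_mult to_fract_eq_iff)
    moreover have "nat (- n) = Suc (nat (- n) - 1)"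
      using \<open>\<not> 0 \<le> n\<close> by simp
    ultimately have "\<pi> dvd u"
      by (metis dvd_mult dvd_triv_left power_Suc)
    then show False
      using assms unit_iff by blast
  qed
qed

lemma val_unit_times_power:
  assumes "u dvd 1"
  shows "val \<pi> (to_fract u * power_pi n) = n"
  unfolding val_def power_pi_def[symmetric]
proof (rule the_equality)
  show "\<exists>w. w dvd 1 \<and> to_fract u * power_pi n = to_fract w * power_pi n"
    using assms by blast
  fix m assume "\<exists>w. w dvd 1 \<and> to_fract u * power_pi n = to_fract w * power_pi m"
  then obtain w where w: "w dvd 1" "to_fract u * power_pi n = to_fract w * power_pi m"
    by blast
  have shift: "to_fract y * power_pi j * power_pi i = to_fract y * power_pi (j + i)" for y j i
    by (simp add: power_pi_add mult.assoc)
  have "to_fract u * power_pi (n + i) = to_fract w * power_pi (m + i)" for i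
    using w(2) shift by metis
  then have "0 \<le> n + i \<longleftrightarrow> 0 \<le> m + i" for i
    using unit_times_power_integral_iff[OF assms] unit_times_power_integral_iff[OF w(1)] by metis
  from this[of "- n"] this[of "- m"] show "m = n"
    by simp
qed

end

text \<open>Used for the set of all \<open>j\<close> such that \<open>\<pi>\<^sup>j\<close> times a given map preserves the reference lattice.\<close>
lemma int_upward_closed_threshold:
  fixes P :: "int \<Rightarrow> bool"
  assumes "\<And>i j. P i \<Longrightarrow> i \<le> j \<Longrightarrow> P j" "P a" "\<not> P b"
  obtains d where "\<And>j. P j \<longleftrightarrow> d \<le> j"
proof -
  have ba: "b < a"
    using assms by (meson not_less)
  define n where "n = (LEAST n. P (b + int n))"
  have "P (b + int (nat (a - b)))"
    using ba assms(2) by simp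
  then have n: "P (b + int n)"
    unfolding n_def by (rule LeastI)
  have "P j \<longleftrightarrow> b + int n \<le> j" for j
  proof
    show "b + int n \<le> j \<Longrightarrow> P j"
      using n assms(1) by blast
    assume j: "P j"
    then have "b < j"
      using assms(1,3) by (meson not_less)
    then have "P (b + int (nat (j - b)))"
      using j by simp
    then have "n \<le> nat (j - b)"
      unfolding n_def by (rule Least_le)
    then show "b + int n \<le> j"
      using \<open>b < j\<close> by linarith
  qed
  then show thesis using that by blast
qed

section \<open>Distances between lattice classes\<close>

lemma lattice_class_eq:
  assumes "Vector_Spaces.vector_space scale" "L \<in> lattice_class scale M"
  shows "lattice_class scale L = lattice_class scale M"
proof -
  interpret Vector_Spaces.vector_space scale by fact
  obtain c where c: "c \<noteq> 0" "L = scale c ` M"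
    using assms(2) unfolding lattice_class_def by blast
  show ?thesis
  proof
    show "lattice_class scale L \<subseteq> lattice_class scale M"
    proof
      fix Z assume "Z \<in> lattice_class scale L"
      then obtain d where "d \<noteq> 0" "Z = scale d ` L"
        unfolding lattice_class_def by blast
      then have "d * c \<noteq> 0 \<and> Z = scale (d * c) ` M"
        using c by (simp add: image_image)
      then show "Z \<in> lattice_class scale M"
        unfolding lattice_class_def by blast
    qed
    show "lattice_class scale M \<subseteq> lattice_class scale L"
    proof
      fix Z assume "Z \<in> lattice_class scale M"
      then obtain d where "d \<noteq> 0" "Z = scale d ` M"
        unfolding lattice_class_def by blast
      then have "d / c \<noteq> 0 \<and> Z = scale (d / c) ` L"
        using c by (simp add: image_image)
      then show "Z \<in> lattice_class scale L"
        unfolding lattice_class_def by blast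
    qed
  qed
qed

lemma lattice_class_self:
  assumes "Vector_Spaces.vector_space scale"
  shows "L \<in> lattice_class scale L"
proof -
  interpret Vector_Spaces.vector_space scale by fact
  show ?thesis
    unfolding lattice_class_def by (intro CollectI exI[of _ 1]) simp
qed

text \<open>Of convexity only the intersections of representatives are kept: since a class contains all multiples
  of its lattices, this covers all intersections of multiples.\<close>
locale lattice_configuration = coordinates scale B + uniformised \<pi>
  for scale :: "'r::idom fract \<Rightarrow> 'v::ab_group_add \<Rightarrow> 'v" and B and \<pi> :: 'r +
  fixes \<Gamma> :: "'v set set set" and g :: "'v set set \<Rightarrow> 'v \<Rightarrow> 'v"
  assumes basis_nonempty: "B \<noteq> {}"
    and finite_configuration: "finite \<Gamma>"
    and g_GL: "v \<in> \<Gamma> \<Longrightarrow> g v \<in> GL scale"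
    and g_class: "v \<in> \<Gamma> \<Longrightarrow> lattice_class scale (g v ` L0) = v"
    and class_Int: "v \<in> \<Gamma> \<Longrightarrow> w \<in> \<Gamma> \<Longrightarrow> L \<in> v \<Longrightarrow> L' \<in> w \<Longrightarrow> lattice_class scale (L \<inter> L') \<in> \<Gamma>"
begin

text \<open>The inclusion of \<open>\<pi>\<^sup>j L\<^sub>v\<close> into \<open>V\<close>, written in the coordinates that \<open>g v\<close> and \<open>g w\<close> provide.\<close>
definition transition :: "'v set set \<Rightarrow> 'v set set \<Rightarrow> int \<Rightarrow> 'v \<Rightarrow> 'v" where
  "transition v w j x = scale (power_pi j) (inv_into UNIV (g w) (g v x))"

definition lattice_at :: "'v set set \<Rightarrow> int \<Rightarrow> 'v set" where
  "lattice_at v j = scale (power_pi j) ` g v ` L0"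

lemma g_linear: "v \<in> \<Gamma> \<Longrightarrow> Vector_Spaces.linear scale scale (g v)"
  and g_bij: "v \<in> \<Gamma> \<Longrightarrow> bij (g v)"
  using g_GL unfolding GL_def by auto

lemma g_scale:
  assumes "v \<in> \<Gamma>"
  shows "g v (scale c x) = scale c (g v x)"
proof -
  interpret Vector_Spaces.linear scale scale "g v"
    using g_linear assms by blast
  show ?thesis by (rule scale)
qed

lemma g_inv: "w \<in> \<Gamma> \<Longrightarrow> g w (inv_into UNIV (g w) x) = x"
  using g_bij bij_is_surj surj_f_inv_f by metis

lemma inv_g: "w \<in> \<Gamma> \<Longrightarrow> inv_into UNIV (g w) (g w x) = x"
  using g_bij bij_is_inj inv_f_f by metis

lemma g_transition: "w \<in> \<Gamma> \<Longrightarrow> g w (transition v w j x) = scale (power_pi j) (g v x)"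
  unfolding transition_def by (simp add: g_scale g_inv)

lemma g_injectD: "w \<in> \<Gamma> \<Longrightarrow> g w x = g w y \<Longrightarrow> x = y"
  using inv_g by metis

lemma transition_linear:
  assumes "v \<in> \<Gamma>" "w \<in> \<Gamma>"
  shows "Vector_Spaces.linear scale scale (transition v w j)"
proof -
  interpret v: Vector_Spaces.linear scale scale "g v" using g_linear assms by blast
  interpret w: Vector_Spaces.linear scale scale "g w" using g_linear assms by blast
  have "transition v w j (x + y) = transition v w j x + transition v w j y" for x y
    by (rule g_injectD[OF assms(2)]) (simp add: assms g_transition w.add v.add B.scale_right_distrib)
  moreover have "transition v w j (scale c x) = scale c (transition v w j x)" for c x
    by (rule g_injectD[OF assms(2)]) (simp add: assms g_transition w.scale v.scale mult.commute)
  ultimately show ?thesis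
    by (simp add: Vector_Spaces.linear_iff B.vector_space_axioms)
qed

lemma transition_comp:
  assumes "v \<in> \<Gamma>" "w \<in> \<Gamma>" "u \<in> \<Gamma>"
  shows "transition w u i (transition v w j x) = transition v u (i + j) x"
  by (rule g_injectD[OF assms(3)]) (simp add: assms g_transition power_pi_add)

lemma transition_self: "v \<in> \<Gamma> \<Longrightarrow> transition v v j x = scale (power_pi j) x"
  unfolding transition_def by (simp add: inv_g)

lemma transition_shift: "transition v w (i + j) x = scale (power_pi i) (transition v w j x)"
  unfolding transition_def by (simp add: power_pi_add)

lemma integral_iff_basis:
  assumes "Vector_Spaces.linear scale scale h"
  shows "integral h \<longleftrightarrow> (\<forall>b\<in>B. h b \<in> L0)"
proof
  show "integral h \<Longrightarrow> \<forall>b\<in>B. h b \<in> L0"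
    unfolding integral_def using basis_subset_L0 by auto
  assume h: "\<forall>b\<in>B. h b \<in> L0"
  interpret h: Vector_Spaces.linear scale scale h by fact
  have "h x \<in> L0" if x: "x \<in> L0" for x
  proof -
    have "h x = (\<Sum>b\<in>B. scale (to_fract (rcoord x b)) (h b))"
      using arg_cong[OF coord_expansion[of x], of h] x by (simp add: h.sum h.scale to_fract_rcoord)
    then show ?thesis
      using h by (simp add: L0_sum L0_scale)
  qed
  then show "integral h"
    unfolding integral_def using assms by auto
qed

text \<open>Clear the denominators of the finitely many matrix entries.\<close>
lemma exists_integral_transition:
  assumes "v \<in> \<Gamma>" "w \<in> \<Gamma>"
  shows "\<exists>j. integral (transition v w j)"
proof -
  have "\<exists>N. \<forall>n\<ge>N. power_pi n * x \<in> range to_fract" for x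
  proof (cases "x = 0")
    case True
    then show ?thesis by (metis mult_zero_right rangeI to_fract_0)
  next
    case False
    then obtain u m where "u dvd 1" "x = to_fract u * power_pi m"
      using fract_unit_times_power by blast
    then have "power_pi n * x = to_fract u * power_pi (m + n)" for n
      by (simp add: power_pi_add)
    then have "\<forall>n\<ge>-m. power_pi n * x \<in> range to_fract"
      using unit_times_power_integral_iff[OF \<open>u dvd 1\<close>] by simp
    then show ?thesis ..
  qed
  then obtain N where N: "\<And>x n. N x \<le> n \<Longrightarrow> power_pi n * x \<in> range to_fract"
    by metis
  define n where "n = Max ((\<lambda>(a, b). N (coord (transition v w 0 b) a)) ` (B \<times> B))"
  have "N (coord (transition v w 0 b) a) \<le> n" if "a \<in> B" "b \<in> B" for a b
    unfolding n_def using that B.finite_Basis by (intro Max_ge) auto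
  then have "transition v w n b \<in> L0" if "b \<in> B" for b
    using that N transition_shift[of v w n 0 b] unfolding L0_def by (simp add: coord_linear)
  then show ?thesis
    using integral_iff_basis transition_linear assms by blast
qed

text \<open>Dividing by a power of \<open>\<pi>\<close> that exceeds the valuation of a nonzero matrix entry leaves the ring.\<close>
lemma exists_nonintegral_transition:
  assumes "v \<in> \<Gamma>" "w \<in> \<Gamma>"
  shows "\<exists>j. \<not> integral (transition v w j)"
proof -
  obtain b where b: "b \<in> B"
    using basis_nonempty by blast
  have "transition v w 0 b \<noteq> 0"
  proof
    assume "transition v w 0 b = 0"
    moreover interpret T: Vector_Spaces.linear scale scale "transition w v 0"
      using transition_linear assms by blast
    have "transition w v 0 (transition v w 0 b) = b"
      using transition_comp[of v w v 0 0 b] transition_self[of v 0 b] assms by (simp add: power_pi_0)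
    ultimately have "b = 0"
      by (simp add: T.zero)
    then show False
      using b B.independent_Basis B.dependent_zero by blast
  qed
  then obtain a where a: "a \<in> B" "coord (transition v w 0 b) a \<noteq> 0"
    using coord_ext[of "transition v w 0 b" 0] by (auto simp: coord_linear)
  then obtain u m where u: "u dvd 1" "coord (transition v w 0 b) a = to_fract u * power_pi m"
    using fract_unit_times_power by blast
  have "coord (transition v w (-m - 1) b) a = to_fract u * power_pi (- 1)"
    using transition_shift[of v w "-m - 1" 0 b] u(2) power_pi_add[of "-m - 1" m]
    by (simp add: coord_linear)
  then have "coord (transition v w (-m - 1) b) a \<notin> range to_fract"
    using unit_times_power_integral_iff[OF u(1), of "-1"] by simp
  then have "transition v w (-m - 1) b \<notin> L0"
    using a(1) unfolding L0_def mem_Collect_eq by blast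
  then show ?thesis
    unfolding integral_def using b basis_subset_L0 by blast
qed

lemma integral_transition_mono:
  assumes "integral (transition v w i)" "i \<le> j"
  shows "integral (transition v w j)"
proof -
  obtain r where r: "power_pi (j - i) = to_fract r"
    using power_pi_integral[of "j - i"] assms(2) by auto
  have "transition v w j = (\<lambda>x. scale (to_fract r) (transition v w i x))"
    using transition_shift[of v w "j - i" i] by (simp add: r fun_eq_iff)
  then show ?thesis
    using integral_scale assms(1) by simp
qed

text \<open>The least \<open>j\<close> with \<open>\<pi>\<^sup>j L\<^sub>v \<subseteq> L\<^sub>w\<close>, see \<open>lattice_at_subset_iff\<close>; it is not symmetric.\<close>
definition distance :: "'v set set \<Rightarrow> 'v set set \<Rightarrow> int" where
  "distance v w = (SOME d. \<forall>j. integral (transition v w j) \<longleftrightarrow> d \<le> j)"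

lemma integral_transition_iff:
  assumes "v \<in> \<Gamma>" "w \<in> \<Gamma>"
  shows "integral (transition v w j) \<longleftrightarrow> distance v w \<le> j"
proof -
  have "\<exists>d. \<forall>j. integral (transition v w j) \<longleftrightarrow> d \<le> j"
    using int_upward_closed_threshold[of "\<lambda>j. integral (transition v w j)"]
      integral_transition_mono exists_integral_transition[OF assms] exists_nonintegral_transition[OF assms]
    by metis
  then show ?thesis
    unfolding distance_def by (rule someI2_ex) blast
qed

lemma lattice_at_subset_iff:
  assumes "v \<in> \<Gamma>" "w \<in> \<Gamma>"
  shows "lattice_at v j \<subseteq> lattice_at w i \<longleftrightarrow> distance v w \<le> j - i"
proof -
  have "scale (power_pi j) (g v x) \<in> lattice_at w i \<longleftrightarrow> transition v w (j - i) x \<in> L0" for x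
  proof -
    have eq: "scale (power_pi j) (g v x) = scale (power_pi i) (g w (transition v w (j - i) x))"
      using assms power_pi_add[of i "j - i"] by (simp add: g_transition)
    show ?thesis
      unfolding eq lattice_at_def
      using B.scale_left_imp_eq[OF power_pi_nonzero[of i]] g_injectD[OF assms(2)] by blast
  qed
  then have "lattice_at v j \<subseteq> lattice_at w i \<longleftrightarrow> transition v w (j - i) ` L0 \<subseteq> L0"
    unfolding lattice_at_def[of v j] by auto
  also have "\<dots> \<longleftrightarrow> integral (transition v w (j - i))"
    unfolding integral_def using transition_linear assms by blast
  finally show ?thesis
    using integral_transition_iff assms by simp
qed

lemma distance_self: "v \<in> \<Gamma> \<Longrightarrow> distance v v = 0"
proof -
  assume v: "v \<in> \<Gamma>"
  obtain b where b: "b \<in> B"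
    using basis_nonempty by blast
  have "transition v v 0 = (\<lambda>x. x)"
    using transition_self[OF v, of 0] by (intro ext) (simp add: power_pi_0)
  then have "integral (transition v v 0)"
    using integral_id by simp
  moreover have "coord (scale (power_pi (- 1)) b) b \<notin> range to_fract"
    using b unit_times_power_integral_iff[of 1 "-1"] by (simp add: coord_linear coord_basis)
  then have "transition v v (- 1) b \<notin> L0"
    unfolding transition_self[OF v] L0_def mem_Collect_eq using b by blast
  then have "\<not> integral (transition v v (- 1))"
    unfolding integral_def using b basis_subset_L0 by blast
  ultimately show ?thesis
    using integral_transition_iff[OF v v, of 0] integral_transition_iff[OF v v, of "-1"] by auto
qed

lemma distance_triangle:
  assumes "u \<in> \<Gamma>" "v \<in> \<Gamma>" "w \<in> \<Gamma>"
  shows "distance u w \<le> distance u v + distance v w"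
proof -
  have "lattice_at u (distance u v + distance v w) \<subseteq> lattice_at v (distance v w)"
    "lattice_at v (distance v w) \<subseteq> lattice_at w 0"
    using lattice_at_subset_iff assms by auto
  then have "lattice_at u (distance u v + distance v w) \<subseteq> lattice_at w 0"
    by blast
  then show ?thesis
    using lattice_at_subset_iff assms by auto
qed

lemma lattice_at_mem: "v \<in> \<Gamma> \<Longrightarrow> lattice_at v j \<in> v"
proof -
  assume v: "v \<in> \<Gamma>"
  have "lattice_at v j \<in> lattice_class scale (g v ` L0)"
    unfolding lattice_class_def lattice_at_def using power_pi_nonzero by blast
  then show ?thesis
    using g_class[OF v] by simp
qed

lemma lattice_class_mem: "v \<in> \<Gamma> \<Longrightarrow> L \<in> v \<Longrightarrow> lattice_class scale L = v"
  using lattice_class_eq[OF B.vector_space_axioms, of L "g v ` L0"] g_class by simp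

lemma unit_scale_L0:
  assumes "u dvd 1"
  shows "scale (to_fract u) ` L0 = L0"
proof
  show "scale (to_fract u) ` L0 \<subseteq> L0"
    using L0_scale by auto
  obtain w where w: "to_fract u * to_fract w = (1 :: 'r fract)"
    using unit_inverse[OF assms] by blast
  show "L0 \<subseteq> scale (to_fract u) ` L0"
  proof
    fix x assume "x \<in> L0"
    then have "scale (to_fract w) x \<in> L0" "x = scale (to_fract u) (scale (to_fract w) x)"
      using L0_scale w by auto
    then show "x \<in> scale (to_fract u) ` L0" by blast
  qed
qed

text \<open>Up to a unit, which preserves the reference lattice, a scalar is a power of \<open>\<pi>\<close>.\<close>
lemma mem_is_lattice_at:
  assumes "v \<in> \<Gamma>" "L \<in> v"
  obtains j where "L = lattice_at v j"
proof -
  obtain c where c: "c \<noteq> 0" "L = scale c ` g v ` L0"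
    using assms g_class unfolding lattice_class_def by blast
  obtain u n where u: "u dvd 1" "c = to_fract u * power_pi n"
    using fract_unit_times_power c by blast
  have "scale c (g v x) = scale (power_pi n) (g v (scale (to_fract u) x))" for x
    unfolding u using assms by (simp add: g_scale mult.commute)
  then have "L = scale (power_pi n) ` g v ` scale (to_fract u) ` L0"
    unfolding c by (simp add: image_image)
  then show thesis
    using that unit_scale_L0[OF u(1)] unfolding lattice_at_def by simp
qed

text \<open>If both distances added up to zero, \<open>L\<^sub>v\<close> and \<open>L\<^sub>w\<close> would be multiples of each other.\<close>
lemma distance_separates:
  assumes "v \<in> \<Gamma>" "w \<in> \<Gamma>" "v \<noteq> w"
  shows "1 \<le> distance v w + distance w v"
proof (rule ccontr)
  assume "\<not> ?thesis"
  then have "lattice_at w 0 \<subseteq> lattice_at v (distance v w)" "lattice_at v (distance v w) \<subseteq> lattice_at w 0"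
    using lattice_at_subset_iff assms by auto
  then have eq: "lattice_at w 0 = lattice_at v (distance v w)"
    by blast
  have "lattice_class scale (lattice_at w 0) = w"
    using lattice_class_mem lattice_at_mem assms by blast
  moreover have "lattice_class scale (lattice_at w 0) = v"
    unfolding eq using lattice_class_mem lattice_at_mem assms by blast
  ultimately show False
    using assms by simp
qed

lemma lattice_at_Int:
  assumes "v \<in> \<Gamma>" "w \<in> \<Gamma>"
  obtains u l where "u \<in> \<Gamma>" "lattice_at u l = lattice_at v i \<inter> lattice_at w j"
proof -
  let ?X = "lattice_at v i \<inter> lattice_at w j"
  have "lattice_class scale ?X \<in> \<Gamma>"
    using class_Int lattice_at_mem assms by blast
  moreover have "?X \<in> lattice_class scale ?X"
    using lattice_class_self B.vector_space_axioms by blast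
  ultimately show thesis
    using mem_is_lattice_at that by metis
qed

lemma lattice_at_INT:
  assumes "v \<in> \<Gamma>" "S \<subseteq> \<Gamma>"
  obtains u l where "u \<in> \<Gamma>" "lattice_at u l = lattice_at v i \<inter> (\<Inter>w\<in>S. lattice_at w (n w))"
proof -
  have "\<exists>u\<in>\<Gamma>. \<exists>l. lattice_at u l = lattice_at v i \<inter> (\<Inter>w\<in>S. lattice_at w (n w))"
    using finite_subset[OF assms(2) finite_configuration] assms(2)
  proof (induction S rule: finite_induct)
    case empty
    then show ?case using assms(1) by auto
  next
    case (insert w S)
    then obtain u l where u: "u \<in> \<Gamma>" "lattice_at u l = lattice_at v i \<inter> (\<Inter>w\<in>S. lattice_at w (n w))"
      by auto
    obtain u' l' where "u' \<in> \<Gamma>" "lattice_at u' l' = lattice_at u l \<inter> lattice_at w (n w)"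
      using lattice_at_Int[of u w l "n w"] u insert by blast
    moreover have "lattice_at u l \<inter> lattice_at w (n w) =
        lattice_at v i \<inter> (\<Inter>w\<in>insert w S. lattice_at w (n w))"
      unfolding u(2) by blast
    ultimately show ?case by metis
  qed
  then show thesis using that by blast
qed

lemma adjacentI:
  assumes "v \<in> \<Gamma>" "w \<in> \<Gamma>" "v \<noteq> w" "distance v w + distance w v = 1"
  shows "adjacent scale \<pi> v w"
proof -
  have "scale (to_fract \<pi>) ` lattice_at w 0 = lattice_at w 1"
    unfolding lattice_at_def by (simp add: image_image power_pi_0 power_pi_1)
  then have 1: "scale (to_fract \<pi>) ` lattice_at w 0 \<subseteq> lattice_at v (distance v w)"
    using lattice_at_subset_iff assms by simp
  have 2: "lattice_at v (distance v w) \<subseteq> lattice_at w 0"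
    using lattice_at_subset_iff assms by simp
  show ?thesis
    unfolding adjacent_def
    by (intro conjI assms(3) bexI[OF _ lattice_at_mem[OF assms(1), of "distance v w"]]
        bexI[OF _ lattice_at_mem[OF assms(2), of 0]] 1 2)
qed

text \<open>The vertex \<open>u\<close> is the class of \<open>L\<^sub>w \<inter> \<pi>\<^sup>-\<^sup>1 M\<close>, where \<open>M\<close> is the largest multiple of \<open>L\<^sub>v\<close> contained in
  \<open>L\<^sub>w\<close>.  This is the first step of the chain \<open>L\<^sub>w \<inter> \<pi>\<^sup>-\<^sup>i M\<close>, which increases from \<open>M\<close> to \<open>L\<^sub>w\<close>.\<close>
lemma geodesic_step:
  assumes v: "v \<in> \<Gamma>" and w: "w \<in> \<Gamma>" and "v \<noteq> w"
  obtains u where "u \<in> \<Gamma>" "adjacent scale \<pi> v u" "distance v w = distance v u + distance u w"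
    "distance u w + distance w u < distance v w + distance w v"
proof -
  obtain u l where u: "u \<in> \<Gamma>" "lattice_at u l = lattice_at w 0 \<inter> lattice_at v (distance v w - 1)"
    using lattice_at_Int v w by blast
  have le: "distance z u \<le> j - l \<longleftrightarrow> distance z w \<le> j \<and> distance z v \<le> j - (distance v w - 1)"
    if z: "z \<in> \<Gamma>" for z j
  proof -
    have "lattice_at z j \<subseteq> lattice_at u l \<longleftrightarrow>
        lattice_at z j \<subseteq> lattice_at w 0 \<and> lattice_at z j \<subseteq> lattice_at v (distance v w - 1)"
      unfolding u(2) by simp
    then show ?thesis
      using lattice_at_subset_iff[OF z u(1)] lattice_at_subset_iff[OF z v] lattice_at_subset_iff[OF z w]
      by simp
  qed
  have below: "distance u w \<le> l" "distance u v \<le> l - (distance v w - 1)"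
    using le[OF u(1), of l] distance_self[OF u(1)] by auto
  have above_v: "distance v u \<le> distance v w - l"
    using le[OF v, of "distance v w"] distance_self[OF v] by auto
  have above_w: "distance w u \<le> distance w v + distance v w - 1 - l"
    using le[OF w, of "distance w v + distance v w - 1"] distance_self[OF w] distance_separates[OF assms] by auto
  have "u \<noteq> v"
    using below above_w distance_self[OF v] above_v by auto
  moreover have geo: "distance v w = distance v u + distance u w"
    using below above_v distance_triangle[OF v u(1) w] by auto
  moreover have "distance v u + distance u v = 1"
    using below above_v distance_separates[OF v u(1)] \<open>u \<noteq> v\<close> by auto
  ultimately show thesis
    using that[of u] u v adjacentI below above_w by auto
qed

text \<open>Entries of nonnegative valuation force the exponent of \<open>\<pi>\<close> in \<open>c\<close> to be at least the distance; if it
  were larger, all entries would be divisible by \<open>\<pi>\<close>.\<close>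
lemma edge_map_eq:
  assumes v: "v \<in> \<Gamma>" and w: "w \<in> \<Gamma>" and "c \<noteq> 0"
    and f: "f = (\<lambda>x. scale c (inv_into UNIV (g w) (g v x)))"
    and norm: "normalised scale \<pi> B f"
  obtains r where "r dvd 1" "f = (\<lambda>x. scale (to_fract r) (transition v w (distance v w) x))"
proof -
  obtain r n where r: "r dvd 1" "c = to_fract r * power_pi n"
    using fract_unit_times_power assms(3) by blast
  have f': "f x = scale (to_fract r) (transition v w n x)" for x
    unfolding f r transition_def by simp
  have entry: "entry scale B f a b = coord (f b) a" for a b
    unfolding entry_def coord_def ..
  obtain r' where r': "to_fract r * to_fract r' = (1 :: 'r fract)"
    using unit_inverse r by blast
  have "f b \<in> L0" if b: "b \<in> B" for b
    unfolding L0_def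
  proof (intro CollectI ballI)
    fix a assume a: "a \<in> B"
    show "coord (f b) a \<in> range to_fract"
    proof (cases "coord (f b) a = 0")
      case True
      then show ?thesis by (metis rangeI to_fract_0)
    next
      case False
      then obtain u m where u: "u dvd 1" "coord (f b) a = to_fract u * power_pi m"
        using fract_unit_times_power by blast
      then have "0 \<le> m"
        using norm a b False val_unit_times_power[OF u(1)] unfolding normalised_def entry by metis
      then show ?thesis
        using unit_times_power_integral_iff u by simp
    qed
  qed
  moreover have "transition v w n b = scale (to_fract r') (f b)" for b
    unfolding f' using r' by (simp add: mult.commute)
  ultimately have "transition v w n b \<in> L0" if "b \<in> B" for b
    using that L0_scale by simp
  then have le: "distance v w \<le> n"
    using integral_transition_iff integral_iff_basis transition_linear v w by blast
  moreover have "\<not> distance v w \<le> n - 1"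
  proof
    assume "distance v w \<le> n - 1"
    then have int: "integral (transition v w (n - 1))"
      using integral_transition_iff v w by blast
    obtain a b where ab: "a \<in> B" "b \<in> B" "coord (f b) a \<noteq> 0" "val \<pi> (coord (f b) a) = 0"
      using norm unfolding normalised_def entry by blast
    obtain u m where u: "u dvd 1" "coord (f b) a = to_fract u * power_pi m"
      using fract_unit_times_power ab by blast
    have "m = 0"
      using ab(4) val_unit_times_power[OF u(1), of m] u(2) by simp
    have "transition v w (n - 1) b \<in> L0"
      using int ab basis_subset_L0 unfolding integral_def by auto
    then have "scale (to_fract r) (transition v w (n - 1) b) \<in> L0"
      by (rule L0_scale)
    moreover have "scale (to_fract r) (transition v w (n - 1) b) = scale (power_pi (- 1)) (f b)"
      unfolding f' using transition_shift[of v w "-1" n b] by (simp add: mult.commute)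
    ultimately have "power_pi (- 1) * coord (f b) a \<in> range to_fract"
      using ab unfolding L0_def by (simp add: coord_linear)
    then have "to_fract u * power_pi (- 1) \<in> range to_fract"
      unfolding u(2) \<open>m = 0\<close> by (simp add: power_pi_0 mult.commute)
    then show False
      using unit_times_power_integral_iff[OF u(1), of "-1"] by simp
  qed
  ultimately have "n = distance v w" by simp
  then show thesis
    using that[OF r(1)] f' by (simp add: fun_eq_iff)
qed

end

section \<open>Exactness in the special fiber\<close>

locale fibre = lattice_configuration scale B \<pi> \<Gamma> g + base_change_setting scale B k \<phi>
  for scale :: "'r::idom fract \<Rightarrow> 'v::ab_group_add \<Rightarrow> 'v" and B and \<pi> and \<Gamma> and g
    and k :: "'e ring" (structure) and \<phi>
begin

text \<open>The base change of the inclusion of the largest multiple of \<open>L\<^sub>v\<close> that is contained in \<open>L\<^sub>w\<close>.\<close>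
definition H :: "'v set set \<Rightarrow> 'v set set \<Rightarrow> ('v \<Rightarrow> 'e) \<Rightarrow> 'v \<Rightarrow> 'e" where
  "H v w = bc (transition v w (distance v w))"

lemma integral_transition: "v \<in> \<Gamma> \<Longrightarrow> w \<in> \<Gamma> \<Longrightarrow> distance v w \<le> j \<Longrightarrow> integral (transition v w j)"
  using integral_transition_iff by blast

lemma H_closed: "s \<in> carrier E \<Longrightarrow> H v w s \<in> carrier E"
  unfolding H_def by (rule bc_closed)

lemma H_comp:
  assumes "u \<in> \<Gamma>" "v \<in> \<Gamma>" "w \<in> \<Gamma>" "s \<in> carrier E"
  shows "H v w (H u v s) = bc (transition u w (distance u v + distance v w)) s"
proof -
  have "H v w (H u v s) = bc (\<lambda>x. transition v w (distance v w) (transition u v (distance u v) x)) s"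
    unfolding H_def using assms by (intro bc_comp[symmetric] integral_transition) auto
  also have "(\<lambda>x. transition v w (distance v w) (transition u v (distance u v) x)) =
      transition u w (distance u v + distance v w)"
    using transition_comp[OF assms(1-3)] by (intro ext) (simp add: add.commute)
  finally show ?thesis .
qed

lemma H_geodesic:
  assumes "u \<in> \<Gamma>" "v \<in> \<Gamma>" "w \<in> \<Gamma>" "s \<in> carrier E" "distance u w = distance u v + distance v w"
  shows "H v w (H u v s) = H u w s"
  using H_comp assms by (simp add: H_def)

lemma H_self:
  assumes "v \<in> \<Gamma>" "s \<in> carrier E"
  shows "H v v s = s"
proof -
  have "transition v v 0 = (\<lambda>x. x)"
    using transition_self[OF assms(1), of 0] by (intro ext) (simp add: power_pi_0)
  then show ?thesis
    unfolding H_def using distance_self assms bc_id by simp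
qed

lemma bc_transition_shift:
  assumes "v \<in> \<Gamma>" "w \<in> \<Gamma>" "distance v w \<le> j" "s \<in> carrier E"
  shows "bc (transition v w (int n + j)) s = \<phi> (\<pi> ^ n) \<odot>\<^bsub>E\<^esub> bc (transition v w j) s"
proof -
  have "transition v w (int n + j) = (\<lambda>x. scale (to_fract (\<pi> ^ n)) (transition v w j x))"
    using transition_shift[of v w "int n" j] by (intro ext) (simp add: power_pi_nat)
  then show ?thesis
    using bc_scale integral_transition assms by simp
qed

text \<open>Going from \<open>v\<close> to \<open>w\<close> and back is multiplication by a power of \<open>\<pi>\<close>.\<close>
lemma H_nonzero_generic:
  assumes "\<phi> \<pi> \<noteq> \<zero>" "v \<in> \<Gamma>" "w \<in> \<Gamma>" "s \<in> carrier E" "s \<noteq> \<zero>\<^bsub>E\<^esub>"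
  shows "H v w s \<noteq> \<zero>\<^bsub>E\<^esub>"
proof
  assume 0: "H v w s = \<zero>\<^bsub>E\<^esub>"
  let ?n = "nat (distance v w + distance w v)"
  have "0 \<le> distance v w + distance w v"
    using distance_triangle[of v w v] distance_self assms by simp
  then have "H w v (H v w s) = bc (transition v v (int ?n + 0)) s"
    using H_comp[of v w v s] assms by simp
  also have "\<dots> = \<phi> (\<pi> ^ ?n) \<odot>\<^bsub>E\<^esub> H v v s"
    using bc_transition_shift[of v v 0 s ?n] distance_self assms by (simp add: H_def)
  finally have "\<phi> (\<pi> ^ ?n) \<odot>\<^bsub>E\<^esub> s = \<zero>\<^bsub>E\<^esub>"
    using 0 H_self assms by (simp add: H_def bc_zero)
  moreover have "\<phi> (\<pi> ^ n) \<noteq> \<zero>" for n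
    using assms(1) phi_closed integral by (induction n) (auto simp: phi_one phi_mult)
  ultimately show False
    using smult_eq_zero phi_closed assms by blast
qed

lemma E_apply:
  assumes "a \<in> B"
  shows "\<zero>\<^bsub>E\<^esub> a = \<zero>" "(x \<oplus>\<^bsub>E\<^esub> y) a = x a \<oplus> y a" "(c \<odot>\<^bsub>E\<^esub> x) a = c \<otimes> x a"
    "red z a = \<phi> (rcoord z a)"
  using assms by (simp_all add: kvec_simps(2-4) red_def)

text \<open>The combination \<open>\<Sum> c\<^sub>i red x\<^sub>i\<close> of reductions of lattice vectors \<open>x\<^sub>i\<close> with coefficients \<open>c\<^sub>i\<close> in
  \<open>k\<close>.  Keeping the \<open>x\<^sub>i\<close> visible makes it possible to lower the number of terms in \<open>kernel_spanned\<close>.\<close>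
primrec comb :: "('e \<times> 'v) list \<Rightarrow> 'v \<Rightarrow> 'e" where
  "comb [] = \<zero>\<^bsub>E\<^esub>"
| "comb (cx # l) = fst cx \<odot>\<^bsub>E\<^esub> red (snd cx) \<oplus>\<^bsub>E\<^esub> comb l"

lemma comb_closed: "set l \<subseteq> carrier k \<times> UNIV \<Longrightarrow> comb l \<in> carrier E"
  by (induction l) (auto simp: red_closed)

lemma comb_insert:
  assumes "set (l1 @ cx # l2) \<subseteq> carrier k \<times> UNIV"
  shows "comb (l1 @ cx # l2) = fst cx \<odot>\<^bsub>E\<^esub> red (snd cx) \<oplus>\<^bsub>E\<^esub> comb (l1 @ l2)"
  using assms
proof (induction l1)
  case (Cons a l1)
  then show ?case
    using comb_closed[of "l1 @ l2"] by (auto simp: red_closed M.a_lcomm)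
qed simp

lemma exists_comb: "s \<in> carrier E \<Longrightarrow> \<exists>l. set l \<subseteq> carrier k \<times> L0 \<and> comb l = s"
proof (induction rule: red_induct)
  case zero
  then show ?case by (intro exI[of _ "[]"]) simp
next
  case (red x c s)
  then obtain l where "set l \<subseteq> carrier k \<times> L0" "comb l = s"
    by blast
  then show ?case
    using red by (intro exI[of _ "(c, x) # l"]) auto
qed

lemma bc_comb:
  assumes "integral h" "set l \<subseteq> carrier k \<times> L0"
  shows "bc h (comb l) = comb (map (\<lambda>(c, x). (c, h x)) l)"
  using assms(2)
proof (induction l)
  case (Cons cx l)
  have "comb l \<in> carrier E"
    using Cons.prems by (intro comb_closed) auto
  then show ?case
    using Cons assms(1) by (cases cx) (simp add: bc_add bc_smult bc_red red_closed)
qed (simp add: bc_zero)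

context
  assumes special: "\<phi> \<pi> = \<zero>"
begin

lemma phi_eq_zero_iff: "\<phi> a = \<zero> \<longleftrightarrow> \<pi> dvd a"
proof
  assume "\<phi> a = \<zero>"
  then show "\<pi> dvd a"
    using phi_unit unit_iff by blast
next
  assume "\<pi> dvd a"
  then obtain b where "a = \<pi> * b" by (rule dvdE)
  then show "\<phi> a = \<zero>"
    using special phi_closed by (simp add: phi_mult)
qed

lemma H_detour:
  assumes "u \<in> \<Gamma>" "v \<in> \<Gamma>" "w \<in> \<Gamma>" "s \<in> carrier E" "distance u w < j"
  shows "bc (transition u w j) s = \<zero>\<^bsub>E\<^esub>"
  using bc_transition_shift[of u w "j - 1" s 1] assms special bc_closed by simp

lemma mem_scale_pi_L0:
  assumes "x \<in> L0" "\<And>b. b \<in> B \<Longrightarrow> \<pi> dvd rcoord x b"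
  obtains z where "z \<in> L0" "x = scale (to_fract \<pi>) z"
proof -
  let ?z = "scale (power_pi (- 1)) x"
  have x: "x = scale (to_fract \<pi>) ?z"
    using power_pi_add[of 1 "-1"] by (simp add: power_pi_0 power_pi_1)
  have "coord ?z b \<in> range to_fract" if b: "b \<in> B" for b
  proof -
    obtain r where "rcoord x b = \<pi> * r"
      using assms(2)[OF b] by (rule dvdE)
    then have "coord x b = power_pi 1 * to_fract r"
      using to_fract_rcoord[OF assms(1) b] by (simp add: power_pi_1)
    then have "coord ?z b = power_pi (- 1 + 1) * to_fract r"
      unfolding power_pi_add by (simp add: coord_linear)
    then show ?thesis
      by (simp add: power_pi_0)
  qed
  then have "?z \<in> L0"
    unfolding L0_def by blast
  then show thesis
    using that x by blast
qed

text \<open>Subtracting from every \<open>y\<close> a multiple of \<open>x\<close> changes the combination only by a multiple of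
  \<open>red x\<close>.  When \<open>r'\<close> is inverse to the \<open>a\<close>-th coordinate of \<open>h x\<close>, the multiple is chosen so that
  the \<open>a\<close>-th coordinate of the image under \<open>h\<close> vanishes.\<close>
lemma eliminate:
  assumes "integral h" "x \<in> L0" "set l \<subseteq> carrier k \<times> L0" "a \<in> B"
    and m: "m = map (\<lambda>(c, y). (c, y - scale (to_fract (r' * rcoord (h y) a)) x)) l"
  shows "set m \<subseteq> carrier k \<times> L0" and
    "comb m \<oplus>\<^bsub>E\<^esub> (\<phi> r' \<otimes> comb (map (\<lambda>(c, y). (c, h y)) l) a) \<odot>\<^bsub>E\<^esub> red x = comb l"
proof -
  show m_set: "set m \<subseteq> carrier k \<times> L0"
    using assms(3) L0_diff L0_scale[OF assms(2)] unfolding m by (auto simp del: to_fract_mult)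
  show "comb m \<oplus>\<^bsub>E\<^esub> (\<phi> r' \<otimes> comb (map (\<lambda>(c, y). (c, h y)) l) a) \<odot>\<^bsub>E\<^esub> red x = comb l"
    using assms(3) unfolding m
  proof (induction l)
    case Nil
    then show ?case
      using red_closed[of x] phi_closed[of r'] by (simp add: E_apply[OF assms(4)])
  next
    case (Cons cy l)
    obtain c y where cy: "cy = (c, y)" by (cases cy)
    have c: "c \<in> carrier k" "y \<in> L0" "set l \<subseteq> carrier k \<times> L0"
      using Cons.prems cy by auto
    let ?m = "map (\<lambda>(c, y). (c, y - scale (to_fract (r' * rcoord (h y) a)) x)) l"
    let ?l = "map (\<lambda>(c, y). (c, h y)) l"
    have hl: "set ?l \<subseteq> carrier k \<times> UNIV" and ml: "set ?m \<subseteq> carrier k \<times> UNIV"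
      using c by auto
    have closed: "comb ?m \<in> carrier E" "comb ?l \<in> carrier E" "comb l \<in> carrier E"
      using comb_closed[OF hl] comb_closed[OF ml] c by (auto intro: comb_closed)
    define e where "e = rcoord (h y) a"
    define S where "S = comb ?l a"
    have S: "S \<in> carrier k"
      unfolding S_def using closed assms(4) by (intro E_mem)
    have la: "comb (map (\<lambda>(c, y). (c, h y)) (cy # l)) a = c \<otimes> \<phi> e \<oplus> S"
      by (simp add: cy E_apply[OF assms(4)] e_def S_def)
    have "red (y - scale (to_fract (r' * e)) x) \<oplus>\<^bsub>E\<^esub> \<phi> (r' * e) \<odot>\<^bsub>E\<^esub> red x = red y"
      using red_add[of "y - scale (to_fract (r' * e)) x" "scale (to_fract (r' * e)) x"]
        red_scale[OF assms(2), of "r' * e"] L0_diff[OF c(2)] L0_scale[OF assms(2)]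
      by (simp del: to_fract_mult)
    then have y: "c \<odot>\<^bsub>E\<^esub> red (y - scale (to_fract (r' * e)) x) \<oplus>\<^bsub>E\<^esub> (\<phi> r' \<otimes> (c \<otimes> \<phi> e)) \<odot>\<^bsub>E\<^esub> red x = c \<odot>\<^bsub>E\<^esub> red y"
      using smult_r_distr[of c "red (y - scale (to_fract (r' * e)) x)" "\<phi> (r' * e) \<odot>\<^bsub>E\<^esub> red x"] c red_closed
        phi_closed by (simp add: smult_assoc1[symmetric] phi_mult R.m_lcomm)
    have IH: "comb ?m \<oplus>\<^bsub>E\<^esub> (\<phi> r' \<otimes> S) \<odot>\<^bsub>E\<^esub> red x = comb l"
      using Cons.IH[OF c(3)] unfolding S_def .
    let ?p = "c \<odot>\<^bsub>E\<^esub> red (y - scale (to_fract (r' * e)) x)"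
    let ?q = "(\<phi> r' \<otimes> (c \<otimes> \<phi> e)) \<odot>\<^bsub>E\<^esub> red x"
    let ?t = "(\<phi> r' \<otimes> S) \<odot>\<^bsub>E\<^esub> red x"
    have cl: "?p \<in> carrier E" "?q \<in> carrier E" "?t \<in> carrier E"
      using c red_closed phi_closed S by auto
    have "(\<phi> r' \<otimes> (c \<otimes> \<phi> e \<oplus> S)) \<odot>\<^bsub>E\<^esub> red x = ?q \<oplus>\<^bsub>E\<^esub> ?t"
      using c red_closed phi_closed S by (simp add: R.r_distr smult_l_distr)
    then have "(?p \<oplus>\<^bsub>E\<^esub> comb ?m) \<oplus>\<^bsub>E\<^esub> (\<phi> r' \<otimes> (c \<otimes> \<phi> e \<oplus> S)) \<odot>\<^bsub>E\<^esub> red x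
        = (?p \<oplus>\<^bsub>E\<^esub> ?q) \<oplus>\<^bsub>E\<^esub> (comb ?m \<oplus>\<^bsub>E\<^esub> ?t)"
      using cl closed by (simp add: M.a_ac)
    also have "\<dots> = c \<odot>\<^bsub>E\<^esub> red y \<oplus>\<^bsub>E\<^esub> comb l"
      unfolding y IH ..
    finally show ?case
      unfolding la by (simp add: cy e_def[symmetric])
  qed
qed

text \<open>The kernel over \<open>k\<close> of matrices with entries in the valuation ring is spanned by the kernel over the
  residue field.  If some \<open>x\<close> occurring in the combination is not mapped into \<open>\<pi>\<close> times the lattice by
  some \<open>h w\<close>, then a coordinate of \<open>h w x\<close> is a unit, and the vanishing of this coordinate of the image
  expresses the coefficient of \<open>x\<close> through the other coefficients.  Eliminating \<open>x\<close> shortens the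
  combination.\<close>
lemma kernel_spanned:
  assumes h: "\<And>w. w \<in> W \<Longrightarrow> integral (h w)"
    and l: "set l \<subseteq> carrier k \<times> L0"
    and zero: "\<And>w. w \<in> W \<Longrightarrow> bc (h w) (comb l) = \<zero>\<^bsub>E\<^esub>"
  shows "\<exists>l'. set l' \<subseteq> carrier k \<times> {x \<in> L0. \<forall>w\<in>W. \<forall>b\<in>B. \<pi> dvd rcoord (h w x) b} \<and> comb l' = comb l"
  using l zero
proof (induction "length l" arbitrary: l rule: less_induct)
  case less
  show ?case
  proof (cases "\<forall>(c, x)\<in>set l. \<forall>w\<in>W. \<forall>b\<in>B. \<pi> dvd rcoord (h w x) b")
    case True
    then show ?thesis
      using less.prems by (intro exI[of _ l]) auto
  next
    case False
    then obtain c x w a where x: "(c, x) \<in> set l" "w \<in> W" "a \<in> B" "\<not> \<pi> dvd rcoord (h w x) a"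
      by auto
    obtain l1 l2 where l12: "l = l1 @ (c, x) # l2"
      using x(1) by (meson split_list)
    have c: "c \<in> carrier k" "x \<in> L0" "set (l1 @ l2) \<subseteq> carrier k \<times> L0"
      using less.prems(1) unfolding l12 by auto
    have l_eq: "comb l = c \<odot>\<^bsub>E\<^esub> red x \<oplus>\<^bsub>E\<^esub> comb (l1 @ l2)"
      unfolding l12 using less.prems(1) l12 by (subst comb_insert) auto
    obtain r' where r': "1 = rcoord (h w x) a * r'"
      using x(4) unit_iff by (meson dvdE)
    define m where "m = map (\<lambda>(c, y). (c, y - scale (to_fract (r' * rcoord (h w y) a)) x)) (l1 @ l2)"
    let ?S = "comb (map (\<lambda>(c, y). (c, h w y)) (l1 @ l2)) a"
    have closed: "comb (l1 @ l2) \<in> carrier E"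
      using c by (intro comb_closed) auto
    have S_eq: "bc (h w) (comb (l1 @ l2)) = comb (map (\<lambda>(c, y). (c, h w y)) (l1 @ l2))"
      using bc_comb[OF h[OF x(2)] c(3)] .
    then have S: "?S \<in> carrier k"
      using bc_closed[OF closed] x(3) E_mem by metis
    have "\<zero>\<^bsub>E\<^esub> = c \<odot>\<^bsub>E\<^esub> red (h w x) \<oplus>\<^bsub>E\<^esub> comb (map (\<lambda>(c, y). (c, h w y)) (l1 @ l2))"
      using less.prems(2)[OF x(2)] c closed h[OF x(2)] unfolding l_eq
      by (simp add: bc_add bc_smult bc_red red_closed S_eq)
    then have "\<zero>\<^bsub>E\<^esub> a = (c \<odot>\<^bsub>E\<^esub> red (h w x) \<oplus>\<^bsub>E\<^esub> comb (map (\<lambda>(c, y). (c, h w y)) (l1 @ l2))) a"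
      by (rule arg_cong)
    then have "\<zero> = c \<otimes> \<phi> (rcoord (h w x) a) \<oplus> ?S"
      unfolding E_apply[OF x(3)] .
    then have "\<phi> r' \<otimes> \<zero> = \<phi> r' \<otimes> (c \<otimes> \<phi> (rcoord (h w x) a)) \<oplus> \<phi> r' \<otimes> ?S"
      using c S phi_closed by (metis R.r_distr R.m_closed)
    also have "\<phi> r' \<otimes> (c \<otimes> \<phi> (rcoord (h w x) a)) = c \<otimes> \<phi> (rcoord (h w x) a * r')"
      using c phi_closed by (simp add: phi_mult R.m_ac)
    finally have sum: "c \<oplus> \<phi> r' \<otimes> ?S = \<zero>"
      using c phi_closed by (simp add: r'[symmetric] phi_one)
    note el = eliminate[OF h[OF x(2)] c(2,3) x(3) m_def]
    have m_closed: "comb m \<in> carrier E"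
      using el(1) by (intro comb_closed) auto
    have "comb l = c \<odot>\<^bsub>E\<^esub> red x \<oplus>\<^bsub>E\<^esub> (comb m \<oplus>\<^bsub>E\<^esub> (\<phi> r' \<otimes> ?S) \<odot>\<^bsub>E\<^esub> red x)"
      unfolding l_eq el(2) ..
    also have "\<dots> = comb m \<oplus>\<^bsub>E\<^esub> (c \<oplus> \<phi> r' \<otimes> ?S) \<odot>\<^bsub>E\<^esub> red x"
      using c S phi_closed red_closed m_closed by (simp add: smult_l_distr M.a_ac)
    also have "\<dots> = comb m"
      unfolding sum using red_closed m_closed by simp
    finally have "comb l = comb m" .
    then show ?thesis
      using less.hyps[of m] el(1) less.prems(2) by (simp add: m_def l12)
  qed
qed

text \<open>By \<open>kernel_spanned\<close> it suffices to consider elements of \<open>L\<^sub>v\<close> whose images in \<open>L\<^sub>w\<close> are divisible by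
  \<open>\<pi>\<close> for all \<open>w \<in> S\<close>.  They form the lattice \<open>L\<^sub>v \<inter> \<Inter>\<^sub>w \<pi>\<^bsup>1 - d\<^esup> L\<^sub>w\<close> with \<open>d\<close> the distance from
  \<open>v\<close> to \<open>w\<close>, which is some \<open>\<pi>\<^sup>l L\<^sub>u\<close> by convexity.\<close>
lemma exactness:
  assumes v: "v \<in> \<Gamma>" and S: "S \<subseteq> \<Gamma>" and s: "s \<in> carrier E" "s \<noteq> \<zero>\<^bsub>E\<^esub>"
    and zero: "\<And>w. w \<in> S \<Longrightarrow> H v w s = \<zero>\<^bsub>E\<^esub>"
  shows "\<exists>u\<in>\<Gamma>. \<exists>y\<in>carrier E. s = H u v y \<and> (\<forall>w\<in>S. distance u w < distance u v + distance v w) \<and>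
    (\<forall>z\<in>\<Gamma>. \<forall>j. distance z v \<le> j \<longrightarrow> (\<forall>w\<in>S. distance z w < j + distance v w) \<longrightarrow>
       distance z u + distance u v \<le> j)"
proof -
  obtain u l where u: "u \<in> \<Gamma>"
    "lattice_at u l = lattice_at v 0 \<inter> (\<Inter>w\<in>S. lattice_at w (1 - distance v w))"
    using lattice_at_INT[OF v S, of 0 "\<lambda>w. 1 - distance v w"] by blast
  let ?h = "\<lambda>w. transition v w (distance v w)"
  have preimage: "\<exists>y\<in>L0. x = transition u v l y"
    if x: "x \<in> L0" "\<forall>w\<in>S. \<forall>b\<in>B. \<pi> dvd rcoord (?h w x) b" for x
  proof -
    have "g v x \<in> lattice_at v 0"
      unfolding lattice_at_def using x(1) by (auto simp: power_pi_0)
    moreover have "g v x \<in> lattice_at w (1 - distance v w)" if w: "w \<in> S" for w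
    proof -
      have wG: "w \<in> \<Gamma>" using w S by blast
      have "?h w x \<in> L0"
        using integral_transition[OF v wG] x(1) unfolding integral_def by blast
      then obtain z where z: "z \<in> L0" "?h w x = scale (to_fract \<pi>) z"
        using mem_scale_pi_L0 x(2) w by blast
      have "scale (power_pi (distance v w)) (g v x) = scale (power_pi 1) (g w z)"
        using g_transition[OF wG, of v "distance v w" x] unfolding z(2)
        by (simp add: g_scale[OF wG] power_pi_1)
      then have "scale (power_pi (- distance v w)) (scale (power_pi (distance v w)) (g v x)) =
          scale (power_pi (- distance v w)) (scale (power_pi 1) (g w z))"
        by simp
      then have "g v x = scale (power_pi (1 - distance v w)) (g w z)"
        using power_pi_add[of "- distance v w" "distance v w"] power_pi_add[of "- distance v w" 1]
        by (simp add: power_pi_0)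
      then show ?thesis
        unfolding lattice_at_def using z(1) by blast
    qed
    ultimately have "g v x \<in> lattice_at u l"
      unfolding u(2) by blast
    then obtain y where "y \<in> L0" "g v x = scale (power_pi l) (g u y)"
      unfolding lattice_at_def by blast
    then show ?thesis
      using g_injectD[OF v, of x "transition u v l y"] g_transition[OF v] by auto
  qed
  obtain l0 where l0: "set l0 \<subseteq> carrier k \<times> L0" "comb l0 = s"
    using exists_comb s by blast
  obtain l1 where l1: "set l1 \<subseteq> carrier k \<times> {x \<in> L0. \<forall>w\<in>S. \<forall>b\<in>B. \<pi> dvd rcoord (?h w x) b}"
    "comb l1 = s"
    using kernel_spanned[of S ?h l0] l0 zero S v integral_transition unfolding H_def by blast
  define pre where "pre x = (SOME y. y \<in> L0 \<and> x = transition u v l y)" for x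
  have pre: "pre x \<in> L0" "transition u v l (pre x) = x" if "(c, x) \<in> set l1" for c x
  proof -
    have "\<exists>y. y \<in> L0 \<and> x = transition u v l y"
      using preimage[of x] l1(1) that by blast
    then have "pre x \<in> L0 \<and> x = transition u v l (pre x)"
      unfolding pre_def by (rule someI_ex)
    then show "pre x \<in> L0" "transition u v l (pre x) = x" by auto
  qed
  let ?l2 = "map (\<lambda>(c, x). (c, pre x)) l1"
  have l2: "set ?l2 \<subseteq> carrier k \<times> L0"
    using pre l1(1) by auto
  have le: "distance u v \<le> l"
    using u(2) lattice_at_subset_iff[OF u(1) v, of l 0] by auto
  have "map (\<lambda>(c, x). (c, transition u v l x)) ?l2 = l1"
    unfolding map_map by (rule map_idI) (use pre in auto)
  then have s_eq: "bc (transition u v l) (comb ?l2) = s"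
    using bc_comb[OF integral_transition[OF u(1) v le] l2] l1(2) by simp
  have y: "comb ?l2 \<in> carrier E"
    using l2 by (intro comb_closed) auto
  \<comment> \<open>For larger \<open>l\<close> the inclusion is divisible by \<open>\<pi>\<close> and would have image zero over \<open>k\<close>.\<close>
  have l: "l = distance u v"
    using le H_detour[OF u(1) u(1) v y, of l] s_eq s(2) by fastforce
  have "\<forall>w\<in>S. distance u w < distance u v + distance v w"
  proof
    fix w assume w: "w \<in> S"
    then have "lattice_at u l \<subseteq> lattice_at w (1 - distance v w)"
      using u(2) by blast
    then show "distance u w < distance u v + distance v w"
      using lattice_at_subset_iff[of u w l "1 - distance v w"] u(1) w S l by auto
  qed
  moreover have "distance z u + distance u v \<le> j"
    if z: "z \<in> \<Gamma>" "distance z v \<le> j" "\<forall>w\<in>S. distance z w < j + distance v w" for z j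
  proof -
    have "lattice_at z j \<subseteq> lattice_at v 0"
      using lattice_at_subset_iff z v by simp
    moreover have "lattice_at z j \<subseteq> lattice_at w (1 - distance v w)" if "w \<in> S" for w
      using lattice_at_subset_iff[of z w j "1 - distance v w"] z that S by force
    ultimately have "lattice_at z j \<subseteq> lattice_at u l"
      unfolding u(2) by blast
    then show ?thesis
      using lattice_at_subset_iff z(1) u(1) l by simp
  qed
  ultimately show ?thesis
    using u(1) y s_eq l unfolding H_def by blast
qed

lemma geodesic_representation: "geodesic_representation k E \<Gamma> distance H"
proof
  fix u v w s assume *: "u \<in> \<Gamma>" "v \<in> \<Gamma>" "w \<in> \<Gamma>" "s \<in> carrier E"
  show "H v w (H u v s) = \<zero>\<^bsub>E\<^esub>" if "distance u w \<noteq> distance u v + distance v w"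
    using H_comp[OF *] H_detour[OF * , of "distance u v + distance v w"] distance_triangle[OF *(1-3)] that
    by simp
qed (use finite_configuration distance_self distance_triangle distance_separates H_closed
    H_self H_geodesic exactness in \<open>auto simp: H_def bc_add bc_smult\<close>)

end

end

section \<open>Infinitude of the field of a special point\<close>

text \<open>The assumption on \<open>\<phi>\<close> says that its kernel is contained in the maximal ideal, so its image is at
  least as large as the residue field.\<close>
lemma (in uniformised) algebraically_closed_residue_infinite:
  assumes "algebraically_closed (ring_of TYPE('r) Quot (PIdl\<^bsub>ring_of TYPE('r)\<^esub> \<pi>))"
    and "\<And>a b. \<phi> a = \<phi> b \<Longrightarrow> \<pi> dvd a - b"
    and "range \<phi> \<subseteq> K"
  shows "infinite K"
proof
  let ?R = "ring_of TYPE('r)"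
  let ?I = "PIdl\<^bsub>?R\<^esub> \<pi>"
  assume fin: "finite K"
  have coset: "?I +>\<^bsub>?R\<^esub> a = {x. \<pi> dvd x - a}" for a
    unfolding a_r_coset_def' PIdl_ring_of ring_of_simps
    by (auto intro!: exI[of _ "_ - a"])
  have coset_eq: "?I +>\<^bsub>?R\<^esub> a = ?I +>\<^bsub>?R\<^esub> b" if "\<phi> a = \<phi> b" for a b
  proof -
    have "\<pi> dvd x - a \<longleftrightarrow> \<pi> dvd x - b" for x
      using assms(2)[OF that] by (metis dvd_add_right_iff diff_add_cancel add_diff_eq dvd_diff)
    then show ?thesis
      unfolding coset by simp
  qed
  have some: "?I +>\<^bsub>?R\<^esub> a = ?I +>\<^bsub>?R\<^esub> (SOME b. \<phi> b = \<phi> a)" for a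
  proof (rule coset_eq)
    show "\<phi> a = \<phi> (SOME b. \<phi> b = \<phi> a)"
      by (rule sym, rule someI[of "\<lambda>b. \<phi> b = \<phi> a" a], rule refl)
  qed
  have "carrier (?R Quot ?I) \<subseteq> (\<lambda>y. ?I +>\<^bsub>?R\<^esub> (SOME b. \<phi> b = y)) ` K"
  proof
    fix C assume "C \<in> carrier (?R Quot ?I)"
    then obtain a where a: "C = ?I +>\<^bsub>?R\<^esub> a"
      unfolding FactRing_def A_RCOSETS_def' by auto
    show "C \<in> (\<lambda>y. ?I +>\<^bsub>?R\<^esub> (SOME b. \<phi> b = y)) ` K"
    proof (rule image_eqI[of _ _ "\<phi> a"])
      show "C = ?I +>\<^bsub>?R\<^esub> (SOME b. \<phi> b = \<phi> a)"
        unfolding a by (rule some)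
      show "\<phi> a \<in> K"
        using assms(3) by blast
    qed
  qed
  then have "finite (carrier (?R Quot ?I))"
    using fin finite_subset by blast
  then show False
    using algebraically_closed_infinite[OF assms(1)] by blast
qed

section \<open>Field-valued points as compatible families of lines\<close>

lemma point_of_cong:
  assumes "\<And>v. v \<in> \<Gamma> \<Longrightarrow> F v = F' v"
  shows "point_of B \<Gamma> k \<phi> F = point_of B \<Gamma> k \<phi> F'"
  unfolding point_of_def using assms by simp

locale prelinked_fibre = fibre scale B \<pi> \<Gamma> g k \<phi>
  for scale :: "'r::idom fract \<Rightarrow> 'v::ab_group_add \<Rightarrow> 'v" and B and \<pi> and \<Gamma> and g
    and k :: "'e ring" (structure) and \<phi> +
  fixes f :: "'v set set \<Rightarrow> 'v set set \<Rightarrow> 'v \<Rightarrow> 'v"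
  assumes edge_map: "v \<in> \<Gamma> \<Longrightarrow> w \<in> \<Gamma> \<Longrightarrow> adjacent scale \<pi> v w \<Longrightarrow>
    \<exists>r. r dvd 1 \<and> f v w = (\<lambda>x. scale (to_fract r) (transition v w (distance v w) x))"
begin

text \<open>The condition that the vectors \<open>s v\<close> span a point.  It agrees with \<open>compatible\<close> in the special fiber
  but makes sense without the assumption that \<open>\<pi>\<close> vanishes in \<open>k\<close>.\<close>
definition compat :: "('v set set \<Rightarrow> 'v \<Rightarrow> 'e) \<Rightarrow> bool" where
  "compat s \<longleftrightarrow> (\<forall>v\<in>\<Gamma>. s v \<in> carrier E - {\<zero>\<^bsub>E\<^esub>}) \<and>
     (\<forall>v\<in>\<Gamma>. \<forall>w\<in>\<Gamma>. H v w (s v) \<in> line_through (s w))"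

lemma span1_eq: "span1 B k x = line_through x"
  unfolding span1_def line_through_def kvec_simps(4) ..

lemma basis_of_line_iff:
  "basis_of_line B k x L \<longleftrightarrow> x \<in> carrier E \<and> x \<noteq> \<zero>\<^bsub>E\<^esub> \<and> L = line_through x"
  unfolding basis_of_line_def span1_eq by (simp add: kvec_simps(1,2))

lemma basis_of_line_mem:
  assumes "x \<in> carrier E" "y \<in> line_through x" "y \<noteq> \<zero>\<^bsub>E\<^esub>"
  shows "basis_of_line B k y (line_through x)"
proof -
  have y: "y \<in> carrier E"
    by (rule line_through_closed[OF assms(1,2)])
  have "line_through y = line_through x"
    using line_through_trans[OF assms(1,2)] line_through_trans[OF y line_through_sym[OF assms]] by blast
  then show ?thesis
    unfolding basis_of_line_iff using assms(3) y by simp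
qed

lemma edge_scalar:
  assumes "v \<in> \<Gamma>" "w \<in> \<Gamma>" "adjacent scale \<pi> v w"
  obtains c where "c \<in> carrier k" "c \<noteq> \<zero>" "\<And>s. s \<in> carrier E \<Longrightarrow> bc (f v w) s = c \<odot>\<^bsub>E\<^esub> H v w s"
proof -
  obtain r where r: "r dvd 1" "f v w = (\<lambda>x. scale (to_fract r) (transition v w (distance v w) x))"
    using edge_map[OF assms] by blast
  show thesis
  proof (rule that[OF phi_closed phi_unit[OF r(1)]])
    fix s assume "s \<in> carrier E"
    then show "bc (f v w) s = \<phi> r \<odot>\<^bsub>E\<^esub> H v w s"
      unfolding r(2) H_def using assms(1,2) by (intro bc_scale integral_transition) auto
  qed
qed

lemma H_smult: "s \<in> carrier E \<Longrightarrow> c \<in> carrier k \<Longrightarrow> H v w (c \<odot>\<^bsub>E\<^esub> s) = c \<odot>\<^bsub>E\<^esub> H v w s"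
  unfolding H_def by (rule bc_smult)

lemma H_line_through:
  "s \<in> carrier E \<Longrightarrow> y \<in> line_through s \<Longrightarrow> H v w y \<in> line_through (H v w s)"
  unfolding line_through_def using H_smult by auto

text \<open>Each geodesic step from \<open>v\<close> to \<open>u\<close> lowers the symmetrised distance to \<open>w\<close>.\<close>
lemma geodesic_induct [consumes 2, case_names refl step]:
  assumes "v \<in> \<Gamma>" "w \<in> \<Gamma>"
    and "P w"
    and "\<And>v u. v \<in> \<Gamma> \<Longrightarrow> u \<in> \<Gamma> \<Longrightarrow> adjacent scale \<pi> v u \<Longrightarrow>
      distance v w = distance v u + distance u w \<Longrightarrow> P u \<Longrightarrow> P v"
  shows "P v"
  using assms(1)
proof (induction "nat (distance v w + distance w v)" arbitrary: v rule: less_induct)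
  case less
  show ?case
  proof (cases "v = w")
    case False
    then obtain u where u: "u \<in> \<Gamma>" "adjacent scale \<pi> v u" "distance v w = distance v u + distance u w"
      "distance u w + distance w u < distance v w + distance w v"
      using geodesic_step[OF less.prems assms(2)] by blast
    have "0 < distance v w + distance w v"
      using distance_separates[OF less.prems assms(2) False] by simp
    then have "P u"
      using less.hyps[of u] u by simp
    then show ?thesis
      using assms(4)[OF less.prems u(1,2,3)] by blast
  qed (simp add: assms(3))
qed

lemma exists_geodesic_path:
  assumes "v \<in> \<Gamma>" "w \<in> \<Gamma>"
  shows "\<exists>P c. path_from_to scale \<pi> \<Gamma> v w P \<and> c \<in> carrier k \<and> c \<noteq> \<zero> \<and>
    (\<forall>s\<in>carrier E. path_map (\<lambda>u w. bc (f u w)) P s = c \<odot>\<^bsub>E\<^esub> H v w s)"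
  using assms
proof (induction rule: geodesic_induct)
  case refl
  have "path_from_to scale \<pi> \<Gamma> w w [w]"
    using assms unfolding path_from_to_def by simp
  then show ?case
    using H_self assms by (intro exI[of _ "[w]"] exI[of _ \<one>]) auto
next
  case (step v u)
  obtain P c where P: "path_from_to scale \<pi> \<Gamma> u w P" "c \<in> carrier k" "c \<noteq> \<zero>"
    "\<forall>s\<in>carrier E. path_map (\<lambda>u w. bc (f u w)) P s = c \<odot>\<^bsub>E\<^esub> H u w s"
    using step.IH by blast
  obtain d where d: "d \<in> carrier k" "d \<noteq> \<zero>" "\<And>s. s \<in> carrier E \<Longrightarrow> bc (f v u) s = d \<odot>\<^bsub>E\<^esub> H v u s"
    using edge_scalar step by blast
  obtain P' where P': "P = u # P'"
    using P(1) unfolding path_from_to_def by (cases P) auto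
  have "path_from_to scale \<pi> \<Gamma> v w (v # P)"
    using P(1) step unfolding path_from_to_def P' by auto
  moreover have "path_map (\<lambda>u w. bc (f u w)) (v # P) s = (c \<otimes> d) \<odot>\<^bsub>E\<^esub> H v w s"
    if s: "s \<in> carrier E" for s
  proof -
    have "path_map (\<lambda>u w. bc (f u w)) (v # P) s = path_map (\<lambda>u w. bc (f u w)) P (bc (f v u) s)"
      unfolding P' by simp
    also have "\<dots> = c \<odot>\<^bsub>E\<^esub> H u w (bc (f v u) s)"
      using P(4) bc_closed[OF s] by blast
    also have "\<dots> = c \<odot>\<^bsub>E\<^esub> H u w (d \<odot>\<^bsub>E\<^esub> H v u s)"
      unfolding d(3)[OF s] ..
    also have "\<dots> = (c \<otimes> d) \<odot>\<^bsub>E\<^esub> H u w (H v u s)"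
      using P d s H_closed H_smult by (simp add: smult_assoc1)
    also have "H u w (H v u s) = H v w s"
      using H_geodesic step assms s by simp
    finally show ?thesis .
  qed
  moreover have "c \<otimes> d \<in> carrier k" "c \<otimes> d \<noteq> \<zero>"
    using P d integral by auto
  ultimately show ?case
    by blast
qed

text \<open>A point is only required to respect the maps of edges.  The maps between arbitrary vertices are composed
  of those along geodesics.\<close>
lemma LG_field_point_iff:
  "LG_field_point scale \<pi> B \<Gamma> f k \<phi> F \<longleftrightarrow> (\<exists>s. compat s \<and> (\<forall>v\<in>\<Gamma>. F v = line_through (s v)))"
proof
  assume F: "LG_field_point scale \<pi> B \<Gamma> f k \<phi> F"
  then have "\<forall>v\<in>\<Gamma>. \<exists>x. basis_of_line B k x (F v)"
    unfolding LG_field_point_def line_def by blast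
  then obtain s where s: "\<And>v. v \<in> \<Gamma> \<Longrightarrow> s v \<in> carrier E" "\<And>v. v \<in> \<Gamma> \<Longrightarrow> s v \<noteq> \<zero>\<^bsub>E\<^esub>"
    "\<And>v. v \<in> \<Gamma> \<Longrightarrow> F v = line_through (s v)"
    unfolding basis_of_line_iff by metis
  have adj: "H v u (s v) \<in> line_through (s u)"
    if vu: "v \<in> \<Gamma>" "u \<in> \<Gamma>" "adjacent scale \<pi> v u" for v u
  proof -
    obtain c where c: "c \<in> carrier k" "c \<noteq> \<zero>" "\<And>s. s \<in> carrier E \<Longrightarrow> bc (f v u) s = c \<odot>\<^bsub>E\<^esub> H v u s"
      using edge_scalar vu by blast
    have "bc (f v u) (s v) \<in> line_through (s u)"
      using F vu line_through_self[OF s(1)[OF vu(1)]] s(3) unfolding LG_field_point_def by blast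
    then have "inv c \<odot>\<^bsub>E\<^esub> (c \<odot>\<^bsub>E\<^esub> H v u (s v)) \<in> line_through (s u)"
      using c s vu inverse_closed line_through_smult by auto
    then show ?thesis
      using smult_inverse c H_closed s vu by simp
  qed
  have "H v w (s v) \<in> line_through (s w)" if "v \<in> \<Gamma>" "w \<in> \<Gamma>" for v w
    using that
  proof (induction rule: geodesic_induct)
    case refl
    then show ?case
      using H_self s that line_through_self by simp
  next
    case (step v u)
    have "H u w (H v u (s v)) \<in> line_through (H u w (s u))"
      using adj step s by (intro H_line_through) auto
    then show ?case
      using H_geodesic[of v u w "s v"] step that s line_through_trans by auto
  qed
  then show "\<exists>s. compat s \<and> (\<forall>v\<in>\<Gamma>. F v = line_through (s v))"
    unfolding compat_def using s by blast
next
  assume "\<exists>s. compat s \<and> (\<forall>v\<in>\<Gamma>. F v = line_through (s v))"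
  then obtain s where s: "compat s" "\<And>v. v \<in> \<Gamma> \<Longrightarrow> F v = line_through (s v)"
    by blast
  have "line B k (F v)" if "v \<in> \<Gamma>" for v
    using s that unfolding line_def basis_of_line_iff compat_def by blast
  moreover have "bc (f v w) ` F v \<subseteq> F w" if vw: "v \<in> \<Gamma>" "w \<in> \<Gamma>" "adjacent scale \<pi> v w" for v w
  proof
    fix y assume "y \<in> bc (f v w) ` F v"
    then obtain x where x: "x \<in> line_through (s v)" "y = bc (f v w) x"
      using s(2) vw by auto
    obtain c where c: "c \<in> carrier k" "\<And>s. s \<in> carrier E \<Longrightarrow> bc (f v w) s = c \<odot>\<^bsub>E\<^esub> H v w s"
      using edge_scalar vw by blast
    have sv: "s v \<in> carrier E" "s w \<in> carrier E" "H v w (s v) \<in> line_through (s w)"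
      using s(1) vw unfolding compat_def by auto
    then have "H v w x \<in> line_through (s w)"
      using H_line_through[OF _ x(1)] line_through_trans by blast
    then show "y \<in> F w"
      using x c sv line_through_closed line_through_smult s(2) vw by simp
  qed
  moreover have "field_over TYPE('r) k \<phi>"
    unfolding field_over_def using field_axioms phi_hom by blast
  ultimately show "LG_field_point scale \<pi> B \<Gamma> f k \<phi> F"
    unfolding LG_field_point_def by blast
qed

lemma simple_field_pointI:
  assumes s: "compat s" and v: "v \<in> \<Gamma>" "\<And>w. w \<in> \<Gamma> \<Longrightarrow> H v w (s v) \<noteq> \<zero>\<^bsub>E\<^esub>"
  shows "simple_field_point scale \<pi> B \<Gamma> f k \<phi> (\<lambda>w. line_through (s w))"
proof -
  have sE: "s w \<in> carrier E" if "w \<in> \<Gamma>" for w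
    using s that unfolding compat_def by blast
  have "\<exists>P. path_from_to scale \<pi> \<Gamma> v w P \<and>
      basis_of_line B k (path_map (\<lambda>u w. bc (f u w)) P (s v)) (line_through (s w))" if w: "w \<in> \<Gamma>" for w
  proof -
    obtain P c where P: "path_from_to scale \<pi> \<Gamma> v w P" "c \<in> carrier k" "c \<noteq> \<zero>"
      "path_map (\<lambda>u w. bc (f u w)) P (s v) = c \<odot>\<^bsub>E\<^esub> H v w (s v)"
      using exists_geodesic_path[OF v(1) w] sE[OF v(1)] by blast
    have "H v w (s v) \<in> line_through (s w)"
      using s v(1) w unfolding compat_def by blast
    then have "c \<odot>\<^bsub>E\<^esub> H v w (s v) \<in> line_through (s w)"
      using line_through_smult sE w P by blast
    moreover have "c \<odot>\<^bsub>E\<^esub> H v w (s v) \<noteq> \<zero>\<^bsub>E\<^esub>"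
      using smult_eq_zero P v H_closed sE w by blast
    ultimately show ?thesis
      using P basis_of_line_mem sE w by auto
  qed
  moreover have "LG_field_point scale \<pi> B \<Gamma> f k \<phi> (\<lambda>w. line_through (s w))"
    unfolding LG_field_point_iff using s by blast
  ultimately show ?thesis
    unfolding simple_field_point_def using v(1) line_through_self sE by blast
qed

section \<open>Simple points near a given point\<close>

lemma finite_zeros_of_pencil:
  assumes "s \<in> carrier E" "x \<in> carrier E" "s \<noteq> \<zero>\<^bsub>E\<^esub>"
  shows "finite {t \<in> carrier k. s \<oplus>\<^bsub>E\<^esub> t \<odot>\<^bsub>E\<^esub> x = \<zero>\<^bsub>E\<^esub>}"
proof -
  have "\<exists>b\<in>B. s b \<noteq> \<zero>"
  proof (rule ccontr)
    assume "\<not> (\<exists>b\<in>B. s b \<noteq> \<zero>)"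
    then have "s = \<zero>\<^bsub>E\<^esub>"
      using assms(1) unfolding kvec_simps by (intro PiE_ext[of s B "\<lambda>_. carrier k"]) auto
    then show False using assms(3) by simp
  qed
  then obtain b where b: "b \<in> B" "s b \<noteq> \<zero>" by blast
  have "polynomial_function (\<lambda>t. s b \<oplus> t \<otimes> x b)"
    using assms b E_mem
    by (intro polynomial_function_add polynomial_function_mult polynomial_function_const
        polynomial_function_id) auto
  moreover have "s b \<oplus> \<zero> \<otimes> x b \<noteq> \<zero>"
    using b assms E_mem by simp
  ultimately have "finite {t \<in> carrier k. s b \<oplus> t \<otimes> x b = \<zero>}"
    using polynomial_function_finite_zeros[of _ \<zero>] by blast
  moreover have "{t \<in> carrier k. s \<oplus>\<^bsub>E\<^esub> t \<odot>\<^bsub>E\<^esub> x = \<zero>\<^bsub>E\<^esub>} \<subseteq> {t \<in> carrier k. s b \<oplus> t \<otimes> x b = \<zero>}"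
    using E_apply[OF b(1)] by (smt (verit, ccfv_SIG) mem_Collect_eq subsetI)
  ultimately show ?thesis
    using finite_subset by blast
qed

text \<open>At vectors that depend affinely on \<open>t\<close> the polynomial \<open>q\<close> becomes a polynomial function of \<open>t\<close>, and by
  assumption this function is nonzero at \<open>t = 0\<close> for a suitable choice \<open>y\<close> of vectors on the lines.\<close>
lemma finite_vanishing_in_pencil:
  assumes q: "multihomogeneous B \<Gamma> q" "q \<notin> point_of B \<Gamma> k \<phi> (\<lambda>v. line_through (s v))"
    and sx: "\<And>v. v \<in> \<Gamma> \<Longrightarrow> s v \<in> carrier E" "\<And>v. v \<in> \<Gamma> \<Longrightarrow> x v \<in> carrier E"
  shows "finite {t \<in> carrier k. q \<in> point_of B \<Gamma> k \<phi> (\<lambda>v. line_through (s v \<oplus>\<^bsub>E\<^esub> t \<odot>\<^bsub>E\<^esub> x v))}"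
proof -
  obtain y where y: "\<And>v. v \<in> \<Gamma> \<Longrightarrow> y v \<in> line_through (s v)" "eval_mpoly k \<phi> (\<lambda>(v, b). y v b) q \<noteq> \<zero>"
    using q unfolding point_of_def by blast
  have "\<forall>v\<in>\<Gamma>. \<exists>c. c \<in> carrier k \<and> y v = c \<odot>\<^bsub>E\<^esub> s v"
    using y(1) unfolding line_through_def by blast
  then obtain c where c: "\<And>v. v \<in> \<Gamma> \<Longrightarrow> c v \<in> carrier k" "\<And>v. v \<in> \<Gamma> \<Longrightarrow> y v = c v \<odot>\<^bsub>E\<^esub> s v"
    by metis
  define z where "z t v = c v \<odot>\<^bsub>E\<^esub> (s v \<oplus>\<^bsub>E\<^esub> t \<odot>\<^bsub>E\<^esub> x v)" for t v
  let ?h = "\<lambda>t. eval_mpoly k \<phi> (\<lambda>(v, b). z t v b) q"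
  have keys: "i \<in> \<Gamma> \<times> B" if "m \<in> Poly_Mapping.keys q" "i \<in> Poly_Mapping.keys m" for m i
    using q(1) that unfolding multihomogeneous_def by blast
  have z_poly: "polynomial_function (\<lambda>t. (\<lambda>(v, b). z t v b) i)" if i: "i \<in> \<Gamma> \<times> B" for i
  proof -
    obtain v b where vb: "i = (v, b)" "v \<in> \<Gamma>" "b \<in> B"
      using i by auto
    have "polynomial_function (\<lambda>t. c v \<otimes> (s v b \<oplus> t \<otimes> x v b))"
      using vb sx E_mem c
      by (intro polynomial_function_add polynomial_function_mult polynomial_function_const
          polynomial_function_id) auto
    then show ?thesis
      unfolding vb(1) z_def prod.case E_apply[OF vb(3)] .
  qed
  have "polynomial_function ?h"
    unfolding eval_mpoly_def
    using keys z_poly phi_closed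
    by (intro polynomial_function_finsum polynomial_function_mult polynomial_function_const
        polynomial_function_finprod polynomial_function_pow) auto
  moreover have "?h \<zero> \<noteq> \<zero>"
  proof -
    have "z \<zero> v = y v" if "v \<in> \<Gamma>" for v
      using that c sx by (simp add: z_def)
    then have "(\<lambda>(v, b). z \<zero> v b) i = (\<lambda>(v, b). y v b) i"
      if "m \<in> Poly_Mapping.keys q" "i \<in> Poly_Mapping.keys m" for m i
      using keys[OF that] by auto
    moreover have "(\<lambda>(v, b). y v b) i \<in> carrier k"
      if "m \<in> Poly_Mapping.keys q" "i \<in> Poly_Mapping.keys m" for m i
      using keys[OF that] c sx by (auto intro!: E_mem)
    ultimately have "?h \<zero> = eval_mpoly k \<phi> (\<lambda>(v, b). y v b) q"
      unfolding eval_mpoly_def using phi_closed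
      by (intro R.finsum_cong' refl arg_cong2[where f = "(\<otimes>)"] R.finprod_cong') (auto intro!: R.finprod_closed)
    then show ?thesis
      using y(2) by simp
  qed
  ultimately have "finite {t \<in> carrier k. ?h t = \<zero>}"
    using polynomial_function_finite_zeros[of ?h \<zero>] by blast
  moreover have "{t \<in> carrier k. q \<in> point_of B \<Gamma> k \<phi> (\<lambda>v. line_through (s v \<oplus>\<^bsub>E\<^esub> t \<odot>\<^bsub>E\<^esub> x v))}
      \<subseteq> {t \<in> carrier k. ?h t = \<zero>}"
  proof
    fix t assume t: "t \<in> {t \<in> carrier k. q \<in> point_of B \<Gamma> k \<phi> (\<lambda>v. line_through (s v \<oplus>\<^bsub>E\<^esub> t \<odot>\<^bsub>E\<^esub> x v))}"
    have "z t v \<in> line_through (s v \<oplus>\<^bsub>E\<^esub> t \<odot>\<^bsub>E\<^esub> x v)" if "v \<in> \<Gamma>" for v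
      unfolding z_def line_through_def using c(1)[OF that] by blast
    then show "t \<in> {t \<in> carrier k. ?h t = \<zero>}"
      using t unfolding point_of_def by blast
  qed
  ultimately show ?thesis
    using finite_subset by blast
qed

text \<open>Among the points over \<open>k\<close> at which no polynomial of \<open>Q\<close> vanishes, choose one with the largest number of
  pairs \<open>(v, w)\<close> such that \<open>v\<close> generates \<open>w\<close>.  If it were not simple, \<open>deformation\<close> would enlarge this
  number for all but finitely many \<open>t\<close>, and \<open>k\<close> is infinite.\<close>
lemma special_simple_point_nearby:
  assumes special: "\<phi> \<pi> = \<zero>" and inf: "infinite (carrier k)" and ne: "\<Gamma> \<noteq> {}"
    and s: "compat s"
    and Q: "finite Q" "\<And>q. q \<in> Q \<Longrightarrow> multihomogeneous B \<Gamma> q"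
      "\<And>q. q \<in> Q \<Longrightarrow> q \<notin> point_of B \<Gamma> k \<phi> (\<lambda>v. line_through (s v))"
  shows "\<exists>s'. compat s' \<and> (\<forall>q\<in>Q. q \<notin> point_of B \<Gamma> k \<phi> (\<lambda>v. line_through (s' v))) \<and>
    (\<exists>v\<in>\<Gamma>. \<forall>w\<in>\<Gamma>. H v w (s' v) \<noteq> \<zero>\<^bsub>E\<^esub>)"
proof -
  interpret G: geodesic_representation k E \<Gamma> distance H
    by (rule geodesic_representation[OF special])
  have compat_iff: "compat s \<longleftrightarrow> G.compatible s" for s
    unfolding compat_def G.compatible_def ..
  let ?good = "\<lambda>s. G.compatible s \<and> (\<forall>q\<in>Q. q \<notin> point_of B \<Gamma> k \<phi> (\<lambda>v. line_through (s v)))"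
  let ?arrows = "\<lambda>s. {(v, w) \<in> \<Gamma> \<times> \<Gamma>. G.generates s v w}"
  have arrows: "?arrows s \<subseteq> \<Gamma> \<times> \<Gamma>" for s
    by blast
  have fin: "finite (\<Gamma> \<times> \<Gamma>)"
    using finite_configuration by simp
  have "card (?arrows s) < Suc (card (\<Gamma> \<times> \<Gamma>))" for s
    by (rule le_imp_less_Suc[OF card_mono[OF fin arrows]])
  then have bound: "\<forall>s. ?good s \<longrightarrow> card (?arrows s) < Suc (card (\<Gamma> \<times> \<Gamma>))"
    by (intro allI impI)
  have good: "?good s"
    using s Q(3) unfolding compat_iff by (intro conjI ballI)
  obtain s' where greatest: "?good s' \<and> (\<forall>s. ?good s \<longrightarrow> card (?arrows s) \<le> card (?arrows s'))"
    using ex_has_greatest_nat[of ?good, OF good bound] by (rule exE)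
  note s' = conjunct1[OF greatest] conjunct2[OF greatest]
  show ?thesis
  proof (cases "\<exists>v\<in>\<Gamma>. \<forall>w\<in>\<Gamma>. G.generates s' v w")
    case True
    then show ?thesis
      using s'(1) unfolding compat_iff G.generates_def by blast
  next
    case False
    obtain x where x: "\<forall>w\<in>\<Gamma>. x w \<in> carrier E"
      and deform: "\<forall>t\<in>carrier k - {\<zero>}.
        (\<forall>w\<in>\<Gamma>. s' w \<oplus>\<^bsub>E\<^esub> t \<odot>\<^bsub>E\<^esub> x w \<noteq> \<zero>\<^bsub>E\<^esub>) \<longrightarrow>
        G.compatible (\<lambda>w. s' w \<oplus>\<^bsub>E\<^esub> t \<odot>\<^bsub>E\<^esub> x w) \<and>
        ?arrows s' \<subset> ?arrows (\<lambda>w. s' w \<oplus>\<^bsub>E\<^esub> t \<odot>\<^bsub>E\<^esub> x w)"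
      by (rule G.deformation[OF conjunct1[OF s'(1)] ne False])
    have s'E: "s' w \<in> carrier E" "s' w \<noteq> \<zero>\<^bsub>E\<^esub>" if "w \<in> \<Gamma>" for w
      using s'(1) that unfolding G.compatible_def by auto
    let ?bad = "{\<zero>} \<union> (\<Union>w\<in>\<Gamma>. {t \<in> carrier k. s' w \<oplus>\<^bsub>E\<^esub> t \<odot>\<^bsub>E\<^esub> x w = \<zero>\<^bsub>E\<^esub>}) \<union>
      (\<Union>q\<in>Q. {t \<in> carrier k. q \<in> point_of B \<Gamma> k \<phi> (\<lambda>v. line_through (s' v \<oplus>\<^bsub>E\<^esub> t \<odot>\<^bsub>E\<^esub> x v))})"
    have "finite ?bad"
      using finite_zeros_of_pencil finite_vanishing_in_pencil s'E x finite_configuration Q s'(1)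
      by (intro finite_UnI finite_UN_I) auto
    then obtain t where t: "t \<in> carrier k" "t \<notin> ?bad"
      using inf by (meson finite_subset subsetI)
    let ?s = "\<lambda>w. s' w \<oplus>\<^bsub>E\<^esub> t \<odot>\<^bsub>E\<^esub> x w"
    have "t \<in> carrier k - {\<zero>}" and nz: "\<forall>w\<in>\<Gamma>. ?s w \<noteq> \<zero>\<^bsub>E\<^esub>"
      using t by auto
    then have new: "G.compatible ?s \<and> ?arrows s' \<subset> ?arrows ?s"
      by (rule bspec[OF deform, THEN mp])
    moreover have "\<forall>q\<in>Q. q \<notin> point_of B \<Gamma> k \<phi> (\<lambda>v. line_through (?s v))"
      using t by blast
    ultimately have "card (?arrows ?s) \<le> card (?arrows s')"
      using s'(2)[rule_format, of ?s] by blast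
    moreover have "card (?arrows s') < card (?arrows ?s)"
      by (rule psubset_card_mono[OF finite_subset[OF arrows fin] conjunct2[OF new]])
    ultimately show ?thesis by simp
  qed
qed

lemma simple_point_nearby:
  assumes ac: "algebraically_closed (ring_of TYPE('r) Quot (PIdl\<^bsub>ring_of TYPE('r)\<^esub> \<pi>))"
    and ne: "\<Gamma> \<noteq> {}"
    and F: "LG_field_point scale \<pi> B \<Gamma> f k \<phi> F"
    and Q: "finite Q" "\<And>q. q \<in> Q \<Longrightarrow> multihomogeneous B \<Gamma> q"
      "\<And>q. q \<in> Q \<Longrightarrow> q \<notin> point_of B \<Gamma> k \<phi> F"
  shows "\<exists>F'. simple_field_point scale \<pi> B \<Gamma> f k \<phi> F' \<and> (\<forall>q\<in>Q. q \<notin> point_of B \<Gamma> k \<phi> F')"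
proof -
  obtain s where s: "compat s" "\<And>v. v \<in> \<Gamma> \<Longrightarrow> F v = line_through (s v)"
    using F unfolding LG_field_point_iff by blast
  have Q': "q \<notin> point_of B \<Gamma> k \<phi> (\<lambda>v. line_through (s v))" if "q \<in> Q" for q
    using Q(3)[OF that] point_of_cong[of \<Gamma> F "\<lambda>v. line_through (s v)"] s(2) by metis
  have "\<exists>s'. compat s' \<and> (\<forall>q\<in>Q. q \<notin> point_of B \<Gamma> k \<phi> (\<lambda>v. line_through (s' v))) \<and>
      (\<exists>v\<in>\<Gamma>. \<forall>w\<in>\<Gamma>. H v w (s' v) \<noteq> \<zero>\<^bsub>E\<^esub>)"
  proof (cases "\<phi> \<pi> = \<zero>")
    case True
    have "\<pi> dvd a - b" if "\<phi> a = \<phi> b" for a b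
    proof -
      have "\<phi> (a - b) = \<zero>"
        using phi_add[of a "- b"] that phi_uminus phi_closed by (simp add: R.r_neg)
      then show ?thesis
        using phi_eq_zero_iff[OF True] by simp
    qed
    then have "infinite (carrier k)"
      using algebraically_closed_residue_infinite[OF ac] phi_closed by blast
    then show ?thesis
      using special_simple_point_nearby[OF True _ ne s(1) Q(1,2) Q'] by blast
  next
    case False
    obtain v where "v \<in> \<Gamma>" using ne by blast
    then show ?thesis
      using s(1) Q' H_nonzero_generic[OF False] unfolding compat_def by blast
  qed
  then show ?thesis
    using simple_field_pointI by blast
qed

end

section \<open>Density in the fibers\<close>

lemma openin_topology_generated_by_finite_Inter:
  assumes "openin (topology_generated_by \<S>) U" "p \<in> U"
  shows "\<exists>\<D>. finite \<D> \<and> \<D> \<subseteq> \<S> \<and> p \<in> \<Inter>\<D> \<and> \<Inter>\<D> \<subseteq> U"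
proof -
  have "generate_topology_on \<S> U"
    using assms(1) openin_topology_generated_by_iff by blast
  then show ?thesis
    using assms(2)
  proof (induction rule: generate_topology_on.induct)
    case (Int a b)
    then obtain \<D> \<D>' where "finite \<D>" "\<D> \<subseteq> \<S>" "p \<in> \<Inter>\<D>" "\<Inter>\<D> \<subseteq> a"
      "finite \<D>'" "\<D>' \<subseteq> \<S>" "p \<in> \<Inter>\<D>'" "\<Inter>\<D>' \<subseteq> b"
      by blast
    then show ?case
      by (intro exI[of _ "\<D> \<union> \<D>'"]) auto
  next
    case (UN K)
    then obtain V where V: "V \<in> K" "p \<in> V"
      by blast
    obtain \<D> where \<D>: "finite \<D>" "\<D> \<subseteq> \<S>" "p \<in> \<Inter>\<D>" "\<Inter>\<D> \<subseteq> V"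
      using UN.IH[OF V] by (elim exE conjE)
    have "\<Inter>\<D> \<subseteq> \<Union>K"
      using V(1) \<D>(4) by (rule subset_trans[OF _ Union_upper, rotated])
    then show ?case
      using \<D>(1-3) by (intro exI[of _ \<D>] conjI)
  next
    case (Basis s)
    then show ?case
      by (intro exI[of _ "{s}"]) auto
  qed simp
qed

text \<open>In particular, points over the same field with the same structure map lie in the same fiber.\<close>
lemma structure_map_point_of:
  fixes k :: "'e ring" and \<phi> :: "'r::idom \<Rightarrow> 'e" and \<Gamma> :: "'p set" and B :: "'b set"
  assumes "field_over TYPE('r) k \<phi>" "\<And>v. v \<in> \<Gamma> \<Longrightarrow> line B k (F v)"
  shows "structure_map (point_of B \<Gamma> k \<phi> F) = {a. \<phi> a = \<zero>\<^bsub>k\<^esub>}"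
proof -
  interpret field k
    using assms(1) unfolding field_over_def by blast
  have closed: "\<phi> a \<in> carrier k" for a
    using assms(1) ring_hom_closed[of \<phi> "ring_of TYPE('r)" k a]
    unfolding field_over_def by (simp add: ring_of_simps)
  have "\<phi> (0 + 0) = \<phi> 0 \<oplus>\<^bsub>k\<^esub> \<phi> 0"
    using assms(1) ring_hom_add[of \<phi> "ring_of TYPE('r)" k 0 0]
    unfolding field_over_def by (simp add: ring_of_simps)
  then have zero: "\<phi> 0 = \<zero>\<^bsub>k\<^esub>"
    using closed[of 0] add.r_cancel_one[of "\<phi> 0" "\<phi> 0"] by simp
  have mh: "multihomogeneous B \<Gamma> (Poly_Mapping.single 0 a :: ('p, 'b, 'r) mpoly)" for a
    unfolding multihomogeneous_def by (intro exI[of _ "\<lambda>_. 0"]) (auto simp: keys_single)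
  have ev: "eval_mpoly k \<phi> x (Poly_Mapping.single 0 a) = \<phi> a" for x :: "'p \<times> 'b \<Rightarrow> 'e" and a
    unfolding eval_mpoly_def using closed zero by (auto simp: keys_single)
  have "\<forall>v\<in>\<Gamma>. \<exists>s. s \<in> F v"
    using assms(2) unfolding line_def basis_of_line_def span1_def by blast
  then obtain s where "\<forall>v\<in>\<Gamma>. s v \<in> F v"
    unfolding bchoice_iff by blast
  then show ?thesis
    unfolding structure_map_def point_of_def using mh ev by auto
qed

theorem theorem1p4:
  fixes \<pi> :: "'r::idom"
    and scale :: "'r fract \<Rightarrow> 'v::ab_group_add \<Rightarrow> 'v"
    and B :: "'v set"
    and \<Gamma> :: "'v set set set"
    and g :: "'v set set \<Rightarrow> 'v \<Rightarrow> 'v"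
    and f :: "'v set set \<Rightarrow> 'v set set \<Rightarrow> 'v \<Rightarrow> 'v"
  assumes "discrete_valuation_ring (ring_of TYPE('r))"
    and "uniformiser (ring_of TYPE('r)) \<pi>"
    and "algebraically_closed (ring_of TYPE('r) Quot (PIdl\<^bsub>ring_of TYPE('r)\<^esub> \<pi>))"
    and "finite_dimensional_vector_space scale B"
    and "point_configuration scale \<Gamma>"
    and "\<Gamma> \<noteq> {}"
    and "convex_configuration scale \<pi> \<Gamma>"
    and "prelinked_chain scale \<pi> B \<Gamma> g f"
  shows "\<forall>\<pp>. primeideal \<pp> (ring_of TYPE('r)) \<longrightarrow>
           LG_fiber scale \<pi> B \<Gamma> f \<pp> closure_of
             (simple_locus scale \<pi> B \<Gamma> f \<inter> topspace (LG_fiber scale \<pi> B \<Gamma> f \<pp>))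
           = topspace (LG_fiber scale \<pi> B \<Gamma> f \<pp>)"
proof (intro allI impI)
  fix \<pp> :: "'r set"
  interpret V: finite_dimensional_vector_space scale B by fact
  interpret coordinates scale B ..
  interpret uniformised \<pi>
    by (rule uniformised_of_discrete_valuation_ring[OF assms(1,2)])
  let ?X = "LG_space scale \<pi> B \<Gamma> f"
  let ?Y = "LG_fiber scale \<pi> B \<Gamma> f \<pp>"
  let ?S = "simple_locus scale \<pi> B \<Gamma> f"
  have topspace: "topspace ?Y = LG_points scale \<pi> B \<Gamma> f \<inter> {p. structure_map p = \<pp>}"
    unfolding LG_fiber_def by (simp add: topspace_LG_space)
  have nearby: "\<exists>y\<in>?S \<inter> topspace ?Y. y \<in> W" if p: "p \<in> topspace ?Y" and W: "p \<in> W" "openin ?Y W" for p W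
  proof -
    obtain U where U: "openin ?X U" "W = U \<inter> {p. structure_map p = \<pp>}"
      using W(2) unfolding LG_fiber_def openin_subtopology by blast
    have pU: "p \<in> U"
      using W U by blast
    obtain \<D> where \<D>: "finite \<D>"
      "\<D> \<subseteq> {{p \<in> LG_points scale \<pi> B \<Gamma> f. q \<notin> p} | q. multihomogeneous B \<Gamma> q}"
      "p \<in> \<Inter>\<D>" "\<Inter>\<D> \<subseteq> U"
      using openin_topology_generated_by_finite_Inter[OF U(1)[unfolded LG_space_def] pU]
      by (elim exE conjE)
    have "\<forall>D\<in>\<D>. \<exists>q. multihomogeneous B \<Gamma> q \<and> D = {p \<in> LG_points scale \<pi> B \<Gamma> f. q \<notin> p}"
    proof
      fix D assume "D \<in> \<D>"
      then have "D \<in> {{p \<in> LG_points scale \<pi> B \<Gamma> f. q \<notin> p} | q. multihomogeneous B \<Gamma> q}"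
        using \<D>(2) by (rule subsetD[rotated])
      then show "\<exists>q. multihomogeneous B \<Gamma> q \<and> D = {p \<in> LG_points scale \<pi> B \<Gamma> f. q \<notin> p}"
        unfolding mem_Collect_eq by (elim exE conjE) (intro exI conjI)
    qed
    then have "\<exists>q. \<forall>D\<in>\<D>. multihomogeneous B \<Gamma> (q D) \<and>
        D = {p \<in> LG_points scale \<pi> B \<Gamma> f. q D \<notin> p}"
      by (rule bchoice)
    then obtain q where q: "\<forall>D\<in>\<D>. multihomogeneous B \<Gamma> (q D) \<and>
        D = {p \<in> LG_points scale \<pi> B \<Gamma> f. q D \<notin> p}"
      by (rule exE)
    have D_iff: "y \<in> D \<longleftrightarrow> y \<in> LG_points scale \<pi> B \<Gamma> f \<and> q D \<notin> y" if "D \<in> \<D>" for y D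
    proof -
      have D: "D = {p \<in> LG_points scale \<pi> B \<Gamma> f. q D \<notin> p}"
        using bspec[OF q that] by (elim conjE)
      have "y \<in> D \<longleftrightarrow> y \<in> {p \<in> LG_points scale \<pi> B \<Gamma> f. q D \<notin> p}"
        using arg_cong[OF D, of "\<lambda>A. y \<in> A"] .
      then show ?thesis
        unfolding mem_Collect_eq .
    qed
    obtain k :: "('v set set, 'v, 'r) universe ring" and \<phi> F where
      F: "p = point_of B \<Gamma> k \<phi> F" "LG_field_point scale \<pi> B \<Gamma> f k \<phi> F"
      using p unfolding topspace LG_points_def by blast
    have k: "field k" "\<phi> \<in> ring_hom (ring_of TYPE('r)) k" "field_over TYPE('r) k \<phi>"
      using F(2) unfolding LG_field_point_def field_over_def by auto
    interpret K: field k by (rule k(1))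
    have "line B k (F v)" if "v \<in> \<Gamma>" for v
      using F(2) that unfolding LG_field_point_def by blast
    \<comment> \<open>In a space of dimension zero there are no lines, hence no points.\<close>
    then have "B \<noteq> {}"
      using assms(6) unfolding line_def basis_of_line_def by (auto simp: restrict_def)
    have g: "g v \<in> GL scale \<and> lattice_class scale (g v ` L0) = v" if "v \<in> \<Gamma>" for v
      using assms(8) that unfolding prelinked_chain_def L0_eq_span by blast
    have Int: "lattice_class scale (L \<inter> L') \<in> \<Gamma>"
      if "v \<in> \<Gamma>" "w \<in> \<Gamma>" "L \<in> v" "L' \<in> w" for v w L L'
    proof -
      have "lattice_class scale (scale (to_fract \<pi> powi 0) ` L \<inter> scale (to_fract \<pi> powi 0) ` L') \<in> \<Gamma>"
        using assms(7) that unfolding convex_configuration_def by blast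
      then show ?thesis by simp
    qed
    interpret lattice_configuration scale B \<pi> \<Gamma> g
      using \<open>B \<noteq> {}\<close> assms(5) g Int unfolding point_configuration_def by unfold_locales auto
    interpret E: module k "kvec B k"
      by (rule kvec_module) (rule K.is_cring)
    interpret prelinked_fibre scale B \<pi> \<Gamma> g k \<phi> f
    proof unfold_locales
      show "\<phi> \<in> ring_hom (ring_of TYPE('r)) k" by (rule k(2))
      fix v w assume vw: "v \<in> \<Gamma>" "w \<in> \<Gamma>" "adjacent scale \<pi> v w"
      then obtain c where "c \<noteq> 0" "f v w = (\<lambda>x. scale c (inv_into UNIV (g w) (g v x)))"
        "normalised scale \<pi> B (f v w)"
        using assms(8) unfolding prelinked_chain_def by blast
      then show "\<exists>r. r dvd 1 \<and> f v w = (\<lambda>x. scale (to_fract r) (transition v w (distance v w) x))"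
        using edge_map_eq vw(1,2) by metis
    qed
    have "multihomogeneous B \<Gamma> r" "r \<notin> point_of B \<Gamma> k \<phi> F" if r: "r \<in> q ` \<D>" for r
    proof -
      obtain D where D: "D \<in> \<D>" "r = q D"
        using r by (rule imageE)
      show "multihomogeneous B \<Gamma> r"
        using bspec[OF q D(1)] unfolding D(2) by (elim conjE)
      have "p \<in> D"
        using \<D>(3) D(1) by (rule InterD)
      then show "r \<notin> point_of B \<Gamma> k \<phi> F"
        using D_iff[OF D(1), of p] unfolding D(2) F(1) by simp
    qed
    then obtain F' where F': "simple_field_point scale \<pi> B \<Gamma> f k \<phi> F'"
      "\<forall>r\<in>q ` \<D>. r \<notin> point_of B \<Gamma> k \<phi> F'"
      using simple_point_nearby[OF assms(3,6) F(2) finite_imageI[OF \<D>(1)], of q] by blast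
    let ?y = "point_of B \<Gamma> k \<phi> F'"
    have LG: "LG_field_point scale \<pi> B \<Gamma> f k \<phi> F'"
      using F'(1) unfolding simple_field_point_def by blast
    have y: "?y \<in> LG_points scale \<pi> B \<Gamma> f" "?y \<in> ?S"
      using LG F'(1) unfolding LG_points_def simple_locus_def by blast+
    have kernel: "structure_map (point_of B \<Gamma> k \<phi> G) = {a. \<phi> a = \<zero>\<^bsub>k\<^esub>}"
      if "LG_field_point scale \<pi> B \<Gamma> f k \<phi> G" for G
      using structure_map_point_of[OF k(3), of \<Gamma> B G] that unfolding LG_field_point_def by simp
    \<comment> \<open>The new point stays in the fiber because it is defined over the same \<open>k\<close> and \<open>\<phi>\<close>.\<close>
    have "structure_map ?y = structure_map p"
      unfolding F(1) kernel[OF F(2)] kernel[OF LG] ..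
    moreover have "structure_map p = \<pp>"
      using p unfolding topspace by blast
    moreover have "?y \<in> \<Inter>\<D>"
    proof
      fix D assume D: "D \<in> \<D>"
      then have "q D \<notin> ?y"
        using bspec[OF F'(2) imageI[OF D]] by simp
      then show "?y \<in> D"
        using D_iff[OF D, of ?y] y(1) by simp
    qed
    then have "?y \<in> U"
      using \<D>(4) by (rule subsetD[rotated])
    ultimately have "?y \<in> W" "?y \<in> topspace ?Y"
      using y(1) unfolding topspace U(2) by simp_all
    then show ?thesis
      using y(2) by (intro bexI[of _ ?y] IntI)
  qed
  have "topspace ?Y \<subseteq> ?Y closure_of (?S \<inter> topspace ?Y)"
  proof
    fix p assume p: "p \<in> topspace ?Y"
    show "p \<in> ?Y closure_of (?S \<inter> topspace ?Y)"
      unfolding in_closure_of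
    proof (intro conjI p allI impI)
      fix W assume "p \<in> W \<and> openin ?Y W"
      then show "\<exists>y. y \<in> ?S \<inter> topspace ?Y \<and> y \<in> W"
        using nearby[OF p, of W] unfolding Bex_def by (elim conjE)
    qed
  qed
  then show "?Y closure_of (?S \<inter> topspace ?Y) = topspace ?Y"
    by (intro equalityI closure_of_subset_topspace)
qed

end
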